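(* If (H4) holds in addition to (H1)--(H3) (all as written out in the context), then: (i) $\lambda R_\lambda1(x)=1$ for all $x\in E$, $\lambda>0$. (ii) $(P_t)_{t>0}$ is strong Feller on $E$, i.e. $P_t(\mathcal{B}_b(\mathbb{R}^d))\subset C_b(E)$ for all $t>0$. (iii) $P_t1(x)=1$ for all $x\in E$, $t>0$.
   Context: Write $C_0^\infty(\mathbb{R}^d)$ for smooth compactly supported functions, $\mathcal{B}_b(\mathbb{R}^d)$ for bounded Borel functions, $C_b(E)$ for bounded continuous functions on $E$, $\|\cdot\|$, $\langle\cdot,\cdot\rangle$ for the Euclidean norm and inner product; $L^q_{loc}(\mathbb{R}^d,\mu)$ consists of the $f$ with $f1_U\in L^q(\mathbb{R}^d,\mu)$ for every relatively compact open $U$; $H^{1,q}_{loc}(\mathbb{R}^d,dx)$ is the local Sobolev space and $\nabla$ the weak gradient. (H1): $\rho=\xi^2$ with $\xi\in H^{1,2}_{loc}(\mathbb{R}^d,dx)$, $\rho>0$ $dx$-a.e., and $\|\nabla\rho\|/\rho\in L^p_{loc}(\mathbb{R}^d,m)$, where $m:=\rho\,dx$ and $p:=(d+\varepsilon)\vee 2$ for some $\varepsilon>0$. Let $(\mathcal{E}^0,D(\mathcal{E}^0))$ be the closure in $L^2(\mathbb{R}^d,m)$ of $\mathcal{E}^0(f,g)=\frac12\int\langle\nabla f,\nabla g\rangle\,dm$, $f,g\in C_0^\infty(\mathbb{R}^d)$, and $\mathcal{E}^0_1(f,g)=\mathcal{E}^0(f,g)+(f,g)_{L^2(\mathbb{R}^d,m)}$.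 (H2): $B:\mathbb{R}^d\to\mathbb{R}^d$ is measurable, $\|B\|\in L^p_{loc}(\mathbb{R}^d,m)$ (same $p$), and $\int\langle B,\nabla f\rangle\,dm=0$ for all $f\in C_0^\infty(\mathbb{R}^d)$. (H3): there is a constant $c_0$ with $|\int\langle B,\nabla f\rangle g\rho\,dx|\le c_0\,\mathcal{E}^0_1(f,f)^{1/2}\mathcal{E}^0_1(g,g)^{1/2}$ for all $f,g\in C_0^\infty(\mathbb{R}^d)$. Under (H1)--(H3) the closure $(\mathcal{E},D(\mathcal{E}))$ in $L^2(\mathbb{R}^d,m)$ of $\mathcal{E}(f,g)=\frac12\int\langle\nabla f,\nabla g\rangle\,dm-\int\langle B,\nabla f\rangle g\,dm$, $f,g\in C_0^\infty(\mathbb{R}^d)$, is a non-symmetric Dirichlet form; $(T_t)_{t>0}$ and $(G_\lambda)_{\lambda>0}$ denote its (submarkovian) semigroup and resolvent, extended to $L^r(\mathbb{R}^d,m)$ for $r\in[1,\infty)$ and, for the semigroup, to $L^\infty(\mathbb{R}^d,m)$. (H4): $(\mathcal{E},D(\mathcal{E}))$ is conservative, i.e. $T_t1=1$ $m$-a.e. for some (hence all) $t>0$. $\rho$ always denotes its continuous version (which exists), and $E:=\{\rho>0\}$, an open set with $m(\mathbb{R}^d\setminus E)=0$. There is a submarkovian transition function $(P_t)_{t>0}$ on $E$ of the form $P_tf(x)=\int_E f(y)p_t(x,y)\,m(dy)$, $x\in E$, such that for every $f\in\bigcup_{r\in[p,\infty)}L^r(E,m)$ and $t>0$, $P_tf$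 is continuous on $E$ and is an $m$-version of $T_tf$. Likewise there are kernels $R_\lambda f(x)=\int f(y)r_\lambda(x,y)\,m(dy)$, $x\in E$, $\lambda>0$, such that for every $f\in L^p(E,m)$, $R_\lambda f$ is continuous on $E$ and $R_\lambda f=G_\lambda f$ $m$-a.e. These properties determine the kernels. *)

theory Defs
  imports "HOL-Analysis.Analysis"
begin

section \<open>Test functions, Lebesgue and Sobolev spaces\<close>

definition grad :: "('a::euclidean_space \<Rightarrow> real) \<Rightarrow> 'a \<Rightarrow> 'a" where
  "grad f x = (\<Sum>b\<in>Basis. frechet_derivative f (at x) b *\<^sub>R b)"

primrec C_k :: "nat \<Rightarrow> ('a::euclidean_space \<Rightarrow> real) \<Rightarrow> bool" where
  "C_k 0 f \<longleftrightarrow> continuous_on UNIV f"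
| "C_k (Suc k) f \<longleftrightarrow> (\<forall>x. f differentiable at x) \<and>
     (\<forall>b\<in>Basis. C_k k (\<lambda>x. frechet_derivative f (at x) b))"

definition test_functions :: "('a::euclidean_space \<Rightarrow> real) set" where
  "test_functions = {f. (\<forall>k. C_k k f) \<and> compact (closure {x. f x \<noteq> 0})}"

text \<open>Elements of \<open>L\<^sup>q\<close> are represented by measurable functions;
  everything below is invariant under changes on null sets.\<close>

definition Lp :: "real \<Rightarrow> 'a measure \<Rightarrow> ('a \<Rightarrow> real) set" where
  "Lp q M = {f \<in> borel_measurable M. integrable M (\<lambda>x. \<bar>f x\<bar> powr q)}"

definition Linfty :: "'a measure \<Rightarrow> ('a \<Rightarrow> real) set" where
  "Linfty M = {f \<in> borel_measurable M. \<exists>C. AE x in M. \<bar>f x\<bar> \<le> C}"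

definition Lp_norm :: "real \<Rightarrow> 'a measure \<Rightarrow> ('a \<Rightarrow> real) \<Rightarrow> real" where
  "Lp_norm q M f = (\<integral>x. \<bar>f x\<bar> powr q \<partial>M) powr (1 / q)"

definition L2_inner :: "'a measure \<Rightarrow> ('a \<Rightarrow> real) \<Rightarrow> ('a \<Rightarrow> real) \<Rightarrow> real" where
  "L2_inner M f g = (\<integral>x. f x * g x \<partial>M)"

definition Lp_loc :: "real \<Rightarrow> 'a::euclidean_space measure \<Rightarrow> ('a \<Rightarrow> real) set" where
  "Lp_loc q M = {f. \<forall>U. open U \<and> compact (closure U) \<longrightarrow> (\<lambda>x. f x * indicator U x) \<in> Lp q M}"

definition has_weak_gradient ::
    "('a::euclidean_space \<Rightarrow> real) \<Rightarrow> ('a \<Rightarrow> 'a) \<Rightarrow> bool" where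
  "has_weak_gradient u w \<longleftrightarrow>
     u \<in> Lp_loc 1 lborel \<and> w \<in> borel_measurable borel \<and> (\<lambda>x. norm (w x)) \<in> Lp_loc 1 lborel \<and>
     (\<forall>\<phi>\<in>test_functions.
        (\<integral>x. u x *\<^sub>R grad \<phi> x \<partial>lborel) = - (\<integral>x. \<phi> x *\<^sub>R w x \<partial>lborel))"

definition H1_loc :: "real \<Rightarrow> ('a::euclidean_space \<Rightarrow> real) set" where
  "H1_loc q = {u \<in> Lp_loc q lborel.
     \<exists>w. has_weak_gradient u w \<and> (\<lambda>x. norm (w x)) \<in> Lp_loc q lborel}"


section \<open>The hypotheses on the coefficients\<close>

definition m_of :: "('a::euclidean_space \<Rightarrow> real) \<Rightarrow> 'a measure" where
  "m_of \<rho> = density lborel (\<lambda>x. ennreal (\<rho> x))"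

definition E_of :: "('a::euclidean_space \<Rightarrow> real) \<Rightarrow> 'a set" where
  "E_of \<rho> = {x. 0 < \<rho> x}"

definition mE_of :: "('a::euclidean_space \<Rightarrow> real) \<Rightarrow> 'a measure" where
  "mE_of \<rho> = restrict_space (m_of \<rho>) (E_of \<rho>)"

text \<open>Here \<open>\<rho>\<close> may be any version of \<open>\<xi>\<^sup>2\<close>.\<close>
definition H1 :: "real \<Rightarrow> ('a::euclidean_space \<Rightarrow> real) \<Rightarrow> bool" where
  "H1 p \<rho> \<longleftrightarrow>
     (\<exists>\<xi>\<in>H1_loc 2. AE x in lborel. \<rho> x = (\<xi> x)\<^sup>2) \<and>
     (AE x in lborel. 0 < \<rho> x) \<and>
     (\<exists>w. has_weak_gradient \<rho> w \<and> (\<lambda>x. norm (w x) / \<rho> x) \<in> Lp_loc p (m_of \<rho>))"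

definition H2 :: "real \<Rightarrow> ('a::euclidean_space \<Rightarrow> real) \<Rightarrow> ('a \<Rightarrow> 'a) \<Rightarrow> bool" where
  "H2 p \<rho> B \<longleftrightarrow>
     B \<in> borel_measurable borel \<and> (\<lambda>x. norm (B x)) \<in> Lp_loc p (m_of \<rho>) \<and>
     (\<forall>f\<in>test_functions. (\<integral>x. B x \<bullet> grad f x \<partial>m_of \<rho>) = 0)"

definition form0 :: "('a::euclidean_space \<Rightarrow> real) \<Rightarrow> ('a \<Rightarrow> real) \<Rightarrow> ('a \<Rightarrow> real) \<Rightarrow> real" where
  "form0 \<rho> f g = 1 / 2 * (\<integral>x. grad f x \<bullet> grad g x \<partial>m_of \<rho>)"

definition form0_1 :: "('a::euclidean_space \<Rightarrow> real) \<Rightarrow> ('a \<Rightarrow> real) \<Rightarrow> ('a \<Rightarrow> real) \<Rightarrow> real" where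
  "form0_1 \<rho> f g = form0 \<rho> f g + L2_inner (m_of \<rho>) f g"

definition H3 :: "('a::euclidean_space \<Rightarrow> real) \<Rightarrow> ('a \<Rightarrow> 'a) \<Rightarrow> bool" where
  "H3 \<rho> B \<longleftrightarrow>
     (\<exists>c\<^sub>0. \<forall>f\<in>test_functions. \<forall>g\<in>test_functions.
        \<bar>\<integral>x. (B x \<bullet> grad f x) * g x * \<rho> x \<partial>lborel\<bar>
          \<le> c\<^sub>0 * sqrt (form0_1 \<rho> f f) * sqrt (form0_1 \<rho> g g))"


section \<open>Closures of forms, and their semigroups and resolvents\<close>

text \<open>\<open>(f n)\<close> is a Cauchy sequence in \<open>D\<close> for \<open>E\<^sub>1\<close> which converges to \<open>u\<close> in \<open>L\<^sup>2\<close>.\<close>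
definition form_approx ::
    "'a measure \<Rightarrow> ('a \<Rightarrow> real) set \<Rightarrow> (('a \<Rightarrow> real) \<Rightarrow> ('a \<Rightarrow> real) \<Rightarrow> real)
      \<Rightarrow> (nat \<Rightarrow> 'a \<Rightarrow> real) \<Rightarrow> ('a \<Rightarrow> real) \<Rightarrow> bool" where
  "form_approx M D E f u \<longleftrightarrow>
     (\<forall>n. f n \<in> D) \<and>
     (\<forall>e>0. \<exists>N. \<forall>i\<ge>N. \<forall>j\<ge>N. E (\<lambda>x. f i x - f j x) (\<lambda>x. f i x - f j x) < e) \<and>
     (\<lambda>n. Lp_norm 2 M (\<lambda>x. f n x - u x)) \<longlonglongrightarrow> 0"

definition closure_dom ::
    "'a measure \<Rightarrow> ('a \<Rightarrow> real) set \<Rightarrow> (('a \<Rightarrow> real) \<Rightarrow> ('a \<Rightarrow> real) \<Rightarrow> real)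
      \<Rightarrow> ('a \<Rightarrow> real) set" where
  "closure_dom M D E = {u \<in> Lp 2 M. \<exists>f. form_approx M D E f u}"

text \<open>The limit does not depend on the approximating sequences when \<open>(E, D)\<close> is
  closable and satisfies the sector condition.\<close>
definition closure_form ::
    "'a measure \<Rightarrow> ('a \<Rightarrow> real) set \<Rightarrow> (('a \<Rightarrow> real) \<Rightarrow> ('a \<Rightarrow> real) \<Rightarrow> real)
      \<Rightarrow> ('a \<Rightarrow> real) \<Rightarrow> ('a \<Rightarrow> real) \<Rightarrow> real" where
  "closure_form M D E u v =
     (THE l. \<forall>f g. form_approx M D E f u \<and> form_approx M D E g v \<longrightarrow>
        (\<lambda>n. E (f n) (g n)) \<longlonglongrightarrow> l)"

definition pre_form ::
    "('a::euclidean_space \<Rightarrow> real) \<Rightarrow> ('a \<Rightarrow> 'a) \<Rightarrow> ('a \<Rightarrow> real) \<Rightarrow> ('a \<Rightarrow> real) \<Rightarrow> real" where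
  "pre_form \<rho> B f g =
     1 / 2 * (\<integral>x. grad f x \<bullet> grad g x \<partial>m_of \<rho>) - (\<integral>x. (B x \<bullet> grad f x) * g x \<partial>m_of \<rho>)"

definition dirichlet_dom :: "('a::euclidean_space \<Rightarrow> real) \<Rightarrow> ('a \<Rightarrow> 'a) \<Rightarrow> ('a \<Rightarrow> real) set" where
  "dirichlet_dom \<rho> B = closure_dom (m_of \<rho>) test_functions (pre_form \<rho> B)"

definition dirichlet_form ::
    "('a::euclidean_space \<Rightarrow> real) \<Rightarrow> ('a \<Rightarrow> 'a) \<Rightarrow> ('a \<Rightarrow> real) \<Rightarrow> ('a \<Rightarrow> real) \<Rightarrow> real" where
  "dirichlet_form \<rho> B = closure_form (m_of \<rho>) test_functions (pre_form \<rho> B)"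

definition sc_contraction_semigroup ::
    "'a measure \<Rightarrow> (real \<Rightarrow> ('a \<Rightarrow> real) \<Rightarrow> 'a \<Rightarrow> real) \<Rightarrow> bool" where
  "sc_contraction_semigroup M T \<longleftrightarrow>
     (\<forall>t>0. \<forall>f\<in>Lp 2 M. T t f \<in> Lp 2 M \<and> Lp_norm 2 M (T t f) \<le> Lp_norm 2 M f) \<and>
     (\<forall>t>0. \<forall>f\<in>Lp 2 M. \<forall>g\<in>Lp 2 M. \<forall>a b.
        AE x in M. T t (\<lambda>y. a * f y + b * g y) x = a * T t f x + b * T t g x) \<and>
     (\<forall>s>0. \<forall>t>0. \<forall>f\<in>Lp 2 M. AE x in M. T (s + t) f x = T s (T t f) x) \<and>
     (\<forall>f\<in>Lp 2 M. ((\<lambda>t. Lp_norm 2 M (\<lambda>x. T t f x - f x)) \<longlongrightarrow> 0) (at_right 0))"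

text \<open>\<open>u\<close> lies in the domain of the \<open>L\<^sup>2\<close>-generator of \<open>T\<close>, which maps it to \<open>w\<close>.\<close>
definition has_generator_value ::
    "'a measure \<Rightarrow> (real \<Rightarrow> ('a \<Rightarrow> real) \<Rightarrow> 'a \<Rightarrow> real) \<Rightarrow> ('a \<Rightarrow> real) \<Rightarrow> ('a \<Rightarrow> real) \<Rightarrow> bool" where
  "has_generator_value M T u w \<longleftrightarrow> u \<in> Lp 2 M \<and> w \<in> Lp 2 M \<and>
     ((\<lambda>t. Lp_norm 2 M (\<lambda>x. (T t u x - u x) / t - w x)) \<longlongrightarrow> 0) (at_right 0)"

text \<open>The continuous extension of a bounded operator from \<open>L\<^sup>2 \<inter> L\<^sup>r\<close> to \<open>L\<^sup>r\<close>, \<open>r < \<infinity>\<close>.\<close>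
definition extended_to_Lp ::
    "'a measure \<Rightarrow> real \<Rightarrow> (('a \<Rightarrow> real) \<Rightarrow> 'a \<Rightarrow> real) \<Rightarrow> bool" where
  "extended_to_Lp M r S \<longleftrightarrow>
     (\<forall>f\<in>Lp r M. S f \<in> Lp r M \<and>
        (\<forall>g. (\<forall>n. g n \<in> Lp 2 M \<inter> Lp r M) \<and> (\<lambda>n. Lp_norm r M (\<lambda>x. g n x - f x)) \<longlonglongrightarrow> 0 \<longrightarrow>
           (\<lambda>n. Lp_norm r M (\<lambda>x. S (g n) x - S f x)) \<longlonglongrightarrow> 0))"

text \<open>\<open>L\<^sup>2 \<inter> L\<^sup>\<infinity>\<close> is not norm dense in \<open>L\<^sup>\<infinity>\<close>; the extension of a
  submarkovian operator is the linear one that is continuous along increasing sequences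
  of nonnegative functions.\<close>
definition extended_to_Linfty ::
    "'a measure \<Rightarrow> (('a \<Rightarrow> real) \<Rightarrow> 'a \<Rightarrow> real) \<Rightarrow> bool" where
  "extended_to_Linfty M S \<longleftrightarrow>
     (\<forall>f\<in>Linfty M. S f \<in> Linfty M) \<and>
     (\<forall>f\<in>Linfty M. \<forall>g\<in>Linfty M. \<forall>a b.
        AE x in M. S (\<lambda>y. a * f y + b * g y) x = a * S f x + b * S g x) \<and>
     (\<forall>f\<in>Linfty M. \<forall>g. (\<forall>n. g n \<in> Lp 2 M \<inter> Linfty M) \<and>
        (AE x in M. (\<forall>n. 0 \<le> g n x \<and> g n x \<le> g (Suc n) x) \<and> (\<lambda>n. g n x) \<longlonglongrightarrow> f x) \<longrightarrow>
        (AE x in M. (\<lambda>n. S (g n) x) \<longlonglongrightarrow> S f x))"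

text \<open>The generator \<open>L\<close> of \<open>T\<close> on \<open>L\<^sup>2\<close> is the operator of the form: \<open>u \<in> D(L)\<close> and
  \<open>L u = w\<close> if and only if \<open>u \<in> D(E)\<close> and \<open>E(u, v) = (-w, v)\<close> for all \<open>v \<in> D(E)\<close>.\<close>
definition is_semigroup_of_form ::
    "('a::euclidean_space \<Rightarrow> real) \<Rightarrow> ('a \<Rightarrow> 'a) \<Rightarrow> (real \<Rightarrow> ('a \<Rightarrow> real) \<Rightarrow> 'a \<Rightarrow> real) \<Rightarrow> bool" where
  "is_semigroup_of_form \<rho> B T \<longleftrightarrow>
     sc_contraction_semigroup (m_of \<rho>) T \<and>
     (\<forall>u\<in>Lp 2 (m_of \<rho>). \<forall>w\<in>Lp 2 (m_of \<rho>).
        has_generator_value (m_of \<rho>) T u w \<longleftrightarrow>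
        u \<in> dirichlet_dom \<rho> B \<and>
        (\<forall>v\<in>dirichlet_dom \<rho> B. dirichlet_form \<rho> B u v = - L2_inner (m_of \<rho>) w v)) \<and>
     (\<forall>t>0. (\<forall>r\<ge>1. extended_to_Lp (m_of \<rho>) r (T t)) \<and> extended_to_Linfty (m_of \<rho>) (T t))"

definition is_resolvent_of_form ::
    "('a::euclidean_space \<Rightarrow> real) \<Rightarrow> ('a \<Rightarrow> 'a) \<Rightarrow> (real \<Rightarrow> ('a \<Rightarrow> real) \<Rightarrow> 'a \<Rightarrow> real) \<Rightarrow> bool" where
  "is_resolvent_of_form \<rho> B G \<longleftrightarrow>
     (\<forall>\<alpha>>0. \<forall>f\<in>Lp 2 (m_of \<rho>). G \<alpha> f \<in> dirichlet_dom \<rho> B \<and>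
        (\<forall>v\<in>dirichlet_dom \<rho> B.
           dirichlet_form \<rho> B (G \<alpha> f) v + \<alpha> * L2_inner (m_of \<rho>) (G \<alpha> f) v
             = L2_inner (m_of \<rho>) f v)) \<and>
     (\<forall>\<alpha>>0. \<forall>r\<ge>1. extended_to_Lp (m_of \<rho>) r (G \<alpha>))"

definition H4 :: "('a::euclidean_space \<Rightarrow> real) \<Rightarrow> (real \<Rightarrow> ('a \<Rightarrow> real) \<Rightarrow> 'a \<Rightarrow> real) \<Rightarrow> bool" where
  "H4 \<rho> T \<longleftrightarrow> (\<exists>t>0. AE x in m_of \<rho>. T t (\<lambda>_. 1) x = 1)"


section \<open>Kernels with densities\<close>

definition kernel_density :: "'a measure \<Rightarrow> ('a \<Rightarrow> 'a \<Rightarrow> real) \<Rightarrow> bool" where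
  "kernel_density N k \<longleftrightarrow>
     (\<forall>x\<in>space N. k x \<in> borel_measurable N \<and> (\<forall>y\<in>space N. 0 \<le> k x y)) \<and>
     (\<forall>A\<in>sets N. (\<lambda>x. emeasure (density N (k x)) A) \<in> borel_measurable N)"

definition kernel_op :: "'a measure \<Rightarrow> ('a \<Rightarrow> 'a \<Rightarrow> real) \<Rightarrow> ('a \<Rightarrow> real) \<Rightarrow> 'a \<Rightarrow> real" where
  "kernel_op N k f x = (\<integral>y. f y * k x y \<partial>N)"

definition submarkovian_transition_density ::
    "'a measure \<Rightarrow> (real \<Rightarrow> 'a \<Rightarrow> 'a \<Rightarrow> real) \<Rightarrow> bool" where
  "submarkovian_transition_density N k \<longleftrightarrow>
     (\<forall>t>0. kernel_density N (k t) \<and>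
        (\<forall>x\<in>space N. emeasure (density N (k t x)) (space N) \<le> 1)) \<and>
     (\<forall>s>0. \<forall>t>0. \<forall>x\<in>space N. \<forall>A\<in>sets N.
        emeasure (density N (k (s + t) x)) A
          = (\<integral>\<^sup>+ y. emeasure (density N (k t y)) A \<partial>density N (k s x)))"

text \<open>The integrability clauses say that the defining integrals of \<open>P\<^sub>t f\<close> and \<open>R\<^sub>\<alpha> f\<close> exist at
  every point of \<open>E\<close> (a Bochner integral that does not exist is \<open>0\<close> by convention).\<close>

definition is_transition_density ::
    "real \<Rightarrow> ('a::euclidean_space \<Rightarrow> real) \<Rightarrow> (real \<Rightarrow> ('a \<Rightarrow> real) \<Rightarrow> 'a \<Rightarrow> real)
      \<Rightarrow> (real \<Rightarrow> 'a \<Rightarrow> 'a \<Rightarrow> real) \<Rightarrow> bool" where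
  "is_transition_density p \<rho> T k \<longleftrightarrow>
     submarkovian_transition_density (mE_of \<rho>) k \<and>
     (\<forall>r\<ge>p. \<forall>f\<in>Lp r (m_of \<rho>). \<forall>t>0.
        (\<forall>x\<in>E_of \<rho>. integrable (mE_of \<rho>) (\<lambda>y. f y * k t x y)) \<and>
        continuous_on (E_of \<rho>) (kernel_op (mE_of \<rho>) (k t) f) \<and>
        (AE x in mE_of \<rho>. kernel_op (mE_of \<rho>) (k t) f x = T t f x))"

definition is_resolvent_density ::
    "real \<Rightarrow> ('a::euclidean_space \<Rightarrow> real) \<Rightarrow> (real \<Rightarrow> ('a \<Rightarrow> real) \<Rightarrow> 'a \<Rightarrow> real)
      \<Rightarrow> (real \<Rightarrow> 'a \<Rightarrow> 'a \<Rightarrow> real) \<Rightarrow> bool" where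
  "is_resolvent_density p \<rho> G k \<longleftrightarrow>
     (\<forall>\<alpha>>0. kernel_density (mE_of \<rho>) (k \<alpha>) \<and>
       (\<forall>f\<in>Lp p (m_of \<rho>).
          (\<forall>x\<in>E_of \<rho>. integrable (mE_of \<rho>) (\<lambda>y. f y * k \<alpha> x y)) \<and>
          continuous_on (E_of \<rho>) (kernel_op (mE_of \<rho>) (k \<alpha>) f) \<and>
          (AE x in mE_of \<rho>. kernel_op (mE_of \<rho>) (k \<alpha>) f x = G \<alpha> f x)))"

end

theory Submission
  imports Defs
begin

text \<open>By the semigroup law of the kernels, \<open>c(x) = P\<^sub>t 1(x)\<close> does not depend on \<open>t\<close>, and (H4) gives
  \<open>c = 1\<close> almost everywhere; no mass may be lost at the exceptional points either. For a test
  function \<open>f\<close>, the function \<open>L f\<close> lies in \<open>L\<^sup>p\<close>, hence \<open>f = R\<^sub>1 (f - L f)\<close> everywhere on \<open>E\<close>. Since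
  \<open>G\<^sub>\<alpha> h - e\<^bsup>-\<alpha>t\<^esup> T\<^sub>t G\<^sub>\<alpha> h = G\<^sub>\<alpha> (h - e\<^bsup>-\<alpha>t\<^esup> T\<^sub>t h)\<close> and since \<open>h \<mapsto> R\<^sub>\<alpha> h(x)\<close> is a continuous functional
  on \<open>L\<^sup>p\<close>, this implies \<open>P\<^sub>t f(x) \<longrightarrow> f(x)\<close> as \<open>t \<longrightarrow> 0\<close>, for every \<open>x \<in> E\<close>. The same holds for \<open>f\<^sup>2\<close>, so
  \<open>0 \<le> P\<^sub>t (f - f(x))\<^sup>2 (x) \<longrightarrow> f(x)\<^sup>2 (c(x) - 1)\<close>, and \<open>c(x) = 1\<close> if \<open>f(x) \<noteq> 0\<close>.

  The strong Feller property follows by truncation to balls, whose complements have locally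
  uniformly small mass. Finally \<open>U = R\<^sub>\<alpha> 1\<close> equals \<open>1/\<alpha>\<close> almost everywhere and is \<open>\<alpha>\<close>-excessive at every
  point, so \<open>e\<^bsup>-\<alpha>t\<^esup>/\<alpha> = e\<^bsup>-\<alpha>t\<^esup> P\<^sub>t U(x) \<le> U(x) \<le> 1/\<alpha>\<close>, and \<open>t \<longrightarrow> 0\<close>.\<close>


section \<open>The space \<open>L\<^sup>2\<close>\<close>

text \<open>The obstacle is that \<open>1\<close> need not lie in any \<open>L\<^sup>r\<close> with
  finite \<open>r\<close>. The continuity assumed for the kernels therefore says nothing about
  \<open>P\<^sub>t 1\<close> and \<open>R\<^sub>\<alpha> 1\<close>. Truncation to balls presents
  both as increasing limits of continuous functions, so a priori they are only lower semicontinuous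
  and may drop below their almost sure value at single points.

  Strong continuity of \<open>T\<close> is given in \<open>L\<^sup>2\<close>, while the functional
  \<open>h \<mapsto> R\<^sub>\<alpha> h(x)\<close> lives on \<open>L\<^sup>p\<close>, and
  \<open>L f\<close> is as unbounded as the drift. Hence the small-time limit is proved for bounded
  \<open>h\<close> first, where \<open>L\<^sup>2\<close> convergence interpolates to
  \<open>L\<^sup>p\<close>.

  Resolvents are not written as Laplace integrals of the semigroup. They are handled as solutions of
  \<open>\<alpha> u - A u = h\<close> with \<open>A\<close> the generator of \<open>T\<close>,
  tested against \<open>L\<^sup>2\<close> functions, so that only real functions of time have to be
  differentiated or integrated.\<close>

lemma Lp_2_iff: "f \<in> Lp 2 M \<longleftrightarrow> f \<in> borel_measurable M \<and> integrable M (\<lambda>x. (f x)\<^sup>2)"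
  unfolding Lp_def by simp

lemma Lp_2_measurable: "f \<in> Lp 2 M \<Longrightarrow> f \<in> borel_measurable M"
  by (simp add: Lp_2_iff)

lemma Lp_norm_2_eq: "Lp_norm 2 M f = sqrt (\<integral>x. (f x)\<^sup>2 \<partial>M)"
  unfolding Lp_norm_def by (simp add: powr_half_sqrt)

lemma Lp_norm_2_nonneg: "0 \<le> Lp_norm 2 M f"
  by (simp add: Lp_norm_2_eq)

lemma Lp_norm_2_power2: "(Lp_norm 2 M f)\<^sup>2 = (\<integral>x. (f x)\<^sup>2 \<partial>M)"
  by (simp add: Lp_norm_2_eq)

lemma Lp_2_integrable_mult:
  assumes "f \<in> Lp 2 M" "g \<in> Lp 2 M"
  shows "integrable M (\<lambda>x. f x * g x)"
proof (rule Bochner_Integration.integrable_bound)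
  show "integrable M (\<lambda>x. (f x)\<^sup>2 + (g x)\<^sup>2)"
    using assms by (simp add: Lp_2_iff)
  show "(\<lambda>x. f x * g x) \<in> borel_measurable M"
    using assms by (auto simp: Lp_2_iff)
  have "\<bar>a * b\<bar> \<le> a\<^sup>2 + b\<^sup>2" for a b :: real
  proof -
    have "2 * (\<bar>a\<bar> * \<bar>b\<bar>) \<le> \<bar>a\<bar>\<^sup>2 + \<bar>b\<bar>\<^sup>2"
      using sum_squares_bound[of "\<bar>a\<bar>" "\<bar>b\<bar>"] by simp
    moreover have "0 \<le> \<bar>a\<bar> * \<bar>b\<bar>" by simp
    ultimately show ?thesis unfolding abs_mult power2_abs by linarith
  qed
  then show "AE x in M. norm (f x * g x) \<le> norm ((f x)\<^sup>2 + (g x)\<^sup>2)"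
    by simp
qed

lemma Lp_2_lincomb:
  assumes "f \<in> Lp 2 M" "g \<in> Lp 2 M"
  shows "(\<lambda>x. a * f x + b * g x) \<in> Lp 2 M"
proof -
  have "integrable M (\<lambda>x. a\<^sup>2 * (f x)\<^sup>2 + b\<^sup>2 * (g x)\<^sup>2 + 2 * a * b * (f x * g x))"
    using assms Lp_2_integrable_mult[OF assms] by (simp add: Lp_2_iff)
  moreover have "a\<^sup>2 * (f x)\<^sup>2 + b\<^sup>2 * (g x)\<^sup>2 + 2 * a * b * (f x * g x) = (a * f x + b * g x)\<^sup>2" for x
    by (simp add: power2_eq_square algebra_simps)
  ultimately show ?thesis
    using assms by (auto simp: Lp_2_iff)
qed

lemma Lp_2_diff: "f \<in> Lp 2 M \<Longrightarrow> g \<in> Lp 2 M \<Longrightarrow> (\<lambda>x. f x - g x) \<in> Lp 2 M"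
  using Lp_2_lincomb[of f M g 1 "-1"] by simp

lemma Lp_2_cmult: "f \<in> Lp 2 M \<Longrightarrow> (\<lambda>x. a * f x) \<in> Lp 2 M"
  using Lp_2_lincomb[of f M f a 0] by simp

lemma Lp_2_divide: "f \<in> Lp 2 M \<Longrightarrow> (\<lambda>x. f x / a) \<in> Lp 2 M"
  using Lp_2_cmult[of f M "1/a"] by simp

lemma Lp_2_zero: "(\<lambda>x. 0) \<in> Lp 2 M"
  by (simp add: Lp_2_iff)

lemma Lp_2_bound:
  assumes "f \<in> Lp 2 M" "g \<in> borel_measurable M" "AE x in M. \<bar>g x\<bar> \<le> \<bar>f x\<bar>"
  shows "g \<in> Lp 2 M"
proof -
  have "integrable M (\<lambda>x. (g x)\<^sup>2)"
  proof (rule Bochner_Integration.integrable_bound[where f = "\<lambda>x. (f x)\<^sup>2"])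
    show "AE x in M. norm ((g x)\<^sup>2) \<le> norm ((f x)\<^sup>2)"
      using assms(3) by eventually_elim (simp add: abs_le_square_iff)
  qed (use assms in \<open>auto simp: Lp_2_iff\<close>)
  with assms show ?thesis by (simp add: Lp_2_iff)
qed

lemma Lp_norm_2_cong_AE:
  assumes "f \<in> borel_measurable M" "g \<in> borel_measurable M" "AE x in M. f x = g x"
  shows "Lp_norm 2 M f = Lp_norm 2 M g"
proof -
  have "(\<integral>x. (f x)\<^sup>2 \<partial>M) = (\<integral>x. (g x)\<^sup>2 \<partial>M)"
    by (rule integral_cong_AE) (use assms in auto)
  then show ?thesis by (simp add: Lp_norm_2_eq)
qed

lemma Lp_norm_2_eq_0_iff:
  assumes "f \<in> Lp 2 M"
  shows "Lp_norm 2 M f = 0 \<longleftrightarrow> (AE x in M. f x = 0)"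
  using assms integral_nonneg_eq_0_iff_AE[of M "\<lambda>x. (f x)\<^sup>2"] by (simp add: Lp_norm_2_eq Lp_2_iff)

lemma L2_inner_commute: "L2_inner M f g = L2_inner M g f"
  by (simp add: L2_inner_def mult.commute)

lemma L2_inner_self: "L2_inner M f f = (Lp_norm 2 M f)\<^sup>2"
  unfolding Lp_norm_2_power2 by (simp add: L2_inner_def power2_eq_square)

lemma L2_inner_lincomb:
  assumes "f \<in> Lp 2 M" "g \<in> Lp 2 M" "v \<in> Lp 2 M"
  shows "L2_inner M (\<lambda>x. a * f x + b * g x) v = a * L2_inner M f v + b * L2_inner M g v"
  using Lp_2_integrable_mult[OF assms(1,3)] Lp_2_integrable_mult[OF assms(2,3)]
  by (simp add: L2_inner_def algebra_simps)

lemma L2_inner_diff: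
  assumes "f \<in> Lp 2 M" "g \<in> Lp 2 M" "v \<in> Lp 2 M"
  shows "L2_inner M (\<lambda>x. f x - g x) v = L2_inner M f v - L2_inner M g v"
  using L2_inner_lincomb[OF assms, of 1 "-1"] by simp

lemma L2_inner_cmult: "L2_inner M (\<lambda>x. a * f x) v = a * L2_inner M f v"
  by (simp add: L2_inner_def mult.assoc)

lemma L2_inner_cong_AE:
  assumes "f \<in> borel_measurable M" "g \<in> borel_measurable M" "v \<in> borel_measurable M"
    and "AE x in M. f x = g x"
  shows "L2_inner M f v = L2_inner M g v"
  unfolding L2_inner_def by (rule integral_cong_AE) (use assms in auto)

lemma L2_inner_mono_AE:
  assumes "f \<in> Lp 2 M" "g \<in> Lp 2 M" "v \<in> Lp 2 M"
    and "AE x in M. f x \<le> g x" "\<And>x. 0 \<le> v x"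
  shows "L2_inner M f v \<le> L2_inner M g v"
  unfolding L2_inner_def
proof (rule integral_mono_AE)
  show "AE x in M. f x * v x \<le> g x * v x"
    using assms(4) by eventually_elim (simp add: assms(5) mult_right_mono)
qed (use assms Lp_2_integrable_mult in auto)

text \<open>The squared norm of \<open>s f + t g\<close> is a nonnegative quadratic form in
  \<open>s\<close> and \<open>t\<close>, so its discriminant has a sign.\<close>

lemma L2_Cauchy_Schwarz:
  assumes "f \<in> Lp 2 M" "g \<in> Lp 2 M"
  shows "\<bar>L2_inner M f g\<bar> \<le> Lp_norm 2 M f * Lp_norm 2 M g"
proof -
  define a b c where "a = (Lp_norm 2 M f)\<^sup>2" and "b = L2_inner M f g" and "c = (Lp_norm 2 M g)\<^sup>2"
  have q: "0 \<le> s\<^sup>2 * a + 2 * s * t * b + t\<^sup>2 * c" for s t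
  proof -
    let ?h = "\<lambda>x. s * f x + t * g x"
    have h: "?h \<in> Lp 2 M"
      using assms by (rule Lp_2_lincomb)
    have "L2_inner M ?h f = s * a + t * b" "L2_inner M ?h g = s * b + t * c"
      using assms by (simp_all add: L2_inner_lincomb a_def b_def c_def L2_inner_self
          L2_inner_commute[of M g f])
    then have "L2_inner M ?h ?h = s * (s * a + t * b) + t * (s * b + t * c)"
      using L2_inner_lincomb[OF assms h, of s t] by (simp add: L2_inner_commute[of M f ?h] L2_inner_commute[of M g ?h])
    moreover have "0 \<le> L2_inner M ?h ?h"
      by (simp add: L2_inner_self)
    ultimately show ?thesis
      by (simp add: power2_eq_square algebra_simps)
  qed
  have "b\<^sup>2 \<le> a * c"
  proof (cases "a = 0")
    case True
    show ?thesis
    proof (rule ccontr)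
      assume "\<not> ?thesis"
      then have "b \<noteq> 0" using True by auto
      \<comment> \<open>For \<open>a = 0\<close> and \<open>t = 1\<close> the form is
        \<open>2 s b + c\<close>; the chosen \<open>s\<close> gives it the value
        \<open>-1\<close>.\<close>
      then show False
        using q[of "-(c + 1) / (2 * b)" 1] True by (simp add: field_simps)
    qed
  next
    case False
    then have "a > 0" by (simp add: a_def)
    moreover have "0 \<le> a * (a * c - b\<^sup>2)"
      using q[of "-b" a] by (simp add: power2_eq_square algebra_simps)
    ultimately show ?thesis by (simp add: zero_le_mult_iff)
  qed
  then have "\<bar>b\<bar>\<^sup>2 \<le> (Lp_norm 2 M f * Lp_norm 2 M g)\<^sup>2"
    by (simp add: a_def c_def power_mult_distrib)
  then show ?thesis
    unfolding b_def by (rule power2_le_imp_le) (simp add: Lp_norm_2_nonneg)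
qed

lemma Lp_norm_2_triangle:
  assumes "f \<in> Lp 2 M" "g \<in> Lp 2 M"
  shows "Lp_norm 2 M (\<lambda>x. f x + g x) \<le> Lp_norm 2 M f + Lp_norm 2 M g"
proof (rule power2_le_imp_le)
  have "(\<integral>x. (f x + g x)\<^sup>2 \<partial>M) = (\<integral>x. (f x)\<^sup>2 + (g x)\<^sup>2 + 2 * (f x * g x) \<partial>M)"
    by (rule Bochner_Integration.integral_cong) (auto simp: power2_eq_square algebra_simps)
  also have "\<dots> = (Lp_norm 2 M f)\<^sup>2 + (Lp_norm 2 M g)\<^sup>2 + 2 * L2_inner M f g"
    using assms Lp_2_integrable_mult[OF assms]
    by (simp add: Lp_norm_2_power2 L2_inner_def Lp_2_iff)
  finally show "(Lp_norm 2 M (\<lambda>x. f x + g x))\<^sup>2 \<le> (Lp_norm 2 M f + Lp_norm 2 M g)\<^sup>2"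
    using L2_Cauchy_Schwarz[OF assms] by (simp add: Lp_norm_2_power2[of M "\<lambda>x. f x + g x"] power2_sum)
qed (simp add: Lp_norm_2_nonneg)

lemma Lp_norm_2_cmult: "Lp_norm 2 M (\<lambda>x. a * f x) = \<bar>a\<bar> * Lp_norm 2 M f"
  by (simp add: Lp_norm_2_eq power_mult_distrib real_sqrt_mult)

text \<open>Testing against the negative part \<open>v\<close> of \<open>f\<close> gives minus the
  squared norm of \<open>v\<close>, so \<open>v\<close> vanishes.\<close>

lemma AE_nonneg_if_L2_inner_nonneg:
  assumes f: "f \<in> Lp 2 M"
    and nonneg: "\<And>v. v \<in> Lp 2 M \<Longrightarrow> (\<And>x. 0 \<le> v x) \<Longrightarrow> 0 \<le> L2_inner M f v"
  shows "AE x in M. 0 \<le> f x"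
proof -
  define v where "v = (\<lambda>x. max 0 (- f x))"
  have v: "v \<in> Lp 2 M"
    by (rule Lp_2_bound[OF f]) (use f in \<open>auto simp: v_def Lp_2_iff\<close>)
  have "f x * v x = - (v x)\<^sup>2" for x
    by (simp add: v_def power2_eq_square max_def)
  then have "0 \<le> - (Lp_norm 2 M v)\<^sup>2"
    using nonneg[OF v] by (simp add: v_def L2_inner_def Lp_norm_2_power2)
  then have "AE x in M. v x = 0"
    using Lp_norm_2_eq_0_iff[OF v] by simp
  then show ?thesis
    by eventually_elim (simp add: v_def max_def split: if_splits)
qed

lemma AE_le_if_L2_inner_le:
  assumes "f \<in> Lp 2 M" "g \<in> Lp 2 M"
    and "\<And>v. v \<in> Lp 2 M \<Longrightarrow> (\<And>x. 0 \<le> v x) \<Longrightarrow> L2_inner M f v \<le> L2_inner M g v"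
  shows "AE x in M. f x \<le> g x"
proof -
  have "AE x in M. 0 \<le> g x - f x"
    by (rule AE_nonneg_if_L2_inner_nonneg) (use assms in \<open>auto intro: Lp_2_diff simp: L2_inner_diff\<close>)
  then show ?thesis by simp
qed


section \<open>Contraction semigroups on \<open>L\<^sup>2\<close>\<close>

text \<open>The hypotheses leave \<open>T 0\<close> unspecified. Setting it to the identity makes
  orbits defined and weakly continuous on the closed half-line, as needed for derivatives and
  integrals that start at time 0.\<close>

definition orbit :: "(real \<Rightarrow> ('a \<Rightarrow> real) \<Rightarrow> 'a \<Rightarrow> real) \<Rightarrow> real \<Rightarrow> ('a \<Rightarrow> real) \<Rightarrow> 'a \<Rightarrow> real" where
  "orbit T t f = (if t = 0 then f else T t f)"

lemma orbit_0 [simp]: "orbit T 0 f = f"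
  by (simp add: orbit_def)

lemma orbit_pos [simp]: "0 < t \<Longrightarrow> orbit T t f = T t f"
  by (simp add: orbit_def)

lemma exp_discount_tendsto_0:
  fixes \<alpha> :: real
  assumes "0 < \<alpha>"
  shows "((\<lambda>t. exp (- \<alpha> * t)) \<longlongrightarrow> 0) at_top"
proof (rule filterlim_compose[OF exp_at_bot])
  show "filterlim (\<lambda>t. - \<alpha> * t) at_bot at_top"
    using assms by (intro filterlim_tendsto_neg_mult_at_bot[OF tendsto_const]) (auto intro: filterlim_ident)
qed

lemma exp_at_right_0: "((\<lambda>t. exp (a * t)) \<longlongrightarrow> 1) (at_right 0)" for a :: real
proof -
  have "((\<lambda>t. exp (a * t)) \<longlongrightarrow> exp (a * 0)) (at_right 0)"
    by (intro tendsto_intros)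
  then show ?thesis by simp
qed

text \<open>At time 0 only a one-sided derivative is available, hence the derivative within
  \<open>{0..}\<close>. The sign comparisons between resolvents and semigroups below reduce to this
  fact.\<close>

lemma nonincreasing_if_derivative_within_nonpos:
  fixes \<phi> :: "real \<Rightarrow> real"
  assumes der: "\<And>t. 0 \<le> t \<Longrightarrow> (\<phi> has_real_derivative D t) (at t within {0..})"
    and "\<And>t. 0 \<le> t \<Longrightarrow> D t \<le> 0" and "0 \<le> s"
  shows "\<phi> s \<le> \<phi> 0"
proof (rule DERIV_nonpos_imp_decreasing_open[OF \<open>0 \<le> s\<close>])
  show "\<exists>y. DERIV \<phi> x :> y \<and> y \<le> 0" if "0 < x" "x < s" for x
  proof -
    have "at x within {0..} = at x"
      using that by (intro at_within_interior) (auto simp: interior_real_atLeast)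
    then show ?thesis
      using der[of x] assms(2)[of x] that by auto
  qed
  show "continuous_on {0..s} \<phi>"
    using der by (auto simp: continuous_on_eq_continuous_within
        intro!: DERIV_continuous DERIV_subset[OF der])
qed

locale L2_contraction_semigroup =
  fixes M :: "'a measure" and T :: "real \<Rightarrow> ('a \<Rightarrow> real) \<Rightarrow> 'a \<Rightarrow> real"
  assumes semigroup: "sc_contraction_semigroup M T"
begin

lemma orbit_Lp: "0 \<le> t \<Longrightarrow> f \<in> Lp 2 M \<Longrightarrow> orbit T t f \<in> Lp 2 M"
  using semigroup by (auto simp: sc_contraction_semigroup_def orbit_def)

lemma orbit_norm_le: "0 \<le> t \<Longrightarrow> f \<in> Lp 2 M \<Longrightarrow> Lp_norm 2 M (orbit T t f) \<le> Lp_norm 2 M f"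
  using semigroup by (auto simp: sc_contraction_semigroup_def orbit_def)

lemma orbit_lincomb:
  "0 \<le> t \<Longrightarrow> f \<in> Lp 2 M \<Longrightarrow> g \<in> Lp 2 M \<Longrightarrow>
    AE x in M. orbit T t (\<lambda>y. a * f y + b * g y) x = a * orbit T t f x + b * orbit T t g x"
  using semigroup by (auto simp: sc_contraction_semigroup_def orbit_def)

lemma orbit_diff:
  "0 \<le> t \<Longrightarrow> f \<in> Lp 2 M \<Longrightarrow> g \<in> Lp 2 M \<Longrightarrow>
    AE x in M. orbit T t (\<lambda>y. f y - g y) x = orbit T t f x - orbit T t g x"
  using orbit_lincomb[of t f g 1 "-1"] by simp

lemma orbit_add:
  "0 \<le> s \<Longrightarrow> 0 \<le> t \<Longrightarrow> f \<in> Lp 2 M \<Longrightarrow>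
    AE x in M. orbit T (s + t) f x = orbit T s (orbit T t f) x"
  using semigroup by (cases "s = 0"; cases "t = 0") (auto simp: sc_contraction_semigroup_def orbit_def)

lemma orbit_strongly_continuous:
  "f \<in> Lp 2 M \<Longrightarrow> ((\<lambda>t. Lp_norm 2 M (\<lambda>x. orbit T t f x - f x)) \<longlongrightarrow> 0) (at_right 0)"
proof -
  assume "f \<in> Lp 2 M"
  then have "((\<lambda>t. Lp_norm 2 M (\<lambda>x. T t f x - f x)) \<longlongrightarrow> 0) (at_right 0)"
    using semigroup by (auto simp: sc_contraction_semigroup_def)
  moreover have "\<forall>\<^sub>F t in at_right (0::real). Lp_norm 2 M (\<lambda>x. T t f x - f x)
      = Lp_norm 2 M (\<lambda>x. orbit T t f x - f x)"
    by (auto simp: eventually_at_filter orbit_def)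
  ultimately show ?thesis
    by (rule Lim_transform_eventually)
qed

lemma inner_orbit_le:
  assumes "0 \<le> t" "f \<in> Lp 2 M" "v \<in> Lp 2 M"
  shows "\<bar>L2_inner M (orbit T t f) v\<bar> \<le> Lp_norm 2 M f * Lp_norm 2 M v"
  using L2_Cauchy_Schwarz[OF orbit_Lp[OF assms(1,2)] assms(3)] orbit_norm_le[OF assms(1,2)]
  by (meson Lp_norm_2_nonneg mult_right_mono order_trans)

lemma inner_orbit_lincomb:
  assumes "0 \<le> t" "f \<in> Lp 2 M" "g \<in> Lp 2 M" "v \<in> Lp 2 M"
  shows "L2_inner M (orbit T t (\<lambda>x. a * f x + b * g x)) v
    = a * L2_inner M (orbit T t f) v + b * L2_inner M (orbit T t g) v"
proof -
  have "L2_inner M (orbit T t (\<lambda>x. a * f x + b * g x)) v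
      = L2_inner M (\<lambda>x. a * orbit T t f x + b * orbit T t g x) v"
    by (rule L2_inner_cong_AE)
      (use assms orbit_lincomb in \<open>auto intro!: Lp_2_measurable orbit_Lp Lp_2_lincomb\<close>)
  then show ?thesis
    using assms by (simp add: L2_inner_lincomb orbit_Lp)
qed

lemma inner_orbit_diff:
  assumes "0 \<le> t" "f \<in> Lp 2 M" "g \<in> Lp 2 M" "v \<in> Lp 2 M"
  shows "L2_inner M (orbit T t (\<lambda>x. f x - g x)) v
    = L2_inner M (orbit T t f) v - L2_inner M (orbit T t g) v"
  using inner_orbit_lincomb[OF assms, of 1 "-1"] by simp

lemma inner_orbit_add:
  assumes "0 \<le> s" "0 \<le> t" "f \<in> Lp 2 M" "v \<in> Lp 2 M"
  shows "L2_inner M (orbit T (s + t) f) v = L2_inner M (orbit T s (orbit T t f)) v"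
  by (rule L2_inner_cong_AE) (use assms orbit_add in \<open>auto intro!: Lp_2_measurable orbit_Lp\<close>)

text \<open>Since \<open>T a\<close> is a contraction, the modulus \<open>\<omega>\<close> at time 0
  bounds the increment over \<open>[a, a + s]\<close> for every \<open>a\<close>. Taking
  \<open>a\<close> as the earlier of the two times turns right continuity at 0 into two-sided
  continuity.\<close>

lemma inner_orbit_continuous:
  assumes f: "f \<in> Lp 2 M" and v: "v \<in> Lp 2 M" and t: "0 \<le> t"
  shows "((\<lambda>s. L2_inner M (orbit T s f) v) \<longlongrightarrow> L2_inner M (orbit T t f) v) (at t within {0..})"
proof -
  define \<phi> where "\<phi> s = L2_inner M (orbit T s f) v" for s
  define \<omega> where "\<omega> s = Lp_norm 2 M (\<lambda>x. orbit T s f x - f x) * Lp_norm 2 M v" for s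
  have step: "\<bar>\<phi> (a + s) - \<phi> a\<bar> \<le> \<omega> s" if "0 \<le> a" "0 \<le> s" for a s
  proof -
    have "\<phi> (a + s) - \<phi> a = L2_inner M (orbit T a (\<lambda>x. orbit T s f x - f x)) v"
      using that f v by (simp add: \<phi>_def inner_orbit_add inner_orbit_diff orbit_Lp)
    then show ?thesis
      unfolding \<omega>_def using that f v by (simp add: inner_orbit_le orbit_Lp Lp_2_diff)
  qed
  have "(\<omega> \<longlongrightarrow> 0) (at_right 0)"
    unfolding \<omega>_def using orbit_strongly_continuous[OF f] by (rule tendsto_mult_left_zero)
  moreover have "filterlim (\<lambda>s. \<bar>s - t\<bar>) (at_right 0) (at t within {0..})"
    by (auto simp: filterlim_at eventually_at_filter intro!: tendsto_eq_intros)
  ultimately have "((\<lambda>s. \<omega> \<bar>s - t\<bar>) \<longlongrightarrow> 0) (at t within {0..})"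
    by (rule filterlim_compose)
  moreover have "norm (\<phi> s - \<phi> t) \<le> \<omega> \<bar>s - t\<bar>" if "s \<in> {0..}" for s
    using step[of t "s - t"] step[of s "t - s"] that t by (cases "t \<le> s") (auto simp: abs_minus_commute)
  then have "\<forall>\<^sub>F s in at t within {0..}. norm (\<phi> s - \<phi> t) \<le> \<omega> \<bar>s - t\<bar>"
    by (simp add: eventually_at_filter)
  ultimately have "((\<lambda>s. \<phi> s - \<phi> t) \<longlongrightarrow> 0) (at t within {0..})"
    by (rule Lim_null_comparison[rotated])
  then show ?thesis
    by (simp add: LIM_zero_iff \<phi>_def)
qed

text \<open>Contractivity transports the error \<open>\<omega>\<close> of the difference quotient at
  0 to every base point. For a left quotient the base point is the moving time \<open>s\<close>, so
  the comparison is with \<open>D s\<close>, and weak continuity replaces \<open>D s\<close> by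
  \<open>D t\<close>.\<close>

lemma inner_orbit_has_derivative:
  assumes gen: "has_generator_value M T u w" and v: "v \<in> Lp 2 M" and t: "0 \<le> t"
  shows "((\<lambda>s. L2_inner M (orbit T s u) v) has_real_derivative L2_inner M (orbit T t w) v)
    (at t within {0..})"
proof -
  have u: "u \<in> Lp 2 M" and w: "w \<in> Lp 2 M"
    using gen by (auto simp: has_generator_value_def)
  define \<phi> where "\<phi> s = L2_inner M (orbit T s u) v" for s
  define D where "D s = L2_inner M (orbit T s w) v" for s
  define q where "q s x = (orbit T s u x - u x) / s - w x" for s x
  define \<omega> where "\<omega> s = Lp_norm 2 M (q s) * Lp_norm 2 M v" for s
  have q: "q s \<in> Lp 2 M" if "0 < s" for s
    unfolding q_def using that u w by (intro Lp_2_diff Lp_2_divide orbit_Lp) auto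
  have step: "\<bar>(\<phi> (a + s) - \<phi> a) / s - D a\<bar> \<le> \<omega> s" if "0 \<le> a" "0 < s" for a s
  proof -
    have "L2_inner M (orbit T a (q s)) v
        = L2_inner M (orbit T a (\<lambda>x. (1 / s) * (orbit T s u x - u x) + (- 1) * w x)) v"
      by (simp add: q_def[abs_def])
    also have "\<dots> = (\<phi> (a + s) - \<phi> a) / s - D a"
      using that u v w
      by (subst inner_orbit_lincomb)
        (auto simp: \<phi>_def D_def inner_orbit_add inner_orbit_diff orbit_Lp Lp_2_diff diff_divide_distrib
          simp del: orbit_pos)
    finally show ?thesis
      unfolding \<omega>_def using inner_orbit_le[OF that(1) q[OF that(2)] v] by simp
  qed
  have "((\<lambda>s. Lp_norm 2 M (q s)) \<longlongrightarrow> 0) (at_right 0)"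
  proof (rule Lim_transform_eventually)
    show "((\<lambda>s. Lp_norm 2 M (\<lambda>x. (T s u x - u x) / s - w x)) \<longlongrightarrow> 0) (at_right 0)"
      using gen by (simp add: has_generator_value_def)
    show "\<forall>\<^sub>F s in at_right 0. Lp_norm 2 M (\<lambda>x. (T s u x - u x) / s - w x) = Lp_norm 2 M (q s)"
      by (auto simp: eventually_at_filter q_def[abs_def] orbit_def)
  qed
  then have "(\<omega> \<longlongrightarrow> 0) (at_right 0)"
    unfolding \<omega>_def by (rule tendsto_mult_left_zero)
  moreover have "filterlim (\<lambda>s. \<bar>s - t\<bar>) (at_right 0) (at t within {0..})"
    by (auto simp: filterlim_at eventually_at_filter intro!: tendsto_eq_intros)
  ultimately have "((\<lambda>s. \<omega> \<bar>s - t\<bar>) \<longlongrightarrow> 0) (at t within {0..})"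
    by (rule filterlim_compose)
  moreover have "((\<lambda>s. \<bar>D s - D t\<bar>) \<longlongrightarrow> 0) (at t within {0..})"
    unfolding D_def using inner_orbit_continuous[OF w v t] by (simp add: LIM_zero tendsto_rabs_zero)
  ultimately have "((\<lambda>s. \<omega> \<bar>s - t\<bar> + \<bar>D s - D t\<bar>) \<longlongrightarrow> 0) (at t within {0..})"
    by (rule tendsto_add_zero)
  moreover have "norm ((\<phi> s - \<phi> t) / (s - t) - D t) \<le> \<omega> \<bar>s - t\<bar> + \<bar>D s - D t\<bar>"
    if s: "s \<in> {0..}" "s \<noteq> t" for s
  proof (cases "t < s")
    case True
    then show ?thesis using step[of t "s - t"] t by simp
  next
    case False
    then have "s < t" using s by simp
    moreover have "(\<phi> t - \<phi> s) / (t - s) = (\<phi> s - \<phi> t) / (s - t)"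
      by (metis minus_diff_eq minus_divide_divide)
    ultimately show ?thesis using step[of s "t - s"] s by simp
  qed
  then have "\<forall>\<^sub>F s in at t within {0..}.
      norm ((\<phi> s - \<phi> t) / (s - t) - D t) \<le> \<omega> \<bar>s - t\<bar> + \<bar>D s - D t\<bar>"
    by (simp add: eventually_at_filter)
  ultimately have "((\<lambda>s. (\<phi> s - \<phi> t) / (s - t) - D t) \<longlongrightarrow> 0) (at t within {0..})"
    by (rule Lim_null_comparison[rotated])
  then show ?thesis
    by (simp add: has_field_derivative_iff LIM_zero_iff \<phi>_def D_def)
qed

section \<open>Rules for generator values\<close>

lemma generator_value_Lp:
  assumes "has_generator_value M T u w"
  shows "u \<in> Lp 2 M" "w \<in> Lp 2 M"
  using assms by (auto simp: has_generator_value_def)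

lemma generator_value_lincomb:
  assumes 1: "has_generator_value M T u w" and 2: "has_generator_value M T u' w'"
  shows "has_generator_value M T (\<lambda>x. a * u x + b * u' x) (\<lambda>x. a * w x + b * w' x)"
proof -
  note L = generator_value_Lp[OF 1] generator_value_Lp[OF 2]
  define q where "q s x = (T s u x - u x) / s - w x" for s x
  define q' where "q' s x = (T s u' x - u' x) / s - w' x" for s x
  let ?c = "\<lambda>x. a * u x + b * u' x"
  have q: "q s \<in> Lp 2 M" "q' s \<in> Lp 2 M" if "0 < s" for s
    unfolding q_def q'_def using that L orbit_Lp[of s u] orbit_Lp[of s u']
    by (auto intro!: Lp_2_diff Lp_2_divide)
  have "((\<lambda>s. \<bar>a\<bar> * Lp_norm 2 M (q s) + \<bar>b\<bar> * Lp_norm 2 M (q' s)) \<longlongrightarrow> 0) (at_right 0)"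
    using 1 2 by (auto simp: has_generator_value_def q_def[abs_def] q'_def[abs_def] intro!: tendsto_add_zero tendsto_mult_right_zero)
  moreover have "norm (Lp_norm 2 M (\<lambda>x. (T s ?c x - ?c x) / s - (a * w x + b * w' x)))
      \<le> \<bar>a\<bar> * Lp_norm 2 M (q s) + \<bar>b\<bar> * Lp_norm 2 M (q' s)" if s: "0 < s" for s
  proof -
    have c: "?c \<in> Lp 2 M" using L by (simp add: Lp_2_lincomb)
    have "Lp_norm 2 M (\<lambda>x. (T s ?c x - ?c x) / s - (a * w x + b * w' x))
        = Lp_norm 2 M (\<lambda>x. a * q s x + b * q' s x)"
    proof (rule Lp_norm_2_cong_AE)
      show "AE x in M. (T s ?c x - ?c x) / s - (a * w x + b * w' x) = a * q s x + b * q' s x"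
        using orbit_lincomb[of s u u' a b] s L
        by (auto simp: q_def q'_def diff_divide_distrib add_divide_distrib algebra_simps elim!: eventually_mono)
    qed (use q[OF s] orbit_Lp[OF _ c, of s] s L c in
        \<open>auto intro!: Lp_2_measurable Lp_2_diff Lp_2_divide Lp_2_lincomb\<close>)
    also have "\<dots> \<le> Lp_norm 2 M (\<lambda>x. a * q s x) + Lp_norm 2 M (\<lambda>x. b * q' s x)"
      by (rule Lp_norm_2_triangle) (use q[OF s] in \<open>auto intro: Lp_2_cmult\<close>)
    finally show ?thesis
      by (simp add: Lp_norm_2_cmult Lp_norm_2_nonneg)
  qed
  then have "\<forall>\<^sub>F s in at_right 0.
      norm (Lp_norm 2 M (\<lambda>x. (T s ?c x - ?c x) / s - (a * w x + b * w' x)))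
      \<le> \<bar>a\<bar> * Lp_norm 2 M (q s) + \<bar>b\<bar> * Lp_norm 2 M (q' s)"
    by (auto simp: eventually_at_filter)
  ultimately have "((\<lambda>s. Lp_norm 2 M (\<lambda>x. (T s ?c x - ?c x) / s - (a * w x + b * w' x))) \<longlongrightarrow> 0) (at_right 0)"
    by (rule Lim_null_comparison[rotated])
  with L show ?thesis
    by (simp add: has_generator_value_def Lp_2_lincomb)
qed

lemma generator_value_cong_AE:
  assumes gen: "has_generator_value M T u w" and w': "w' \<in> Lp 2 M" and eq: "AE x in M. w x = w' x"
  shows "has_generator_value M T u w'"
proof -
  note L = generator_value_Lp[OF gen]
  have "((\<lambda>s. Lp_norm 2 M (\<lambda>x. (T s u x - u x) / s - w' x)) \<longlongrightarrow> 0) (at_right 0)"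
  proof (rule Lim_transform_eventually)
    show "((\<lambda>s. Lp_norm 2 M (\<lambda>x. (T s u x - u x) / s - w x)) \<longlongrightarrow> 0) (at_right 0)"
      using gen by (simp add: has_generator_value_def)
    have "Lp_norm 2 M (\<lambda>x. (T s u x - u x) / s - w x) = Lp_norm 2 M (\<lambda>x. (T s u x - u x) / s - w' x)"
      if "0 < s" for s
    proof (rule Lp_norm_2_cong_AE)
      show "AE x in M. (T s u x - u x) / s - w x = (T s u x - u x) / s - w' x"
        using eq by eventually_elim simp
    qed (use L w' orbit_Lp[of s u] that in \<open>auto intro!: Lp_2_measurable Lp_2_diff Lp_2_divide\<close>)
    then show "\<forall>\<^sub>F s in at_right 0. Lp_norm 2 M (\<lambda>x. (T s u x - u x) / s - w x)
        = Lp_norm 2 M (\<lambda>x. (T s u x - u x) / s - w' x)"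
      by (auto simp: eventually_at_filter)
  qed
  with L w' show ?thesis by (simp add: has_generator_value_def)
qed

text \<open>\<open>T t\<close> commutes with \<open>T s\<close> and is a contraction, so the error
  of the quotient for \<open>T t u\<close> is at most that for \<open>u\<close>.\<close>

lemma generator_value_orbit:
  assumes gen: "has_generator_value M T u w" and t: "0 < t"
  shows "has_generator_value M T (T t u) (T t w)"
proof -
  note L = generator_value_Lp[OF gen]
  note LT = orbit_Lp[OF less_imp_le[OF t] L(1)] orbit_Lp[OF less_imp_le[OF t] L(2)]
  define q where "q s x = (1 / s) * (T s u x - u x) + (- 1) * w x" for s x
  have q: "q s \<in> Lp 2 M" if "0 < s" for s
    unfolding q_def using that L orbit_Lp[of s u] by (intro Lp_2_lincomb Lp_2_diff) auto
  have "((\<lambda>s. Lp_norm 2 M (q s)) \<longlongrightarrow> 0) (at_right 0)"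
    using gen by (simp add: has_generator_value_def q_def[abs_def])
  moreover have "norm (Lp_norm 2 M (\<lambda>x. (T s (T t u) x - T t u x) / s - T t w x)) \<le> Lp_norm 2 M (q s)"
    if s: "0 < s" for s
  proof -
    have "AE x in M. T s (T t u) x = T t (T s u) x"
      using orbit_add[of s t u] orbit_add[of t s u] s t L
      by (auto simp: add.commute elim: eventually_elim2)
    moreover have "AE x in M. T t (q s) x = (1 / s) * T t (\<lambda>x. T s u x - u x) x + (- 1) * T t w x"
      using orbit_lincomb[of t "\<lambda>x. T s u x - u x" w "1/s" "-1"] s t L orbit_Lp[of s u]
      by (simp add: q_def[abs_def] Lp_2_diff)
    moreover have "AE x in M. T t (\<lambda>x. T s u x - u x) x = T t (T s u) x - T t u x"
      using orbit_diff[of t "T s u" u] s t L orbit_Lp[of s u] by simp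
    ultimately have "AE x in M. (T s (T t u) x - T t u x) / s - T t w x = T t (q s) x"
      by eventually_elim (simp add: diff_divide_distrib)
    then have "Lp_norm 2 M (\<lambda>x. (T s (T t u) x - T t u x) / s - T t w x) = Lp_norm 2 M (T t (q s))"
      by (rule Lp_norm_2_cong_AE[rotated 2])
        (use orbit_Lp[of t "q s"] orbit_Lp[of s "T t u"] q[OF s] s t LT in
          \<open>auto intro!: Lp_2_measurable Lp_2_diff Lp_2_divide\<close>)
    also have "\<dots> \<le> Lp_norm 2 M (q s)"
      using orbit_norm_le[of t "q s"] t q[OF s] by simp
    finally show ?thesis by (simp add: Lp_norm_2_nonneg)
  qed
  then have "\<forall>\<^sub>F s in at_right 0.
      norm (Lp_norm 2 M (\<lambda>x. (T s (T t u) x - T t u x) / s - T t w x)) \<le> Lp_norm 2 M (q s)"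
    by (auto simp: eventually_at_filter)
  ultimately have "((\<lambda>s. Lp_norm 2 M (\<lambda>x. (T s (T t u) x - T t u x) / s - T t w x)) \<longlongrightarrow> 0) (at_right 0)"
    by (rule Lim_null_comparison[rotated])
  with LT t show ?thesis
    by (simp add: has_generator_value_def)
qed

section \<open>Resolvent equations studied through discounted orbits\<close>

lemma discounted_orbit_has_derivative:
  assumes gen: "has_generator_value M T u (\<lambda>x. \<alpha> * u x - h x)"
    and h: "h \<in> Lp 2 M" and v: "v \<in> Lp 2 M" and t: "0 \<le> t"
  shows "((\<lambda>s. exp (- \<alpha> * s) * L2_inner M (orbit T s u) v) has_real_derivative
      - exp (- \<alpha> * t) * L2_inner M (orbit T t h) v) (at t within {0..})"
proof -
  \<comment> \<open>The hypothesis says \<open>A u = \<alpha> u - h\<close>. The discount factor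
    cancels the term \<open>\<alpha> u\<close> in the product rule, and only \<open>h\<close>
    remains.\<close>
  have "L2_inner M (orbit T t (\<lambda>x. \<alpha> * u x - h x)) v
      = \<alpha> * L2_inner M (orbit T t u) v - L2_inner M (orbit T t h) v"
    using inner_orbit_lincomb[OF t generator_value_Lp(1)[OF gen] h v, of \<alpha> "-1"] by simp
  with inner_orbit_has_derivative[OF gen v t]
  have "((\<lambda>s. L2_inner M (orbit T s u) v) has_real_derivative
      \<alpha> * L2_inner M (orbit T t u) v - L2_inner M (orbit T t h) v) (at t within {0..})"
    by simp
  then show ?thesis
    by (auto intro!: derivative_eq_intros simp: algebra_simps)
qed

lemma discounted_orbit_tendsto_0:
  assumes u: "u \<in> Lp 2 M" and v: "v \<in> Lp 2 M" and "0 < \<alpha>"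
  shows "((\<lambda>t. exp (- \<alpha> * t) * L2_inner M (orbit T t u) v) \<longlongrightarrow> 0) at_top"
proof (rule Lim_null_comparison)
  show "((\<lambda>t. exp (- \<alpha> * t) * (Lp_norm 2 M u * Lp_norm 2 M v)) \<longlongrightarrow> 0) at_top"
    by (intro tendsto_mult_left_zero exp_discount_tendsto_0 \<open>0 < \<alpha>\<close>)
  show "\<forall>\<^sub>F t in at_top. norm (exp (- \<alpha> * t) * L2_inner M (orbit T t u) v)
      \<le> exp (- \<alpha> * t) * (Lp_norm 2 M u * Lp_norm 2 M v)"
    using eventually_ge_at_top[of 0]
    by eventually_elim (simp add: abs_mult inner_orbit_le u v)
qed

text \<open>The difference of two solutions solves the equation with right side 0. Its discounted
  orbit therefore does not move, yet it tends to 0 because orbits stay bounded.\<close>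

lemma resolvent_equation_unique:
  assumes 1: "has_generator_value M T u (\<lambda>x. \<alpha> * u x - h x)"
    and 2: "has_generator_value M T u' (\<lambda>x. \<alpha> * u' x - h x)" and "0 < \<alpha>"
  shows "AE x in M. u x = u' x"
proof -
  define d where "d x = 1 * u x + (-1) * u' x" for x
  have gen: "has_generator_value M T d (\<lambda>x. \<alpha> * d x - 0)"
    using generator_value_lincomb[OF 1 2, of 1 "-1"] by (simp add: d_def[abs_def] algebra_simps)
  have d: "d \<in> Lp 2 M" by (rule generator_value_Lp[OF gen])
  have "L2_inner M d v \<le> 0" if v: "v \<in> Lp 2 M" for v
  proof -
    have z: "L2_inner M (orbit T t (\<lambda>x. 0)) v = 0" if "0 \<le> t" for t
      using inner_orbit_le[OF that Lp_2_zero v] by (simp add: Lp_norm_2_eq)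
    define \<phi> where "\<phi> t = - (exp (- \<alpha> * t) * L2_inner M (orbit T t d) v)" for t
    have "(\<phi> has_real_derivative 0) (at t within {0..})" if "0 \<le> t" for t
      using DERIV_minus[OF discounted_orbit_has_derivative[OF gen Lp_2_zero v that]] z[OF that]
      by (simp add: \<phi>_def[abs_def])
    then have "\<phi> s \<le> \<phi> 0" if "0 \<le> s" for s
      using nonincreasing_if_derivative_within_nonpos[of \<phi> "\<lambda>_. 0" s] that by simp
    then have "\<forall>\<^sub>F s in at_top. \<phi> s \<le> \<phi> 0"
      using eventually_mono[OF eventually_ge_at_top[of "0::real"], of "\<lambda>s. \<phi> s \<le> \<phi> 0"] by blast
    moreover have "(\<phi> \<longlongrightarrow> - 0) at_top"
      unfolding \<phi>_def by (intro tendsto_minus discounted_orbit_tendsto_0 d v \<open>0 < \<alpha>\<close>)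
    ultimately have "- 0 \<le> \<phi> 0"
      by (intro tendsto_upperbound) auto
    then show ?thesis by (simp add: \<phi>_def)
  qed
  from this[OF d] have "Lp_norm 2 M d = 0"
    by (simp add: L2_inner_self)
  then have "AE x in M. d x = 0"
    using Lp_norm_2_eq_0_iff[OF d] by simp
  then show ?thesis by eventually_elim (simp add: d_def)
qed

text \<open>If \<open>T s h\<close> is nonnegative for all \<open>s\<close>, then the derivative of
  the discounted orbit of \<open>u\<close>, tested against \<open>v \<ge> 0\<close>, is
  nonpositive.\<close>

lemma resolvent_excessive:
  assumes gen: "has_generator_value M T u (\<lambda>x. \<alpha> * u x - h x)"
    and h: "h \<in> Lp 2 M" and pos: "\<And>s. 0 \<le> s \<Longrightarrow> AE x in M. 0 \<le> orbit T s h x"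
    and t: "0 < t"
  shows "AE x in M. exp (- \<alpha> * t) * T t u x \<le> u x"
proof (rule AE_le_if_L2_inner_le)
  have u: "u \<in> Lp 2 M" by (rule generator_value_Lp[OF gen])
  show "u \<in> Lp 2 M" "(\<lambda>x. exp (- \<alpha> * t) * T t u x) \<in> Lp 2 M"
    using u orbit_Lp[of t u] t by (auto intro: Lp_2_cmult)
  fix v :: "'a \<Rightarrow> real" assume v: "v \<in> Lp 2 M" "\<And>x. 0 \<le> v x"
  have "0 \<le> L2_inner M (orbit T s h) v" if "0 \<le> s" for s
    using L2_inner_mono_AE[OF Lp_2_zero orbit_Lp[OF that h] v(1) pos[OF that] v(2)]
    by (simp add: L2_inner_def)
  then have "exp (- \<alpha> * t) * L2_inner M (orbit T t u) v \<le> exp (- \<alpha> * 0) * L2_inner M (orbit T 0 u) v"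
    using t by (intro nonincreasing_if_derivative_within_nonpos[OF
          discounted_orbit_has_derivative[OF gen h v(1)]]) auto
  then show "L2_inner M (\<lambda>x. exp (- \<alpha> * t) * T t u x) v \<le> L2_inner M u v"
    using t by (simp add: L2_inner_cmult)
qed

text \<open>The weak form of \<open>\<alpha> u \<le> 1\<close>. As \<open>1\<close> need not be in
  \<open>L\<^sup>2\<close>, it enters through \<open>integral\<^sup>L M v\<close> for integrable
  \<open>v\<close>. The discounted orbit is compared with
  \<open>exp (- \<alpha> * t) * V / \<alpha>\<close>, the orbit of the formal solution
  \<open>1 / \<alpha>\<close>; both vanish at infinity.\<close>

lemma resolvent_le:
  assumes gen: "has_generator_value M T u (\<lambda>x. \<alpha> * u x - h x)"
    and h: "h \<in> Lp 2 M" and le: "\<And>s. 0 \<le> s \<Longrightarrow> AE x in M. orbit T s h x \<le> 1"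
    and v: "v \<in> Lp 2 M" "\<And>x. 0 \<le> v x" "integrable M v" and "0 < \<alpha>"
  shows "\<alpha> * L2_inner M u v \<le> integral\<^sup>L M v"
proof -
  have u: "u \<in> Lp 2 M" by (rule generator_value_Lp[OF gen])
  define V where "V = integral\<^sup>L M v"
  define \<phi> where "\<phi> t = exp (- \<alpha> * t) * V / \<alpha> - exp (- \<alpha> * t) * L2_inner M (orbit T t u) v" for t
  have "L2_inner M (orbit T s h) v \<le> V" if "0 \<le> s" for s
    unfolding L2_inner_def V_def
  proof (rule integral_mono_AE)
    show "AE x in M. orbit T s h x * v x \<le> v x"
      using le[OF that] by eventually_elim (use v(2) mult_right_mono[where b = 1] in fastforce)
  qed (use v orbit_Lp[OF that h] Lp_2_integrable_mult in auto)
  then have "\<phi> t \<le> \<phi> 0" if "0 \<le> t" for t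
  proof (intro nonincreasing_if_derivative_within_nonpos[where \<phi> = \<phi> and
        D = "\<lambda>s. exp (- \<alpha> * s) * (L2_inner M (orbit T s h) v - V)"])
    show "(\<phi> has_real_derivative exp (- \<alpha> * s) * (L2_inner M (orbit T s h) v - V)) (at s within {0..})"
      if "0 \<le> s" for s
    proof -
      have "((\<lambda>t. exp (- \<alpha> * t) * V / \<alpha>) has_real_derivative - exp (- \<alpha> * s) * V) (at s within {0..})"
        using \<open>0 < \<alpha>\<close> by (auto intro!: derivative_eq_intros)
      from DERIV_diff[OF this discounted_orbit_has_derivative[OF gen h v(1) that]] show ?thesis
        by (simp add: \<phi>_def[abs_def] algebra_simps)
    qed
  qed (use that in \<open>auto simp: mult_le_0_iff\<close>)
  then have "\<forall>\<^sub>F s in at_top. \<phi> s \<le> \<phi> 0"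
    using eventually_mono[OF eventually_ge_at_top[of "0::real"], of "\<lambda>s. \<phi> s \<le> \<phi> 0"] by blast
  moreover have "((\<lambda>t. exp (- \<alpha> * t) * V / \<alpha>) \<longlongrightarrow> 0) at_top"
    by (intro tendsto_divide_zero tendsto_mult_left_zero exp_discount_tendsto_0 \<open>0 < \<alpha>\<close>)
  then have "(\<phi> \<longlongrightarrow> 0 - 0) at_top"
    unfolding \<phi>_def by (intro tendsto_diff discounted_orbit_tendsto_0 u v \<open>0 < \<alpha>\<close>)
  ultimately have "0 - 0 \<le> \<phi> 0"
    by (intro tendsto_upperbound) auto
  then show ?thesis
    using \<open>0 < \<alpha>\<close> by (simp add: \<phi>_def V_def field_simps)
qed

text \<open>The weak form of \<open>1 \<le> \<alpha> U\<close> for any upper bound \<open>U\<close>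
  of all \<open>u n\<close>, where \<open>c\<close> stands for \<open>U\<close> tested against
  \<open>v\<close>. Integrating the derivative of the discounted orbit over
  \<open>[0, \<tau>]\<close> and dropping the nonnegative end term bounds the discounted integral of
  \<open>T s (h n)\<close> by \<open>c\<close>. Dominated convergence in \<open>n\<close>, on the
  compact interval, comes before \<open>\<tau> \<rightarrow> \<infinity>\<close>.\<close>

lemma resolvent_ge_limit:
  assumes gen: "\<And>n. has_generator_value M T (u n) (\<lambda>x. \<alpha> * u n x - h n x)"
    and h: "\<And>n. h n \<in> Lp 2 M"
    and bound: "\<And>n s. 0 \<le> s \<Longrightarrow> AE x in M. \<bar>orbit T s (h n) x\<bar> \<le> 1"
    and lim: "\<And>s. 0 \<le> s \<Longrightarrow> AE x in M. (\<lambda>n. orbit T s (h n) x) \<longlonglongrightarrow> 1"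
    and pos: "\<And>n s. 0 \<le> s \<Longrightarrow> AE x in M. 0 \<le> orbit T s (u n) x"
    and v: "v \<in> Lp 2 M" "\<And>x. 0 \<le> v x" "integrable M v" and "0 < \<alpha>"
    and le: "\<And>n. L2_inner M (u n) v \<le> c"
  shows "integral\<^sup>L M v \<le> \<alpha> * c"
proof -
  have u: "u n \<in> Lp 2 M" for n by (rule generator_value_Lp[OF gen])
  define V where "V = integral\<^sup>L M v"
  have *: "(1 - exp (- \<alpha> * \<tau>)) * V \<le> \<alpha> * c" if "0 < \<tau>" for \<tau>
  proof -
    define F where "F n s = exp (- \<alpha> * s) * L2_inner M (orbit T s (h n)) v" for n s
    have int: "((\<lambda>s. F n s) has_integral
        L2_inner M (u n) v - exp (- \<alpha> * \<tau>) * L2_inner M (orbit T \<tau> (u n)) v) {0..\<tau>}" for n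
    proof -
      have "((\<lambda>s. - (- exp (- \<alpha> * s) * L2_inner M (orbit T s (h n)) v)) has_integral
          - (exp (- \<alpha> * \<tau>) * L2_inner M (orbit T \<tau> (u n)) v - exp (- \<alpha> * 0) * L2_inner M (orbit T 0 (u n)) v)) {0..\<tau>}"
        using that
        by (intro has_integral_neg fundamental_theorem_of_calculus)
          (auto simp flip: has_real_derivative_iff_has_vector_derivative
            intro!: DERIV_subset[OF discounted_orbit_has_derivative[OF gen h v(1), unfolded mult_minus_left]])
      then show ?thesis by (simp add: F_def)
    qed
    have "((\<lambda>s. exp (- \<alpha> * s) * V) has_integral (- exp (- \<alpha> * \<tau>) / \<alpha> * V) - (- exp (- \<alpha> * 0) / \<alpha> * V)) {0..\<tau>}"
      using that \<open>0 < \<alpha>\<close>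
      by (intro fundamental_theorem_of_calculus)
        (auto simp flip: has_real_derivative_iff_has_vector_derivative intro!: derivative_eq_intros)
    then have lim_int: "((\<lambda>s. exp (- \<alpha> * s) * V) has_integral ((1 - exp (- \<alpha> * \<tau>)) / \<alpha> * V)) {0..\<tau>}"
      by (simp add: field_simps diff_divide_distrib)
    have conv: "(\<lambda>n. L2_inner M (orbit T s (h n)) v) \<longlonglongrightarrow> V" if "0 \<le> s" for s
    proof -
      have "(\<lambda>n. \<integral>x. orbit T s (h n) x * v x \<partial>M) \<longlonglongrightarrow> (\<integral>x. v x \<partial>M)"
      proof (rule integral_dominated_convergence[where w = v])
        show "AE x in M. (\<lambda>n. orbit T s (h n) x * v x) \<longlonglongrightarrow> v x"
          using lim[OF that] by eventually_elim (auto intro!: tendsto_eq_intros)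
        show "AE x in M. norm (orbit T s (h n) x * v x) \<le> v x" for n
          using bound[OF that, of n] by eventually_elim (simp add: abs_mult v(2) mult_left_le_one_le)
      qed (use v Lp_2_measurable[OF orbit_Lp[OF that h]] in auto)
      then show ?thesis by (simp add: L2_inner_def V_def)
    qed
    have "\<bar>L2_inner M (orbit T s (h n)) v\<bar> \<le> V" if "0 \<le> s" for s n
    proof -
      have "\<bar>L2_inner M (orbit T s (h n)) v\<bar> \<le> (\<integral>x. \<bar>orbit T s (h n) x * v x\<bar> \<partial>M)"
        unfolding L2_inner_def by (rule integral_abs_bound)
      also have "\<dots> \<le> V"
        unfolding V_def
      proof (rule integral_mono_AE)
        show "AE x in M. \<bar>orbit T s (h n) x * v x\<bar> \<le> v x"
          using bound[OF that, of n] by eventually_elim (simp add: abs_mult v(2) mult_left_le_one_le)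
      qed (use v Lp_2_integrable_mult[OF orbit_Lp[OF that h] v(1)] in auto)
      finally show ?thesis .
    qed
    moreover have "F n integrable_on {0..\<tau>}" for n
      using int by (rule has_integral_integrable)
    ultimately have "(\<lambda>n. integral {0..\<tau>} (F n)) \<longlonglongrightarrow> integral {0..\<tau>} (\<lambda>s. exp (- \<alpha> * s) * V)"
      using int lim_int conv
      by (intro dominated_convergence(2)[where h = "\<lambda>s. exp (- \<alpha> * s) * V"])
        (auto simp: F_def abs_mult intro!: tendsto_intros)
    moreover have "integral {0..\<tau>} (F n) \<le> c" for n
    proof -
      have "0 \<le> L2_inner M (orbit T \<tau> (u n)) v"
        using L2_inner_mono_AE[OF Lp_2_zero orbit_Lp[OF _ u] v(1) pos v(2), of \<tau> n] that
        by (simp add: L2_inner_def)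
      then have "0 \<le> exp (- \<alpha> * \<tau>) * L2_inner M (orbit T \<tau> (u n)) v" by simp
      with le[of n] integral_unique[OF int, of n] show ?thesis by linarith
    qed
    ultimately have "integral {0..\<tau>} (\<lambda>s. exp (- \<alpha> * s) * V) \<le> c"
      by (intro tendsto_upperbound) auto
    then have "(1 - exp (- \<alpha> * \<tau>)) / \<alpha> * V \<le> c"
      unfolding integral_unique[OF lim_int] .
    then show ?thesis
      using \<open>0 < \<alpha>\<close> by (simp add: field_simps)
  qed
  have "((\<lambda>\<tau>. (1 - exp (- \<alpha> * \<tau>)) * V) \<longlongrightarrow> (1 - 0) * V) at_top"
    by (intro tendsto_intros exp_discount_tendsto_0 \<open>0 < \<alpha>\<close>)
  moreover have "\<forall>\<^sub>F \<tau> in at_top. (1 - exp (- \<alpha> * \<tau>)) * V \<le> \<alpha> * c"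
    using eventually_gt_at_top[of 0] by eventually_elim (rule *)
  ultimately have "(1 - 0) * V \<le> \<alpha> * c"
    by (rule tendsto_upperbound) simp
  then show ?thesis by (simp add: V_def)
qed

end


section \<open>Positive functionals on \<open>L\<^sup>p\<close>\<close>

lemma Lp_measurable: "f \<in> Lp q M \<Longrightarrow> f \<in> borel_measurable M"
  by (simp add: Lp_def)

lemma Lp_integrable: "f \<in> Lp q M \<Longrightarrow> integrable M (\<lambda>x. \<bar>f x\<bar> powr q)"
  by (simp add: Lp_def)

lemma Lp_bound:
  assumes "f \<in> Lp q M" "g \<in> borel_measurable M" "AE x in M. \<bar>g x\<bar> \<le> \<bar>f x\<bar>" "0 \<le> q"
  shows "g \<in> Lp q M"
proof -
  have "integrable M (\<lambda>x. \<bar>g x\<bar> powr q)"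
  proof (rule Bochner_Integration.integrable_bound[where f = "\<lambda>x. \<bar>f x\<bar> powr q"])
    show "AE x in M. norm (\<bar>g x\<bar> powr q) \<le> norm (\<bar>f x\<bar> powr q)"
      using assms(3) by eventually_elim (simp add: powr_mono2 assms(4))
  qed (use assms in \<open>auto simp: Lp_def\<close>)
  with assms show ?thesis by (simp add: Lp_def)
qed

lemma Lp_abs: "f \<in> Lp q M \<Longrightarrow> (\<lambda>x. \<bar>f x\<bar>) \<in> Lp q M"
  by (auto simp: Lp_def)

lemma Lp_cmult: "f \<in> Lp q M \<Longrightarrow> (\<lambda>x. c * f x) \<in> Lp q M"
  by (auto simp: Lp_def abs_mult powr_mult)

lemma Lp_add:
  assumes f: "f \<in> Lp q M" and g: "g \<in> Lp q M" and "0 \<le> q"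
  shows "(\<lambda>x. f x + g x) \<in> Lp q M"
proof -
  have m: "f \<in> borel_measurable M" "g \<in> borel_measurable M"
    using f g by (auto simp: Lp_def)
  have *: "\<bar>a + b\<bar> powr q \<le> 2 powr q * (\<bar>a\<bar> powr q + \<bar>b\<bar> powr q)" for a b :: real
  proof -
    have "\<bar>a + b\<bar> \<le> 2 * max \<bar>a\<bar> \<bar>b\<bar>" by linarith
    then have "\<bar>a + b\<bar> powr q \<le> (2 * max \<bar>a\<bar> \<bar>b\<bar>) powr q"
      by (rule powr_mono2[OF \<open>0 \<le> q\<close>, rotated]) simp
    also have "\<dots> = 2 powr q * max \<bar>a\<bar> \<bar>b\<bar> powr q"
      by (simp add: powr_mult)
    also have "max \<bar>a\<bar> \<bar>b\<bar> powr q \<le> \<bar>a\<bar> powr q + \<bar>b\<bar> powr q"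
      by (simp add: max_def)
    finally show ?thesis by simp
  qed
  have "integrable M (\<lambda>x. \<bar>f x + g x\<bar> powr q)"
  proof (rule Bochner_Integration.integrable_bound)
    show "integrable M (\<lambda>x. 2 powr q * (\<bar>f x\<bar> powr q + \<bar>g x\<bar> powr q))"
      using f g by (auto simp: Lp_def)
    show "AE x in M. norm (\<bar>f x + g x\<bar> powr q) \<le> norm (2 powr q * (\<bar>f x\<bar> powr q + \<bar>g x\<bar> powr q))"
      using * by (auto simp: abs_mult)
  qed (use m in auto)
  then show ?thesis using m by (auto simp: Lp_def)
qed

lemma Lp_diff:
  assumes "f \<in> Lp q M" "g \<in> Lp q M" "0 \<le> q"
  shows "(\<lambda>x. f x - g x) \<in> Lp q M"
  using Lp_add[OF assms(1) Lp_cmult[OF assms(2), of "-1"] assms(3)] by simp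

lemma AE_summable_if_summable_integral:
  fixes f :: "nat \<Rightarrow> 'a \<Rightarrow> real"
  assumes int: "\<And>n. integrable M (f n)" and nonneg: "\<And>n x. 0 \<le> f n x"
    and sum: "summable (\<lambda>n. \<integral>x. f n x \<partial>M)"
  shows "AE x in M. summable (\<lambda>n. f n x)"
proof -
  have m: "f n \<in> borel_measurable M" for n using int by auto
  have "(\<integral>\<^sup>+x. (\<Sum>n. ennreal (f n x)) \<partial>M) = (\<Sum>n. \<integral>\<^sup>+x. ennreal (f n x) \<partial>M)"
    using m by (intro nn_integral_suminf) auto
  also have "\<dots> = (\<Sum>n. ennreal (\<integral>x. f n x \<partial>M))"
    using int nonneg by (simp add: nn_integral_eq_integral)
  also have "\<dots> = ennreal (\<Sum>n. \<integral>x. f n x \<partial>M)"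
    using nonneg sum by (intro suminf_ennreal2) auto
  finally have "(\<integral>\<^sup>+x. (\<Sum>n. ennreal (f n x)) \<partial>M) \<noteq> \<infinity>" by simp
  then have "AE x in M. (\<Sum>n. ennreal (f n x)) \<noteq> \<infinity>"
    using m by (intro nn_integral_noteq_infinite) auto
  then show ?thesis
    by eventually_elim (auto intro: summable_suminf_not_top simp: nonneg)
qed

text \<open>Otherwise there are \<open>g n \<in> L\<^sup>q\<close> with \<open>\<Sum>n. \<bar>g n\<bar> powr q\<close>
  integrable on which the functional stays away from \<open>0\<close>, but \<open>(\<Sum>n. \<bar>g n\<bar> powr q) powr (1 / q)\<close>
  is an \<open>L\<^sup>q\<close> majorant of all of them.\<close>
lemma positive_functional_continuous_Lp:
  assumes "0 < q" and k: "k \<in> borel_measurable M" "\<And>x. 0 \<le> k x"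
    and int: "\<And>g. g \<in> Lp q M \<Longrightarrow> integrable M (\<lambda>x. g x * k x)" and "0 < e"
  shows "\<exists>\<eta>>0. \<forall>g\<in>Lp q M. (\<integral>x. \<bar>g x\<bar> powr q \<partial>M) < \<eta> \<longrightarrow> \<bar>\<integral>x. g x * k x \<partial>M\<bar> < e"
proof (rule ccontr)
  assume "\<not> ?thesis"
  then have "\<forall>n::nat. \<exists>g\<in>Lp q M. (\<integral>x. \<bar>g x\<bar> powr q \<partial>M) < (1/2) ^ n \<and> e \<le> \<bar>\<integral>x. g x * k x \<partial>M\<bar>"
    by (metis not_less half_gt_zero_iff zero_less_one zero_less_power)
  then obtain g where g: "\<And>n. g n \<in> Lp q M" and small: "\<And>n. (\<integral>x. \<bar>g n x\<bar> powr q \<partial>M) < (1/2) ^ n"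
    and big: "\<And>n. e \<le> \<bar>\<integral>x. g n x * k x \<partial>M\<bar>"
    by metis
  note m = Lp_measurable[OF g]
  have sum: "summable (\<lambda>n. \<integral>x. \<bar>g n x\<bar> powr q \<partial>M)"
    by (rule summable_comparison_test'[of "\<lambda>n. (1/2)^n" 0])
      (use small in \<open>auto simp: less_imp_le intro: summable_geometric\<close>)
  have AE: "AE x in M. summable (\<lambda>n. \<bar>g n x\<bar> powr q)"
    using Lp_integrable[OF g] sum by (intro AE_summable_if_summable_integral) auto
  define D where "D x = (\<Sum>n. \<bar>g n x\<bar> powr q)" for x
  have D: "integrable M D"
    unfolding D_def by (intro integrable_suminf) (use AE sum Lp_integrable[OF g] in auto)
  have Dm: "D \<in> borel_measurable M" using D by simp
  define G where "G x = D x powr (1 / q)" for x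
  have "integrable M (\<lambda>x. \<bar>G x\<bar> powr q)"
  proof (rule integrable_cong_AE_imp[OF D])
    show "(\<lambda>x. \<bar>G x\<bar> powr q) \<in> borel_measurable M"
      unfolding G_def using Dm by measurable
    show "AE x in M. D x = \<bar>G x\<bar> powr q"
      using AE
    proof eventually_elim
      case (elim x)
      then have "0 \<le> D x" unfolding D_def by (intro suminf_nonneg) auto
      then show ?case using \<open>0 < q\<close> by (simp add: G_def powr_powr)
    qed
  qed
  then have G: "G \<in> Lp q M"
    unfolding Lp_def G_def using Dm by simp
  have "(\<lambda>n. \<integral>x. g n x * k x \<partial>M) \<longlonglongrightarrow> (\<integral>x. 0 \<partial>M)"
  proof (rule integral_dominated_convergence[where w = "\<lambda>x. G x * k x"])
    show "AE x in M. (\<lambda>n. g n x * k x) \<longlonglongrightarrow> 0"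
      using AE
    proof eventually_elim
      case (elim x)
      then have "(\<lambda>n. \<bar>g n x\<bar> powr q) \<longlonglongrightarrow> 0" by (rule summable_LIMSEQ_zero)
      then have "(\<lambda>n. (\<bar>g n x\<bar> powr q) powr (1 / q)) \<longlonglongrightarrow> 0"
        by (rule tendsto_zero_powrI[of _ _ _ "1 / q"]) (use \<open>0 < q\<close> in auto)
      then have "(\<lambda>n. g n x) \<longlonglongrightarrow> 0"
        using \<open>0 < q\<close> by (simp add: powr_powr tendsto_rabs_zero_iff)
      then show ?case by (rule tendsto_mult_left_zero)
    qed
    show "AE x in M. norm (g n x * k x) \<le> G x * k x" for n
      using AE
    proof eventually_elim
      case (elim x)
      have "\<bar>g n x\<bar> powr q = (\<Sum>i\<in>{n}. \<bar>g i x\<bar> powr q)" by simp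
      also have "\<dots> \<le> D x"
        unfolding D_def using elim by (intro sum_le_suminf) auto
      finally have "(\<bar>g n x\<bar> powr q) powr (1 / q) \<le> G x"
        unfolding G_def using \<open>0 < q\<close> by (intro powr_mono2) auto
      then have "\<bar>g n x\<bar> \<le> G x"
        using \<open>0 < q\<close> by (simp add: powr_powr)
      then show ?case by (simp add: abs_mult k mult_right_mono)
    qed
  qed (use m k int[OF G] in auto)
  then have "(\<lambda>n. \<bar>\<integral>x. g n x * k x \<partial>M\<bar>) \<longlonglongrightarrow> 0"
    by (simp add: tendsto_rabs_zero)
  then have "e \<le> 0"
    by (rule tendsto_lowerbound) (use big in auto)
  with \<open>0 < e\<close> show False by simp
qed


section \<open>Test functions\<close>

definition partial :: "'a::euclidean_space \<Rightarrow> ('a \<Rightarrow> real) \<Rightarrow> 'a \<Rightarrow> real" where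
  "partial b f = (\<lambda>x. frechet_derivative f (at x) b)"

lemma partial_eqI: "(f has_derivative f') (at x) \<Longrightarrow> partial b f x = f' b"
  by (metis partial_def frechet_derivative_at)

lemma has_derivative_frechet:
  "f differentiable at x \<Longrightarrow> (f has_derivative frechet_derivative f (at x)) (at x)"
  by (simp add: frechet_derivative_works)

lemma partial_lincomb:
  assumes "f differentiable at x" "g differentiable at x"
  shows "partial b (\<lambda>x. c * f x + d * g x) x = c * partial b f x + d * partial b g x"
  using assms[THEN has_derivative_frechet]
  by (subst partial_eqI) (auto intro!: derivative_eq_intros simp: partial_def)

lemma partial_mult:
  assumes "f differentiable at x" "g differentiable at x"
  shows "partial b (\<lambda>x. f x * g x) x = f x * partial b g x + partial b f x * g x"
  using assms[THEN has_derivative_frechet]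
  by (subst partial_eqI) (auto intro!: derivative_eq_intros simp: partial_def)

lemma has_derivative_shift:
  assumes "f differentiable at (x + c)"
  shows "((\<lambda>x. f (x + c)) has_derivative frechet_derivative f (at (x + c))) (at x)"
proof -
  have "((\<lambda>x. x + c) has_derivative (\<lambda>h. h)) (at x)"
    by (auto intro!: derivative_eq_intros)
  from has_derivative_compose[OF this has_derivative_frechet[OF assms]] show ?thesis .
qed

lemma C_k_Suc_iff: "C_k (Suc k) f \<longleftrightarrow> (\<forall>x. f differentiable at x) \<and> (\<forall>b\<in>Basis. C_k k (partial b f))"
  by (simp add: partial_def)

lemma C_k_continuous: "C_k k f \<Longrightarrow> continuous_on UNIV f"
  by (cases k) (auto intro!: differentiable_imp_continuous_on simp: differentiable_on_def)

lemma C_k_SucD: "C_k (Suc k) f \<Longrightarrow> C_k k f"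
proof (induction k arbitrary: f)
  case 0
  then show ?case
    by (auto intro!: differentiable_imp_continuous_on simp: differentiable_on_def)
next
  case (Suc k)
  then show ?case by (subst C_k_Suc_iff) (metis C_k_Suc_iff)
qed

lemma C_k_lincomb:
  assumes "C_k k f" "C_k k g"
  shows "C_k k (\<lambda>x. c * f x + d * g x)"
  using assms
proof (induction k arbitrary: f g c d)
  case 0
  then show ?case by (auto intro!: continuous_intros)
next
  case (Suc k)
  then have diff: "f differentiable at x" "g differentiable at x" for x
    by auto
  then have "partial b (\<lambda>x. c * f x + d * g x) = (\<lambda>x. c * partial b f x + d * partial b g x)" for b
    by (simp add: fun_eq_iff partial_lincomb)
  with Suc diff show ?case
    unfolding C_k_Suc_iff by (auto intro!: differentiable_add differentiable_mult)
qed

lemma C_k_mult: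
  assumes "C_k k f" "C_k k g"
  shows "C_k k (\<lambda>x. f x * g x)"
  using assms
proof (induction k arbitrary: f g)
  case 0
  then show ?case by (auto intro!: continuous_intros)
next
  case (Suc k)
  then have diff: "f differentiable at x" "g differentiable at x" for x
    by auto
  then have p: "partial b (\<lambda>x. f x * g x) = (\<lambda>x. 1 * (f x * partial b g x) + 1 * (partial b f x * g x))" for b
    by (simp add: fun_eq_iff partial_mult)
  have "C_k k (partial b (\<lambda>x. f x * g x))" if "b \<in> Basis" for b
    unfolding p using Suc that C_k_SucD[of k f] C_k_SucD[of k g]
    by (intro C_k_lincomb Suc.IH) (auto simp: C_k_Suc_iff simp del: C_k.simps)
  with diff show ?case
    unfolding C_k_Suc_iff by (auto intro!: differentiable_mult)
qed

lemma C_k_shift: "C_k k f \<Longrightarrow> C_k k (\<lambda>x. f (x + c))"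
proof (induction k arbitrary: f)
  case 0
  then show ?case by (auto intro!: continuous_on_compose2[of UNIV f] continuous_intros)
next
  case (Suc k)
  then have diff: "f differentiable at x" for x by auto
  have p: "partial b (\<lambda>x. f (x + c)) = (\<lambda>x. partial b f (x + c))" for b
    by (rule ext, subst partial_eqI[OF has_derivative_shift[OF diff]]) (simp add: partial_def)
  have "(\<lambda>x. f (x + c)) differentiable at x" for x
    using has_derivative_shift[OF diff] by (auto simp: differentiable_def)
  with Suc p show ?case
    unfolding C_k_Suc_iff by auto
qed

section \<open>Closure properties of the space of test functions\<close>

lemma test_functions_differentiable: "f \<in> test_functions \<Longrightarrow> f differentiable at x"
  unfolding test_functions_def using C_k_Suc_iff by blast

lemma test_functions_continuous: "f \<in> test_functions \<Longrightarrow> continuous_on UNIV f"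
  unfolding test_functions_def using C_k_continuous by blast

lemma test_functions_measurable: "f \<in> test_functions \<Longrightarrow> f \<in> borel_measurable borel"
  by (simp add: borel_measurable_continuous_onI test_functions_continuous)

lemma test_functionsI:
  assumes "\<And>k. C_k k g" "compact K" "\<And>x. x \<notin> K \<Longrightarrow> g x = 0"
  shows "g \<in> test_functions"
proof -
  have "closure {x. g x \<noteq> 0} \<subseteq> K"
    using assms by (intro closure_minimal) (auto intro: compact_imp_closed)
  then have "compact (closure {x. g x \<noteq> 0})"
    using assms(2) closed_closure compact_Int_closed[of K] by (metis inf.absorb_iff2)
  with assms(1) show ?thesis by (simp add: test_functions_def)
qed

lemma test_functions_support:
  assumes "f \<in> test_functions"
  obtains K where "compact K" "\<And>x. x \<notin> K \<Longrightarrow> f x = 0"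
proof (rule that)
  show "compact (closure {x. f x \<noteq> 0})"
    using assms unfolding test_functions_def by blast
  show "f x = 0" if "x \<notin> closure {x. f x \<noteq> 0}" for x
    using that closure_subset[of "{x. f x \<noteq> 0}"] by auto
qed

lemma test_functions_lincomb:
  assumes "f \<in> test_functions" "g \<in> test_functions"
  shows "(\<lambda>x. c * f x + d * g x) \<in> test_functions"
proof -
  obtain K L where "compact K" "\<And>x. x \<notin> K \<Longrightarrow> f x = 0" "compact L" "\<And>x. x \<notin> L \<Longrightarrow> g x = 0"
    using assms test_functions_support by metis
  then show ?thesis
    using assms by (intro test_functionsI[of _ "K \<union> L"] C_k_lincomb) (auto simp: test_functions_def)
qed

lemma test_functions_diff:
  "f \<in> test_functions \<Longrightarrow> g \<in> test_functions \<Longrightarrow> (\<lambda>x. f x - g x) \<in> test_functions"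
  using test_functions_lincomb[of f g 1 "-1"] by simp

lemma test_functions_mult:
  assumes "f \<in> test_functions" "g \<in> test_functions"
  shows "(\<lambda>x. f x * g x) \<in> test_functions"
proof -
  obtain K where "compact K" "\<And>x. x \<notin> K \<Longrightarrow> f x = 0"
    using assms test_functions_support by metis
  then show ?thesis
    using assms by (intro test_functionsI[of _ K] C_k_mult) (auto simp: test_functions_def)
qed

lemma test_functions_shift:
  assumes "f \<in> test_functions"
  shows "(\<lambda>x. f (x + c)) \<in> test_functions"
proof -
  obtain K where K: "compact K" "\<And>x. x \<notin> K \<Longrightarrow> f x = 0"
    using assms test_functions_support by metis
  have "f (x + c) = 0" if "x \<notin> (+) (- c) ` K" for x
  proof (rule K(2))
    show "x + c \<notin> K"
      using that image_eqI[of x "(+) (- c)" "x + c" K] by auto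
  qed
  moreover have "compact ((+) (- c) ` K)"
    using K(1) by (rule compact_translation)
  ultimately show ?thesis
    using assms by (intro test_functionsI[of _ "(+) (- c) ` K"] C_k_shift) (auto simp: test_functions_def)
qed

lemma test_functions_partial:
  assumes f: "f \<in> test_functions" and "b \<in> Basis"
  shows "partial b f \<in> test_functions"
proof (rule test_functionsI)
  show "C_k k (partial b f)" for k
    using assms C_k_Suc_iff unfolding test_functions_def by blast
  show "compact (closure {x. f x \<noteq> 0})"
    using f by (simp add: test_functions_def)
  show "partial b f x = 0" if "x \<notin> closure {x. f x \<noteq> 0}" for x
  proof -
    have "(f has_derivative (\<lambda>_. 0)) (at x)"
    proof (rule has_derivative_transform_within_open)
      show "((\<lambda>_. 0) has_derivative (\<lambda>_. 0)) (at x)" by simp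
      show "0 = f y" if "y \<in> - closure {x. f x \<noteq> 0}" for y
        using that closure_subset[of "{x. f x \<noteq> 0}"] by auto
    qed (use that in \<open>auto intro: open_Compl\<close>)
    then show ?thesis by (rule partial_eqI)
  qed
qed

lemma test_functions_bounded:
  assumes "f \<in> test_functions"
  obtains C where "0 \<le> C" "\<And>x. \<bar>f x\<bar> \<le> C"
proof -
  obtain K where K: "compact K" "\<And>x. x \<notin> K \<Longrightarrow> f x = 0"
    using assms test_functions_support by metis
  have "compact (f ` K)"
    using K(1) test_functions_continuous[OF assms]
    by (intro compact_continuous_image) (auto intro: continuous_on_subset)
  then have "bounded (f ` K)" by (rule compact_imp_bounded)
  then obtain C where "\<And>x. x \<in> K \<Longrightarrow> \<bar>f x\<bar> \<le> C"
    unfolding bounded_iff by auto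
  then have "\<bar>f x\<bar> \<le> \<bar>C\<bar>" for x
    using K(2)[of x] by (cases "x \<in> K") (auto intro: order_trans[OF _ abs_ge_self])
  then show ?thesis by (intro that[of "\<bar>C\<bar>"]) auto
qed

section \<open>Gradients of test functions\<close>

lemma grad_inner: "b \<in> Basis \<Longrightarrow> grad f x \<bullet> b = partial b f x"
  by (simp add: grad_def partial_def inner_sum_left inner_Basis if_distrib[of "\<lambda>t. _ * t"] cong: if_cong)

lemma grad_lincomb:
  assumes "f \<in> test_functions" "g \<in> test_functions"
  shows "grad (\<lambda>x. c * f x + d * g x) x = c *\<^sub>R grad f x + d *\<^sub>R grad g x"
  by (rule euclidean_eqI)
    (simp add: grad_inner inner_left_distrib partial_lincomb test_functions_differentiable assms)

lemma grad_diff: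
  assumes "f \<in> test_functions" "g \<in> test_functions"
  shows "grad (\<lambda>x. f x - g x) x = grad f x - grad g x"
  using grad_lincomb[OF assms, of 1 "-1"] by simp

lemma grad_mult:
  assumes "f \<in> test_functions" "g \<in> test_functions"
  shows "grad (\<lambda>x. f x * g x) x = f x *\<^sub>R grad g x + g x *\<^sub>R grad f x"
  by (rule euclidean_eqI)
    (simp add: grad_inner inner_left_distrib partial_mult test_functions_differentiable assms mult.commute)

lemma grad_measurable:
  assumes "f \<in> test_functions"
  shows "grad f \<in> borel_measurable borel"
proof -
  have "(\<lambda>x. \<Sum>b\<in>Basis. partial b f x *\<^sub>R b) \<in> borel_measurable borel"
    using test_functions_measurable[OF test_functions_partial[OF assms]] by measurable
  then show ?thesis by (simp add: grad_def[abs_def] partial_def)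
qed

lemma grad_bounded:
  assumes "f \<in> test_functions"
  obtains C where "0 \<le> C" "\<And>x. norm (grad f x) \<le> C"
proof -
  have "\<exists>C. 0 \<le> C \<and> (\<forall>x. \<bar>partial b f x\<bar> \<le> C)" if "b \<in> Basis" for b
    using test_functions_bounded[OF test_functions_partial[OF assms that]] by metis
  then obtain C where C: "\<And>b. b \<in> Basis \<Longrightarrow> 0 \<le> C b \<and> (\<forall>x. \<bar>partial b f x\<bar> \<le> C b)"
    by metis
  have "norm (grad f x) \<le> (\<Sum>b\<in>Basis. C b)" for x
    using C by (intro norm_le_l1[THEN order_trans] sum_mono) (simp add: grad_inner)
  then show ?thesis using C by (intro that[of "\<Sum>b\<in>Basis. C b"]) (auto intro: sum_nonneg)
qed

lemma grad_support:
  fixes f :: "'a::euclidean_space \<Rightarrow> real"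
  assumes "f \<in> test_functions"
  obtains r where "\<And>x. r \<le> norm x \<Longrightarrow> f x = 0" "\<And>x. r \<le> norm x \<Longrightarrow> grad f x = 0"
    "\<And>x b. b \<in> Basis \<Longrightarrow> r \<le> norm x \<Longrightarrow> partial b (partial b f) x = 0"
proof -
  have "\<exists>r. \<forall>x. r \<le> norm x \<longrightarrow> g x = 0" if g: "g \<in> test_functions" for g :: "'a \<Rightarrow> real"
  proof -
    obtain K where K: "compact K" "\<And>x. x \<notin> K \<Longrightarrow> g x = 0"
      using test_functions_support[OF g] by metis
    then obtain r where "\<And>x. x \<in> K \<Longrightarrow> norm x \<le> r"
      using compact_imp_bounded bounded_iff by metis
    then show ?thesis
      using K by (intro exI[of _ "r + 1"]) force
  qed
  then have "\<exists>R. \<forall>g\<in>test_functions. \<forall>x::'a. R g \<le> norm x \<longrightarrow> g x = (0::real)" 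
    by (intro bchoice) auto
  then obtain R where R: "\<And>g x. g \<in> test_functions \<Longrightarrow> R g \<le> norm (x::'a) \<Longrightarrow> g x = (0::real)"
    by metis
  define r where "r = Max (insert (R f) ((\<lambda>b. R (partial b f)) ` Basis \<union> (\<lambda>b. R (partial b (partial b f))) ` Basis))"
  have r: "R f \<le> r" "\<And>b. b \<in> Basis \<Longrightarrow> R (partial b f) \<le> r"
    "\<And>b. b \<in> Basis \<Longrightarrow> R (partial b (partial b f)) \<le> r"
    unfolding r_def by (auto intro!: Max_ge simp del: Max_insert)
  have p: "partial b f x = 0" if "b \<in> Basis" "r \<le> norm x" for b x
    using R[OF test_functions_partial[OF assms that(1)]] r(2)[OF that(1)] that(2) by force
  show ?thesis
  proof (rule that[of r])
    show "f x = 0" if "r \<le> norm x" for x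
      using R[OF assms] r(1) that by force
    show "grad f x = 0" if "r \<le> norm x" for x
      by (rule euclidean_eqI) (simp add: grad_inner p that)
    show "partial b (partial b f) x = 0" if "b \<in> Basis" "r \<le> norm x" for b x
      using R[OF test_functions_partial[OF test_functions_partial[OF assms that(1)] that(1)]]
        r(3)[OF that(1)] that(2) by force
  qed
qed


section \<open>Closures of forms represented by an operator\<close>

text \<open>An abstract setting in which the closure can be evaluated: the form on its core
  \<open>D\<close> is nonnegative on the diagonal, satisfies a sector condition in the graph norm,
  and is given by an operator \<open>A\<close> with values in \<open>L\<^sup>2\<close>. Symmetry is
  not assumed. The representation yields closability and the value of the closed form when the first
  argument is in \<open>D\<close>.\<close>

locale represented_form =
  fixes M :: "'a measure" and D :: "('a \<Rightarrow> real) set"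
    and \<E> :: "('a \<Rightarrow> real) \<Rightarrow> ('a \<Rightarrow> real) \<Rightarrow> real"
    and A :: "('a \<Rightarrow> real) \<Rightarrow> 'a \<Rightarrow> real" and K :: real
  assumes D_Lp: "f \<in> D \<Longrightarrow> f \<in> Lp 2 M"
    and D_diff: "f \<in> D \<Longrightarrow> g \<in> D \<Longrightarrow> (\<lambda>x. f x - g x) \<in> D"
    and A_Lp: "f \<in> D \<Longrightarrow> A f \<in> Lp 2 M"
    and represented: "f \<in> D \<Longrightarrow> g \<in> D \<Longrightarrow> \<E> f g = - L2_inner M (A f) g"
    and form_diff_left: "f \<in> D \<Longrightarrow> g \<in> D \<Longrightarrow> h \<in> D \<Longrightarrow> \<E> (\<lambda>x. f x - g x) h = \<E> f h - \<E> g h"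
    and form_nonneg: "f \<in> D \<Longrightarrow> 0 \<le> \<E> f f"
    and sector: "f \<in> D \<Longrightarrow> g \<in> D \<Longrightarrow>
      \<bar>\<E> f g\<bar> \<le> K * sqrt (\<E> f f + (Lp_norm 2 M f)\<^sup>2) * sqrt (\<E> g g + (Lp_norm 2 M g)\<^sup>2)"
    and K_nonneg: "0 \<le> K"
begin

abbreviation graph_norm :: "('a \<Rightarrow> real) \<Rightarrow> real" where
  "graph_norm f \<equiv> sqrt (\<E> f f + (Lp_norm 2 M f)\<^sup>2)"

lemma form_diff_right:
  assumes "f \<in> D" "g \<in> D" "h \<in> D"
  shows "\<E> f (\<lambda>x. g x - h x) = \<E> f g - \<E> f h"
  using assms
  by (simp add: represented D_diff L2_inner_commute[of M "A f"] L2_inner_diff A_Lp D_Lp)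

text \<open>The parallelogram law holds without symmetry, since the mixed terms cancel in pairs.
  With \<open>f = d + g\<close> it reads
  \<open>\<E> f f + \<E> (d - g) (d - g) = 2 \<E> d d + 2 \<E> g g\<close>.\<close>

lemma form_le_parallelogram:
  assumes f: "f \<in> D" and g: "g \<in> D"
  shows "\<E> f f \<le> 2 * \<E> g g + 2 * \<E> (\<lambda>x. f x - g x) (\<lambda>x. f x - g x)"
proof -
  let ?d = "\<lambda>x. f x - g x"
  have d: "?d \<in> D" using f g by (rule D_diff)
  have "0 \<le> \<E> (\<lambda>x. ?d x - g x) (\<lambda>x. ?d x - g x)"
    by (rule form_nonneg[OF D_diff[OF d g]])
  also have "\<dots> = 2 * \<E> g g + 2 * \<E> ?d ?d - \<E> f f"
    using form_diff_left[OF d g D_diff[OF d g]] form_diff_right[OF d d g] form_diff_right[OF g d g]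
      form_diff_left[OF f g d] form_diff_right[OF f f g] form_diff_right[OF g f g] form_diff_left[OF f g g]
    by linarith
  finally show ?thesis by simp
qed

lemma graph_norm_bounded:
  assumes "form_approx M D \<E> g v" and v: "v \<in> Lp 2 M"
  obtains C where "0 \<le> C" "\<forall>\<^sub>F n in sequentially. graph_norm (g n) \<le> C"
proof -
  have g: "g n \<in> D" for n using assms by (simp add: form_approx_def)
  obtain N where N: "\<And>i j. N \<le> i \<Longrightarrow> N \<le> j \<Longrightarrow>
      \<E> (\<lambda>x. g i x - g j x) (\<lambda>x. g i x - g j x) < 1"
    using assms(1) unfolding form_approx_def by (meson zero_less_one)
  have "(\<lambda>n. Lp_norm 2 M (\<lambda>x. g n x - v x)) \<longlonglongrightarrow> 0"
    using assms(1) by (simp add: form_approx_def)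
  then have "\<forall>\<^sub>F n in sequentially. Lp_norm 2 M (\<lambda>x. g n x - v x) < 1"
    by (rule order_tendstoD) simp
  then have "\<forall>\<^sub>F n in sequentially. graph_norm (g n) \<le> sqrt (2 * \<E> (g N) (g N) + 2 + (1 + Lp_norm 2 M v)\<^sup>2)"
    using eventually_ge_at_top[of N]
  proof eventually_elim
    case (elim n)
    have "Lp_norm 2 M (g n) \<le> Lp_norm 2 M (\<lambda>x. g n x - v x) + Lp_norm 2 M v"
      using Lp_norm_2_triangle[OF Lp_2_diff[OF D_Lp[OF g] v] v, of n] by simp
    then have "(Lp_norm 2 M (g n))\<^sup>2 \<le> (1 + Lp_norm 2 M v)\<^sup>2"
      using elim by (intro power_mono) (auto simp: Lp_norm_2_nonneg)
    moreover have "\<E> (g n) (g n) \<le> 2 * \<E> (g N) (g N) + 2"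
      using form_le_parallelogram[OF g g, of n N] N[of n N] elim by simp
    ultimately show ?case by simp
  qed
  moreover have "0 \<le> sqrt (2 * \<E> (g N) (g N) + 2 + (1 + Lp_norm 2 M v)\<^sup>2)"
    using form_nonneg[OF g] by simp
  ultimately show ?thesis using that by blast
qed

text \<open>Closability: the representation makes \<open>\<E> (a n) (a j)\<close> small for fixed \<open>n\<close> and large \<open>j\<close>.\<close>
lemma form_tendsto_0:
  assumes a: "form_approx M D \<E> a (\<lambda>x. 0)"
  shows "(\<lambda>n. graph_norm (a n)) \<longlonglongrightarrow> 0"
proof -
  have aD: "a n \<in> D" for n using a by (simp add: form_approx_def)
  have a0: "(\<lambda>n. Lp_norm 2 M (a n)) \<longlonglongrightarrow> 0"
    using a by (simp add: form_approx_def)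
  obtain Q where "0 \<le> Q" and Q: "\<forall>\<^sub>F n in sequentially. graph_norm (a n) \<le> Q"
    using graph_norm_bounded[OF a Lp_2_zero] .
  have "\<forall>\<^sub>F n in sequentially. \<E> (a n) (a n) \<le> e" if "0 < e" for e
  proof -
    \<comment> \<open>Chosen so that \<open>K * Q * sqrt (2 * d) \<le> e\<close>. In the squared
      graph norm of \<open>a n - a j\<close> the form and the squared \<open>L\<^sup>2\<close> norm
      contribute at most \<open>d\<close> each; the \<open>+ 1\<close> keeps the denominator
      positive.\<close>
    define d where "d = (e / (K * Q + 1))\<^sup>2 / 2"
    have KQ: "0 \<le> K * Q" using K_nonneg \<open>0 \<le> Q\<close> by simp
    then have "0 < d" using \<open>0 < e\<close> by (simp add: d_def)
    have d: "K * Q * sqrt (2 * d) \<le> e"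
    proof -
      have "sqrt (2 * d) = e / (K * Q + 1)"
        using KQ \<open>0 < e\<close> by (simp add: d_def)
      then have "K * Q * sqrt (2 * d) = e - sqrt (2 * d)"
        using KQ by (simp add: field_simps)
      then show ?thesis using \<open>0 < d\<close> by simp
    qed
    obtain N where N: "\<And>i j. N \<le> i \<Longrightarrow> N \<le> j \<Longrightarrow>
        \<E> (\<lambda>x. a i x - a j x) (\<lambda>x. a i x - a j x) < d"
      using a \<open>0 < d\<close> unfolding form_approx_def by meson
    have "0 < sqrt d / 2" using \<open>0 < d\<close> by simp
    then have s: "\<forall>\<^sub>F n in sequentially. Lp_norm 2 M (a n) < sqrt d / 2"
      using a0 by (intro order_tendstoD)
    show ?thesis
      using Q s eventually_ge_at_top[of N]
    proof eventually_elim
      case (elim n)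
      have "\<forall>\<^sub>F j in sequentially. \<E> (a n) (a n) \<le> e + Lp_norm 2 M (A (a n)) * Lp_norm 2 M (a j)"
        using s eventually_ge_at_top[of N]
      proof eventually_elim
        case (elim j)
        let ?b = "\<lambda>x. a n x - a j x"
        have b: "?b \<in> D" by (intro D_diff aD)
        have "Lp_norm 2 M ?b \<le> Lp_norm 2 M (a n) + Lp_norm 2 M (a j)"
          using Lp_norm_2_triangle[OF D_Lp[OF aD] Lp_2_cmult[OF D_Lp[OF aD], of "-1"], of n j]
            Lp_norm_2_cmult[of M "-1" "a j"] by simp
        also have "\<dots> \<le> sqrt d"
          using elim \<open>Lp_norm 2 M (a n) < _\<close> by simp
        finally have "(Lp_norm 2 M ?b)\<^sup>2 \<le> (sqrt d)\<^sup>2"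
          by (intro power_mono) (auto simp: Lp_norm_2_nonneg)
        then have "graph_norm ?b \<le> sqrt (2 * d)"
          using N[of n j] elim \<open>N \<le> n\<close> \<open>0 < d\<close> by simp
        then have "K * graph_norm (a n) * graph_norm ?b \<le> K * Q * sqrt (2 * d)"
          using \<open>graph_norm (a n) \<le> Q\<close> K_nonneg \<open>0 \<le> Q\<close> form_nonneg[OF b]
          by (intro mult_mono mult_left_mono) auto
        with sector[OF aD b, of n] d have "\<E> (a n) ?b \<le> e" by linarith
        moreover have "\<E> (a n) (a j) \<le> Lp_norm 2 M (A (a n)) * Lp_norm 2 M (a j)"
          using L2_Cauchy_Schwarz[OF A_Lp[OF aD] D_Lp[OF aD], of n j]
          by (simp add: represented aD)
        moreover have "\<E> (a n) ?b = \<E> (a n) (a n) - \<E> (a n) (a j)"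
          by (intro form_diff_right aD)
        ultimately show ?case by linarith
      qed
      moreover have "(\<lambda>j. e + Lp_norm 2 M (A (a n)) * Lp_norm 2 M (a j)) \<longlonglongrightarrow> e + Lp_norm 2 M (A (a n)) * 0"
        by (intro tendsto_intros a0)
      ultimately have "\<E> (a n) (a n) \<le> e + Lp_norm 2 M (A (a n)) * 0"
        by (intro tendsto_lowerbound[of _ "e + Lp_norm 2 M (A (a n)) * 0" sequentially]) auto
      then show ?case by simp
    qed
  qed note le = this
  have "(\<lambda>n. \<E> (a n) (a n)) \<longlonglongrightarrow> 0"
  proof (rule order_tendstoI)
    show "\<forall>\<^sub>F n in sequentially. \<E> (a n) (a n) < e" if "0 < e" for e
      using le[of "e/2"] that by (auto elim: eventually_mono)
    show "\<forall>\<^sub>F n in sequentially. e < \<E> (a n) (a n)" if "e < 0" for e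
      using form_nonneg[OF aD] that by (auto intro!: always_eventually intro: less_le_trans)
  qed
  then have "(\<lambda>n. graph_norm (a n)) \<longlonglongrightarrow> sqrt (0 + 0\<^sup>2)"
    by (intro tendsto_intros a0)
  then show ?thesis by simp
qed

lemma closure_dom_subset_Lp: "v \<in> closure_dom M D \<E> \<Longrightarrow> v \<in> Lp 2 M"
  by (simp add: closure_dom_def)

lemma form_approx_const:
  assumes "f \<in> D"
  shows "form_approx M D \<E> (\<lambda>n. f) f"
proof -
  have "\<E> (\<lambda>x. f x - f x) (\<lambda>x. f x - f x) = 0"
    using assms form_diff_left[OF assms assms D_diff[OF assms assms]] by simp
  then show ?thesis
    using assms by (simp add: form_approx_def Lp_norm_2_eq)
qed

lemma D_subset_closure_dom: "f \<in> D \<Longrightarrow> f \<in> closure_dom M D \<E>"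
  using form_approx_const D_Lp by (auto simp: closure_dom_def)

text \<open>Write \<open>fs n = a n + f\<close>. Closability sends \<open>a n\<close> to 0 in graph
  norm, and the sector condition removes its contribution because \<open>gs\<close> stays bounded.
  The rest is \<open>\<E> f (gs n) = - L2_inner M (A f) (gs n)\<close>, which is continuous in
  \<open>L\<^sup>2\<close>.\<close>

lemma form_approx_tendsto:
  assumes f: "f \<in> D" and fs: "form_approx M D \<E> fs f"
    and gs: "form_approx M D \<E> gs v" and v: "v \<in> Lp 2 M"
  shows "(\<lambda>n. \<E> (fs n) (gs n)) \<longlonglongrightarrow> - L2_inner M (A f) v"
proof -
  define a where "a n x = fs n x - f x" for n x
  have fsD: "fs n \<in> D" and gsD: "gs n \<in> D" for n
    using fs gs by (simp_all add: form_approx_def)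
  have aD: "a n \<in> D" for n
    using D_diff[OF fsD f] by (simp add: a_def[abs_def])
  have "form_approx M D \<E> a (\<lambda>x. 0)"
    using fs aD unfolding form_approx_def by (simp add: a_def[abs_def])
  then have a0: "(\<lambda>n. graph_norm (a n)) \<longlonglongrightarrow> 0"
    by (rule form_tendsto_0)
  obtain C where "0 \<le> C" and C: "\<forall>\<^sub>F n in sequentially. graph_norm (gs n) \<le> C"
    using graph_norm_bounded[OF gs v] .
  have "(\<lambda>n. \<E> (a n) (gs n)) \<longlonglongrightarrow> 0"
  proof (rule Lim_null_comparison)
    show "\<forall>\<^sub>F n in sequentially. norm (\<E> (a n) (gs n)) \<le> K * graph_norm (a n) * C"
      using C
    proof eventually_elim
      case (elim n)
      have "K * graph_norm (a n) * graph_norm (gs n) \<le> K * graph_norm (a n) * C"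
        using elim K_nonneg form_nonneg[OF aD, of n] by (intro mult_left_mono) auto
      with sector[OF aD gsD, of n n] show ?case by simp
    qed
    have "(\<lambda>n. K * graph_norm (a n) * C) \<longlonglongrightarrow> K * 0 * C"
      by (intro tendsto_intros a0)
    then show "(\<lambda>n. K * graph_norm (a n) * C) \<longlonglongrightarrow> 0" by simp
  qed
  moreover have "(\<lambda>n. \<E> f (gs n) - (- L2_inner M (A f) v)) \<longlonglongrightarrow> 0"
  proof (rule Lim_null_comparison)
    have "\<E> f (gs n) - (- L2_inner M (A f) v) = - L2_inner M (\<lambda>x. gs n x - v x) (A f)" for n
      using f gsD v by (simp add: represented L2_inner_diff A_Lp D_Lp L2_inner_commute[of M "A f"])
    then show "\<forall>\<^sub>F n in sequentially. norm (\<E> f (gs n) - (- L2_inner M (A f) v))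
        \<le> Lp_norm 2 M (\<lambda>x. gs n x - v x) * Lp_norm 2 M (A f)"
      using L2_Cauchy_Schwarz[OF Lp_2_diff[OF D_Lp[OF gsD] v] A_Lp[OF f]]
      by (intro always_eventually) simp
    have "(\<lambda>n. Lp_norm 2 M (\<lambda>x. gs n x - v x)) \<longlonglongrightarrow> 0"
      using gs by (simp add: form_approx_def)
    then show "(\<lambda>n. Lp_norm 2 M (\<lambda>x. gs n x - v x) * Lp_norm 2 M (A f)) \<longlonglongrightarrow> 0"
      by (rule tendsto_mult_left_zero)
  qed
  then have "(\<lambda>n. \<E> f (gs n)) \<longlonglongrightarrow> - L2_inner M (A f) v"
    by (rule LIM_zero_cancel)
  ultimately have "(\<lambda>n. \<E> (a n) (gs n) + \<E> f (gs n)) \<longlonglongrightarrow> 0 + - L2_inner M (A f) v"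
    by (rule tendsto_add)
  moreover have "\<E> (a n) (gs n) + \<E> f (gs n) = \<E> (fs n) (gs n)" for n
    using form_diff_left[OF fsD f gsD] by (simp add: a_def[abs_def])
  ultimately show ?thesis by simp
qed

lemma closure_form_eq:
  assumes f: "f \<in> D" and v: "v \<in> closure_dom M D \<E>"
  shows "closure_form M D \<E> f v = - L2_inner M (A f) v"
  unfolding closure_form_def
proof (rule the_equality)
  have vL: "v \<in> Lp 2 M" using v by (rule closure_dom_subset_Lp)
  show *: "\<forall>fs gs. form_approx M D \<E> fs f \<and> form_approx M D \<E> gs v \<longrightarrow>
      (\<lambda>n. \<E> (fs n) (gs n)) \<longlonglongrightarrow> - L2_inner M (A f) v"
    using form_approx_tendsto[OF f _ _ vL] by blast
  fix l assume l: "\<forall>fs gs. form_approx M D \<E> fs f \<and> form_approx M D \<E> gs v \<longrightarrow>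
      (\<lambda>n. \<E> (fs n) (gs n)) \<longlonglongrightarrow> l"
  \<comment> \<open>Uniqueness needs one admissible pair of sequences, for otherwise every
    \<open>l\<close> would satisfy the condition vacuously. The constant sequence serves for
    \<open>f\<close>.\<close>
  obtain gs where "form_approx M D \<E> gs v" using v by (auto simp: closure_dom_def)
  then show "l = - L2_inner M (A f) v"
    using l * form_approx_const[OF f] LIMSEQ_unique by blast
qed

end


section \<open>The generator on test functions\<close>

locale weighted_space =
  fixes \<rho> :: "'a::euclidean_space \<Rightarrow> real"
  assumes \<rho>_cont: "continuous_on UNIV \<rho>" and \<rho>_pos: "AE x in lborel. 0 < \<rho> x"
begin

abbreviation m where "m \<equiv> m_of \<rho>"

lemma \<rho>_measurable [measurable]: "\<rho> \<in> borel_measurable borel"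
  using \<rho>_cont by (rule borel_measurable_continuous_onI)

lemma sets_m [simp, measurable_cong]: "sets m = sets borel"
  by (simp add: m_of_def)

lemma space_m [simp]: "space m = UNIV"
  by (simp add: m_of_def)

lemma measurable_m [simp]: "borel_measurable m = borel_measurable borel"
  by (rule measurable_cong_sets) auto

lemma AE_m_iff: "(AE x in m. P x) \<longleftrightarrow> (AE x in lborel. P x)"
proof -
  have "(AE x in m. P x) \<longleftrightarrow> (AE x in lborel. 0 < ennreal (\<rho> x) \<longrightarrow> P x)"
    unfolding m_of_def by (rule AE_density) simp
  also have "\<dots> \<longleftrightarrow> (AE x in lborel. P x)"
    using \<rho>_pos by (auto elim: eventually_elim2)
  finally show ?thesis .
qed

lemma AE_m_\<rho>_pos: "AE x in m. 0 < \<rho> x"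
  using \<rho>_pos by (simp add: AE_m_iff)

lemma integral_m:
  fixes f :: "'a \<Rightarrow> real"
  assumes "f \<in> borel_measurable borel"
  shows "(\<integral>x. f x \<partial>m) = (\<integral>x. \<rho> x * f x \<partial>lborel)"
proof -
  have "AE x in lborel. 0 \<le> \<rho> x" using \<rho>_pos by eventually_elim simp
  then show ?thesis
    unfolding m_of_def using assms by (subst integral_density) auto
qed

lemma integrable_m_iff:
  fixes f :: "'a \<Rightarrow> real"
  assumes "f \<in> borel_measurable borel"
  shows "integrable m f \<longleftrightarrow> integrable lborel (\<lambda>x. \<rho> x * f x)"
proof -
  have "AE x in lborel. 0 \<le> \<rho> x" using \<rho>_pos by eventually_elim simp
  then show ?thesis
    unfolding m_of_def using assms by (subst integrable_density) auto
qed

lemma indicator_cball_integrable: "integrable m (indicator (cball 0 r) :: 'a \<Rightarrow> real)"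
proof -
  have "integrable lborel (\<lambda>x. indicator (cball 0 r) x *\<^sub>R \<rho> x)"
    by (intro borel_integrable_compact) (auto intro: continuous_on_subset[OF \<rho>_cont])
  then show ?thesis
    by (subst integrable_m_iff) (auto simp: mult.commute borel_measurable_indicator)
qed

lemma bounded_support_integrable:
  fixes f :: "'a \<Rightarrow> real"
  assumes "f \<in> borel_measurable borel" "\<And>x. \<bar>f x\<bar> \<le> C" "\<And>x. r \<le> norm x \<Longrightarrow> f x = 0"
  shows "integrable m f"
proof (rule Bochner_Integration.integrable_bound)
  show "integrable m (\<lambda>x. C * indicator (cball 0 r) x)"
    by (intro integrable_mult_right indicator_cball_integrable)
  have "\<bar>f x\<bar> \<le> \<bar>C * indicator (cball 0 r) x\<bar>" for x
    using assms(2,3)[of x] by (cases "norm x \<le> r") (auto simp: indicator_def intro: order_trans)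
  then show "AE x in m. norm (f x) \<le> norm (C * indicator (cball 0 r) x)" by simp
qed (use assms in auto)

lemma bounded_support_Lp:
  fixes f :: "'a \<Rightarrow> real"
  assumes f: "f \<in> borel_measurable borel" "\<And>x. \<bar>f x\<bar> \<le> C" "\<And>x. r \<le> norm x \<Longrightarrow> f x = 0"
    and "0 < q"
  shows "f \<in> Lp q m"
proof -
  have "integrable m (\<lambda>x. \<bar>f x\<bar> powr q)"
  proof (rule bounded_support_integrable[where C = "C powr q" and r = r])
    show "(\<lambda>x. \<bar>f x\<bar> powr q) \<in> borel_measurable borel" using f(1) by measurable
    show "\<bar>\<bar>f x\<bar> powr q\<bar> \<le> C powr q" for x
      using f(2)[of x] \<open>0 < q\<close> by (simp add: powr_mono2)
  qed (use f(3) \<open>0 < q\<close> in auto)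
  then show ?thesis using f(1) by (simp add: Lp_def)
qed

text \<open>Balls have finite measure, and \<open>a\<^sup>2 \<le> 1 + \<bar>a\<bar> powr q\<close>
  holds for \<open>q \<ge> 2\<close>.\<close>

lemma bounded_support_Lp_2:
  fixes f :: "'a \<Rightarrow> real"
  assumes f: "f \<in> Lp q m" "\<And>x. r \<le> norm x \<Longrightarrow> f x = 0" and "2 \<le> q"
  shows "f \<in> Lp 2 m"
proof -
  have fm: "f \<in> borel_measurable borel" using Lp_measurable[OF f(1)] by simp
  have "integrable m (\<lambda>x. (f x)\<^sup>2)"
  proof (rule Bochner_Integration.integrable_bound)
    show "integrable m (\<lambda>x. indicator (cball 0 r) x + \<bar>f x\<bar> powr q)"
      using Lp_integrable[OF f(1)] indicator_cball_integrable by simp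
    have "(f x)\<^sup>2 \<le> indicator (cball 0 r) x + \<bar>f x\<bar> powr q" for x
    proof (cases "r \<le> norm x")
      case True
      then show ?thesis by (simp add: f(2))
    next
      case False
      then have i: "indicator (cball 0 r) x = (1::real)" by simp
      show ?thesis
      proof (cases "\<bar>f x\<bar> \<le> 1")
        case True
        then have "(f x)\<^sup>2 \<le> 1" by (simp add: abs_square_le_1)
        with i show ?thesis by (simp add: add_increasing2)
      next
        case False
        then have "\<bar>f x\<bar> powr 2 \<le> \<bar>f x\<bar> powr q" using \<open>2 \<le> q\<close> by (intro powr_mono) auto
        with i show ?thesis by simp
      qed
    qed
    then show "AE x in m. norm ((f x)\<^sup>2) \<le> norm (indicator (cball 0 r) x + \<bar>f x\<bar> powr q)"
      by (auto intro: order_trans)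
  qed (use fm in auto)
  then show ?thesis using fm by (simp add: Lp_2_iff)
qed

lemma test_functions_Lp:
  assumes "f \<in> test_functions" "0 < q"
  shows "f \<in> Lp q m"
proof -
  obtain C where "\<And>x. \<bar>f x\<bar> \<le> C" by (rule test_functions_bounded[OF assms(1)]) blast
  moreover obtain r where "\<And>x. r \<le> norm x \<Longrightarrow> f x = 0" by (rule grad_support[OF assms(1)]) blast
  ultimately show ?thesis
    using test_functions_measurable[OF assms(1)] \<open>0 < q\<close> by (intro bounded_support_Lp) auto
qed

lemma locally_Lp_bound:
  fixes f b :: "'a \<Rightarrow> real"
  assumes b: "b \<in> Lp_loc q m" and "f \<in> borel_measurable borel"
    and le: "\<And>x. \<bar>f x\<bar> \<le> C * \<bar>b x\<bar>" and supp: "\<And>x. r \<le> norm x \<Longrightarrow> f x = 0" and "0 \<le> q"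
  shows "f \<in> Lp q m"
proof (rule Lp_bound)
  have "compact (closure (ball (0::'a) r))" by simp
  then have "(\<lambda>x. b x * indicator (ball 0 r) x) \<in> Lp q m"
    using b by (auto simp: Lp_loc_def)
  then show "(\<lambda>x. C * (b x * indicator (ball 0 r) x)) \<in> Lp q m" by (rule Lp_cmult)
  have "\<bar>f x\<bar> \<le> \<bar>C * (b x * indicator (ball 0 r) x)\<bar>" for x
  proof (cases "r \<le> norm x")
    case False
    have "C * \<bar>b x\<bar> \<le> \<bar>C\<bar> * \<bar>b x\<bar>" by (intro mult_right_mono) auto
    with False le[of x] show ?thesis by (simp add: abs_mult)
  qed (simp add: supp)
  then show "AE x in m. \<bar>f x\<bar> \<le> \<bar>C * (b x * indicator (ball 0 r) x)\<bar>" by simp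
qed (use assms in auto)

end

definition laplacian :: "('a::euclidean_space \<Rightarrow> real) \<Rightarrow> 'a \<Rightarrow> real" where
  "laplacian f x = (\<Sum>b\<in>Basis. partial b (partial b f) x)"

text \<open>\<open>w\<close> is the weak gradient of \<open>\<rho>\<close>.\<close>
definition drift_operator ::
    "('a::euclidean_space \<Rightarrow> real) \<Rightarrow> ('a \<Rightarrow> 'a) \<Rightarrow> ('a \<Rightarrow> 'a) \<Rightarrow> ('a \<Rightarrow> real) \<Rightarrow> 'a \<Rightarrow> real" where
  "drift_operator \<rho> w B f x = 1 / 2 * laplacian f x + 1 / 2 * ((w x \<bullet> grad f x) / \<rho> x) + B x \<bullet> grad f x"

locale distorted_brownian = weighted_space \<rho> for \<rho> :: "'a::euclidean_space \<Rightarrow> real" +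
  fixes w B :: "'a \<Rightarrow> 'a" and p :: real
  assumes p_ge_2: "2 \<le> p"
    and w: "has_weak_gradient \<rho> w" and w_Lp: "(\<lambda>x. norm (w x) / \<rho> x) \<in> Lp_loc p m"
    and H2: "H2 p \<rho> B" and H3: "H3 \<rho> B"
begin

abbreviation L where "L \<equiv> drift_operator \<rho> w B"

lemma w_measurable [measurable]: "w \<in> borel_measurable borel"
  using w by (simp add: has_weak_gradient_def)

lemma B_measurable [measurable]: "B \<in> borel_measurable borel"
  using H2 by (simp add: H2_def)

section \<open>The operator on test functions and integration by parts\<close>

lemma laplacian_Lp:
  assumes f: "f \<in> test_functions" and "0 < q"
  shows "laplacian f \<in> Lp q m"
proof -
  have "\<exists>C. \<forall>x. \<bar>partial b (partial b f) x\<bar> \<le> C" if "b \<in> Basis" for b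
    using test_functions_bounded[OF test_functions_partial[OF test_functions_partial[OF f that] that]] by metis
  then obtain C where "\<And>b x. b \<in> Basis \<Longrightarrow> \<bar>partial b (partial b f) x\<bar> \<le> C b" by metis
  then have "\<bar>laplacian f x\<bar> \<le> (\<Sum>b\<in>Basis. C b)" for x
    unfolding laplacian_def by (intro sum_abs[THEN order_trans] sum_mono) auto
  moreover obtain r where r: "\<And>x b. b \<in> Basis \<Longrightarrow> r \<le> norm x \<Longrightarrow> partial b (partial b f) x = 0"
    by (rule grad_support[OF f]) blast
  moreover have "laplacian f \<in> borel_measurable borel"
    unfolding laplacian_def[abs_def]
    by (intro borel_measurable_sum test_functions_measurable test_functions_partial f)
  ultimately show ?thesis
    using \<open>0 < q\<close> by (intro bounded_support_Lp[where r = r]) (auto simp: laplacian_def r)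
qed

lemma
  assumes f: "f \<in> test_functions"
  shows drift_w_Lp: "(\<lambda>x. (w x \<bullet> grad f x) / \<rho> x) \<in> Lp p m"
    and drift_B_Lp: "(\<lambda>x. B x \<bullet> grad f x) \<in> Lp p m"
    and drift_w_Lp_2: "(\<lambda>x. (w x \<bullet> grad f x) / \<rho> x) \<in> Lp 2 m"
    and drift_B_Lp_2: "(\<lambda>x. B x \<bullet> grad f x) \<in> Lp 2 m"
proof -
  note [measurable] = grad_measurable[OF f]
  obtain C where C: "0 \<le> C" "\<And>x. norm (grad f x) \<le> C" by (rule grad_bounded[OF f]) blast
  obtain r where r: "\<And>x. r \<le> norm x \<Longrightarrow> grad f x = 0" by (rule grad_support[OF f]) blast
  have le: "\<bar>v \<bullet> grad f x\<bar> \<le> C * norm v" for v x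
    using Cauchy_Schwarz_ineq2[of v "grad f x"] mult_left_mono[OF C(2)[of x], of "norm v"]
    by (simp add: mult.commute)
  show w1: "(\<lambda>x. (w x \<bullet> grad f x) / \<rho> x) \<in> Lp p m"
  proof (rule locally_Lp_bound[OF w_Lp, where r = r])
    show "\<bar>(w x \<bullet> grad f x) / \<rho> x\<bar> \<le> C * \<bar>norm (w x) / \<rho> x\<bar>" for x
      using le[of "w x" x] by (simp add: divide_right_mono)
  qed (use r p_ge_2 in auto)
  show B1: "(\<lambda>x. B x \<bullet> grad f x) \<in> Lp p m"
  proof (rule locally_Lp_bound[where b = "\<lambda>x. norm (B x)" and r = r])
    show "(\<lambda>x. norm (B x)) \<in> Lp_loc p m" using H2 by (simp add: H2_def)
    show "\<bar>B x \<bullet> grad f x\<bar> \<le> C * \<bar>norm (B x)\<bar>" for x using le by simp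
  qed (use r p_ge_2 in auto)
  show "(\<lambda>x. (w x \<bullet> grad f x) / \<rho> x) \<in> Lp 2 m"
    by (rule bounded_support_Lp_2[OF w1 _ p_ge_2, of r]) (simp add: r)
  show "(\<lambda>x. B x \<bullet> grad f x) \<in> Lp 2 m"
    by (rule bounded_support_Lp_2[OF B1 _ p_ge_2, of r]) (simp add: r)
qed

text \<open>The local exponent \<open>p\<close> in (H1) and (H2) survives multiplication by a
  compactly supported bounded gradient. Being in \<open>L\<^sup>p\<close> makes
  \<open>R 1 (f - L f)\<close> continuous on \<open>E\<close>, whereas the generator needs the
  \<open>L\<^sup>2\<close> variant.\<close>

lemma L_Lp:
  assumes "f \<in> test_functions"
  shows "L f \<in> Lp p m"
  unfolding drift_operator_def[abs_def] using p_ge_2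
  by (intro Lp_add Lp_cmult laplacian_Lp drift_w_Lp drift_B_Lp assms) auto

lemma L_Lp_2:
  assumes "f \<in> test_functions"
  shows "L f \<in> Lp 2 m"
  unfolding drift_operator_def[abs_def]
  by (intro Lp_add Lp_cmult laplacian_Lp drift_w_Lp_2 drift_B_Lp_2 assms) auto

text \<open>In each direction \<open>b\<close> the weak gradient of \<open>\<rho>\<close> is tested
  with the product of \<open>g\<close> and the partial derivative of \<open>f\<close>; the product
  rule produces the second derivative. The remaining Lebesgue integral of \<open>w\<close> becomes
  an integral for \<open>m\<close> after division by \<open>\<rho>\<close>, which is positive almost
  everywhere.\<close>

lemma integral_grad_product:
  assumes f: "f \<in> test_functions" and g: "g \<in> test_functions"
  shows "(\<integral>x. grad f x \<bullet> grad g x \<partial>m)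
    = - (\<integral>x. laplacian f x * g x \<partial>m) - (\<integral>x. (w x \<bullet> grad f x) / \<rho> x * g x \<partial>m)"
proof -
  note [measurable] = grad_measurable[OF f] grad_measurable[OF g] test_functions_measurable[OF g]
  have [measurable]: "partial b f \<in> borel_measurable borel" "partial b g \<in> borel_measurable borel"
    "partial b (partial b f) \<in> borel_measurable borel" if "b \<in> Basis" for b
    using f g that by (auto intro!: test_functions_measurable test_functions_partial)
  have T2: "h \<in> Lp 2 m" if "h \<in> test_functions" for h using test_functions_Lp[OF that] by simp
  have ibp: "(\<integral>x. partial b f x * partial b g x \<partial>m)
      = - (\<integral>x. partial b (partial b f) x * g x \<partial>m) - (\<integral>x. g x * partial b f x * (w x \<bullet> b) \<partial>lborel)"
    and int: "integrable lborel (\<lambda>x. g x * partial b f x * (w x \<bullet> b))"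
    if b: "b \<in> Basis" for b
  proof -
    define \<phi> where "\<phi> x = g x * partial b f x" for x
    have \<phi>: "\<phi> \<in> test_functions"
      unfolding \<phi>_def[abs_def] by (intro test_functions_mult g test_functions_partial f b)
    note [measurable] = grad_measurable[OF \<phi>] test_functions_measurable[OF \<phi>]
    obtain C where C: "\<And>x. norm (grad \<phi> x) \<le> C" by (rule grad_bounded[OF \<phi>]) blast
    obtain r where r: "\<And>x. r \<le> norm x \<Longrightarrow> \<phi> x = 0" "\<And>x. r \<le> norm x \<Longrightarrow> grad \<phi> x = 0"
      by (rule grad_support[OF \<phi>]) blast
    obtain C' where C': "\<And>x. \<bar>\<phi> x\<bar> \<le> C'" by (rule test_functions_bounded[OF \<phi>]) blast
    have "integrable m (\<lambda>x. norm (grad \<phi> x))"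
      by (rule bounded_support_integrable[where C = C and r = r]) (use C r in auto)
    then have "integrable lborel (\<lambda>x. \<rho> x * norm (grad \<phi> x))"
      by (subst (asm) integrable_m_iff) auto
    then have i1: "integrable lborel (\<lambda>x. \<rho> x *\<^sub>R grad \<phi> x)"
      by (rule Bochner_Integration.integrable_bound) (auto simp: abs_mult)
    have "compact (closure (ball (0::'a) r))" by simp
    then have "(\<lambda>x. norm (w x) * indicator (ball 0 r) x) \<in> Lp 1 lborel"
      using w unfolding has_weak_gradient_def Lp_loc_def by blast
    then have "integrable lborel (\<lambda>x. C' * \<bar>norm (w x) * indicator (ball 0 r) x\<bar>)"
      by (intro integrable_mult_right) (auto simp: Lp_def)
    then have i2: "integrable lborel (\<lambda>x. \<phi> x *\<^sub>R w x)"
    proof (rule Bochner_Integration.integrable_bound)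
      have "norm (\<phi> x *\<^sub>R w x) \<le> norm (C' * \<bar>norm (w x) * indicator (ball 0 r) x\<bar>)" for x
      proof (cases "r \<le> norm x")
        case True
        then show ?thesis by (simp add: r)
      next
        case False
        have "\<bar>\<phi> x\<bar> \<le> \<bar>C'\<bar>" using C'[of x] by linarith
        with False show ?thesis by (simp add: abs_mult mult_right_mono)
      qed
      then show "AE x in lborel. norm (\<phi> x *\<^sub>R w x) \<le> norm (C' * \<bar>norm (w x) * indicator (ball 0 r) x\<bar>)"
        by simp
    qed simp
    show "integrable lborel (\<lambda>x. g x * partial b f x * (w x \<bullet> b))"
      using integrable_inner_left[OF i2, of b] by (simp add: \<phi>_def)
    have "(\<integral>x. \<rho> x *\<^sub>R grad \<phi> x \<partial>lborel) \<bullet> b = - (\<integral>x. \<phi> x *\<^sub>R w x \<partial>lborel) \<bullet> b"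
      using w \<phi> by (simp add: has_weak_gradient_def)
    then have "(\<integral>x. \<rho> x * (grad \<phi> x \<bullet> b) \<partial>lborel) = - (\<integral>x. \<phi> x * (w x \<bullet> b) \<partial>lborel)"
      using i1 i2 integral_inner_left[OF i1, of b] integral_inner_left[OF i2, of b] by simp
    moreover have "(\<integral>x. \<rho> x * (grad \<phi> x \<bullet> b) \<partial>lborel) = (\<integral>x. grad \<phi> x \<bullet> b \<partial>m)"
      by (subst integral_m) auto
    moreover have "grad \<phi> x \<bullet> b = partial b f x * partial b g x + partial b (partial b f) x * g x" for x
      using b f g test_functions_partial[OF f b]
      by (simp add: \<phi>_def[abs_def] grad_inner partial_mult test_functions_differentiable mult.commute)
    moreover have "(\<integral>x. partial b f x * partial b g x + partial b (partial b f) x * g x \<partial>m)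
        = (\<integral>x. partial b f x * partial b g x \<partial>m) + (\<integral>x. partial b (partial b f) x * g x \<partial>m)"
      using f g b by (intro Bochner_Integration.integral_add Lp_2_integrable_mult T2 test_functions_partial)
    ultimately show "(\<integral>x. partial b f x * partial b g x \<partial>m)
      = - (\<integral>x. partial b (partial b f) x * g x \<partial>m) - (\<integral>x. g x * partial b f x * (w x \<bullet> b) \<partial>lborel)"
      by (simp add: \<phi>_def)
  qed
  have "(\<integral>x. grad f x \<bullet> grad g x \<partial>m) = (\<integral>x. (\<Sum>b\<in>Basis. partial b f x * partial b g x) \<partial>m)"
    by (subst euclidean_inner) (simp add: grad_inner)
  also have "\<dots> = (\<Sum>b\<in>Basis. \<integral>x. partial b f x * partial b g x \<partial>m)"
    using f g by (intro Bochner_Integration.integral_sum Lp_2_integrable_mult T2 test_functions_partial)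
  also have "\<dots> = - (\<Sum>b\<in>Basis. \<integral>x. partial b (partial b f) x * g x \<partial>m)
      - (\<Sum>b\<in>Basis. \<integral>x. g x * partial b f x * (w x \<bullet> b) \<partial>lborel)"
    by (simp add: ibp sum_subtractf sum_negf)
  also have "(\<Sum>b\<in>Basis. \<integral>x. partial b (partial b f) x * g x \<partial>m) = (\<integral>x. laplacian f x * g x \<partial>m)"
    unfolding laplacian_def sum_distrib_right using f g
    by (intro Bochner_Integration.integral_sum[symmetric] Lp_2_integrable_mult T2 test_functions_partial)
  also have "(\<Sum>b\<in>Basis. \<integral>x. g x * partial b f x * (w x \<bullet> b) \<partial>lborel)
      = (\<integral>x. (\<Sum>b\<in>Basis. g x * partial b f x * (w x \<bullet> b)) \<partial>lborel)"
    by (intro Bochner_Integration.integral_sum[symmetric] int)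
  also have "\<dots> = (\<integral>x. \<rho> x * ((w x \<bullet> grad f x) / \<rho> x * g x) \<partial>lborel)"
  proof (rule integral_cong_AE)
    have "(\<Sum>b\<in>Basis. g x * partial b f x * (w x \<bullet> b)) = (w x \<bullet> grad f x) * g x" for x
      by (subst euclidean_inner) (simp add: grad_inner sum_distrib_left sum_distrib_right mult_ac)
    then show "AE x in lborel. (\<Sum>b\<in>Basis. g x * partial b f x * (w x \<bullet> b))
        = \<rho> x * ((w x \<bullet> grad f x) / \<rho> x * g x)"
      using \<rho>_pos by (auto elim!: eventually_mono)
  qed (simp_all, measurable)
  also have "\<dots> = (\<integral>x. (w x \<bullet> grad f x) / \<rho> x * g x \<partial>m)"
    by (subst integral_m) auto
  finally show ?thesis .
qed

lemma pre_form_eq: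
  assumes f: "f \<in> test_functions" and g: "g \<in> test_functions"
  shows "pre_form \<rho> B f g = - L2_inner m (L f) g"
proof -
  have g2: "g \<in> Lp 2 m" using test_functions_Lp[OF g] by simp
  define X Y Z where "X x = laplacian f x * g x" and "Y x = (w x \<bullet> grad f x) / \<rho> x * g x"
    and "Z x = (B x \<bullet> grad f x) * g x" for x
  have int: "integrable m X" "integrable m Y" "integrable m Z"
    unfolding X_def[abs_def] Y_def[abs_def] Z_def[abs_def]
    by (intro Lp_2_integrable_mult laplacian_Lp drift_w_Lp_2 drift_B_Lp_2 f g2; simp)+
  have "L2_inner m (L f) g = (\<integral>x. 1 / 2 * X x + 1 / 2 * Y x + Z x \<partial>m)"
    unfolding L2_inner_def drift_operator_def X_def Y_def Z_def
    by (rule Bochner_Integration.integral_cong) (auto simp: algebra_simps)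
  also have "\<dots> = 1 / 2 * integral\<^sup>L m X + 1 / 2 * integral\<^sup>L m Y + integral\<^sup>L m Z"
    using int by simp
  finally have "L2_inner m (L f) g = 1 / 2 * integral\<^sup>L m X + 1 / 2 * integral\<^sup>L m Y + integral\<^sup>L m Z" .
  then show ?thesis
    unfolding pre_form_def integral_grad_product[OF f g]
    by (simp add: X_def[abs_def] Y_def[abs_def] Z_def[abs_def] algebra_simps)
qed

text \<open>The square of \<open>f\<close> is a test function with gradient
  \<open>2 f grad f\<close>, so the divergence condition in (H2), applied to it, removes the drift
  term on the diagonal.\<close>

lemma pre_form_self:
  assumes f: "f \<in> test_functions"
  shows "pre_form \<rho> B f f = form0 \<rho> f f"
proof -
  have "(\<integral>x. B x \<bullet> grad (\<lambda>x. f x * f x) x \<partial>m) = 0"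
    using H2 test_functions_mult[OF f f] by (simp add: H2_def)
  moreover have "B x \<bullet> grad (\<lambda>x. f x * f x) x = 2 * ((B x \<bullet> grad f x) * f x)" for x
    by (simp add: grad_mult f inner_right_distrib)
  ultimately have "(\<integral>x. (B x \<bullet> grad f x) * f x \<partial>m) = 0" by simp
  then show ?thesis by (simp add: pre_form_def form0_def)
qed

section \<open>Sector condition and closure of the form\<close>

lemma norm_grad_Lp_2:
  assumes f: "f \<in> test_functions"
  shows "(\<lambda>x. norm (grad f x)) \<in> Lp 2 m"
proof -
  note [measurable] = grad_measurable[OF f]
  obtain C where "\<And>x. norm (grad f x) \<le> C" by (rule grad_bounded[OF f]) blast
  moreover obtain r where "\<And>x. r \<le> norm x \<Longrightarrow> grad f x = 0" by (rule grad_support[OF f]) blast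
  ultimately show ?thesis by (intro bounded_support_Lp) auto
qed

lemma form0_self: "form0 \<rho> f f = 1 / 2 * (Lp_norm 2 m (\<lambda>x. norm (grad f x)))\<^sup>2"
  by (simp add: form0_def Lp_norm_2_power2 dot_square_norm)

lemma form0_bound:
  assumes f: "f \<in> test_functions" and g: "g \<in> test_functions"
  shows "\<bar>form0 \<rho> f g\<bar> \<le> sqrt (form0 \<rho> f f) * sqrt (form0 \<rho> g g)"
proof -
  note [measurable] = grad_measurable[OF f] grad_measurable[OF g]
  let ?f = "\<lambda>x. norm (grad f x)" and ?g = "\<lambda>x. norm (grad g x)"
  have i: "integrable m (\<lambda>x. ?f x * ?g x)"
    by (intro Lp_2_integrable_mult norm_grad_Lp_2 f g)
  then have i': "integrable m (\<lambda>x. grad f x \<bullet> grad g x)"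
    by (rule Bochner_Integration.integrable_bound) (auto simp: Cauchy_Schwarz_ineq2)
  have "\<bar>\<integral>x. grad f x \<bullet> grad g x \<partial>m\<bar> \<le> (\<integral>x. \<bar>grad f x \<bullet> grad g x\<bar> \<partial>m)"
    by (rule integral_abs_bound)
  also have "\<dots> \<le> L2_inner m ?f ?g"
    unfolding L2_inner_def using i i' by (intro integral_mono) (auto simp: Cauchy_Schwarz_ineq2)
  also have "\<dots> \<le> Lp_norm 2 m ?f * Lp_norm 2 m ?g"
    using L2_Cauchy_Schwarz[OF norm_grad_Lp_2[OF f] norm_grad_Lp_2[OF g]] by simp
  finally have "\<bar>form0 \<rho> f g\<bar> \<le> 1 / 2 * (Lp_norm 2 m ?f * Lp_norm 2 m ?g)"
    by (simp add: form0_def)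
  also have "\<dots> = sqrt (form0 \<rho> f f) * sqrt (form0 \<rho> g g)"
    by (simp add: form0_self real_sqrt_mult real_sqrt_divide Lp_norm_2_nonneg)
  finally show ?thesis .
qed

lemma form0_1_eq:
  assumes "f \<in> test_functions"
  shows "form0_1 \<rho> f f = pre_form \<rho> B f f + (Lp_norm 2 m f)\<^sup>2"
  by (simp add: form0_1_def pre_form_self assms L2_inner_self)

text \<open>The symmetric part obeys the Cauchy-Schwarz inequality with constant 1, and (H3) bounds
  the drift part. The absolute value of \<open>c\<close> makes the sum of the constants nonnegative
  whatever the sign of \<open>c\<close>.\<close>

lemma pre_form_sector:
  obtains K where "0 \<le> K" "\<And>f g. f \<in> test_functions \<Longrightarrow> g \<in> test_functions \<Longrightarrow>
    \<bar>pre_form \<rho> B f g\<bar> \<le> K * sqrt (form0_1 \<rho> f f) * sqrt (form0_1 \<rho> g g)"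
proof -
  obtain c where c: "\<And>f g. f \<in> test_functions \<Longrightarrow> g \<in> test_functions \<Longrightarrow>
      \<bar>\<integral>x. (B x \<bullet> grad f x) * g x * \<rho> x \<partial>lborel\<bar> \<le> c * sqrt (form0_1 \<rho> f f) * sqrt (form0_1 \<rho> g g)"
    using H3 unfolding H3_def by blast
  show ?thesis
  proof (rule that[of "1 + \<bar>c\<bar>"])
    fix f g :: "'a \<Rightarrow> real" assume f: "f \<in> test_functions" and g: "g \<in> test_functions"
    note [measurable] = grad_measurable[OF f] test_functions_measurable[OF g]
    let ?q = "sqrt (form0_1 \<rho> f f) * sqrt (form0_1 \<rho> g g)"
    have q: "0 \<le> ?q" by (simp add: form0_1_def form0_self L2_inner_self)
    have "(\<integral>x. (B x \<bullet> grad f x) * g x \<partial>m) = (\<integral>x. (B x \<bullet> grad f x) * g x * \<rho> x \<partial>lborel)"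
      by (subst integral_m) (auto simp: mult_ac)
    then have "\<bar>\<integral>x. (B x \<bullet> grad f x) * g x \<partial>m\<bar> \<le> c * ?q"
      using c[OF f g] by (simp add: mult.assoc)
    also have "\<dots> \<le> \<bar>c\<bar> * ?q" using q by (intro mult_right_mono) auto
    finally have "\<bar>\<integral>x. (B x \<bullet> grad f x) * g x \<partial>m\<bar> \<le> \<bar>c\<bar> * ?q" .
    moreover have "\<bar>form0 \<rho> f g\<bar> \<le> ?q"
      using form0_bound[OF f g]
      by (rule order_trans) (auto intro!: mult_mono simp: form0_1_def L2_inner_self form0_self)
    ultimately show "\<bar>pre_form \<rho> B f g\<bar> \<le> (1 + \<bar>c\<bar>) * sqrt (form0_1 \<rho> f f) * sqrt (form0_1 \<rho> g g)"
      unfolding pre_form_def form0_def[symmetric] by (simp add: algebra_simps)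
  qed simp
qed

lemma L_diff:
  assumes f: "f \<in> test_functions" and g: "g \<in> test_functions"
  shows "L (\<lambda>x. f x - g x) x = L f x - L g x"
proof -
  have *: "partial b (\<lambda>x. f x - g x) y = partial b f y - partial b g y"
    if "f \<in> test_functions" "g \<in> test_functions" for f g :: "'a \<Rightarrow> real" and b y
    using partial_lincomb[of f y g b 1 "-1"] that by (simp add: test_functions_differentiable)
  have "partial b (partial b (\<lambda>x. f x - g x)) x = partial b (partial b f) x - partial b (partial b g) x"
    if "b \<in> Basis" for b
  proof -
    have "partial b (\<lambda>x. f x - g x) = (\<lambda>y. partial b f y - partial b g y)"
      by (rule ext) (rule *[OF f g])
    then show ?thesis
      using *[OF test_functions_partial[OF f that] test_functions_partial[OF g that]] by simp
  qed
  then have "laplacian (\<lambda>x. f x - g x) x = laplacian f x - laplacian g x"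
    by (simp add: laplacian_def sum_subtractf)
  then show ?thesis
    by (simp add: drift_operator_def grad_diff f g inner_diff_right diff_divide_distrib algebra_simps)
qed

lemma
  assumes f: "f \<in> test_functions"
  shows test_function_dirichlet_dom: "f \<in> dirichlet_dom \<rho> B"
    and test_function_dirichlet_form:
      "v \<in> dirichlet_dom \<rho> B \<Longrightarrow> dirichlet_form \<rho> B f v = - L2_inner m (L f) v"
proof -
  obtain K where K: "0 \<le> K" "\<And>f g. f \<in> test_functions \<Longrightarrow> g \<in> test_functions \<Longrightarrow>
    \<bar>pre_form \<rho> B f g\<bar> \<le> K * sqrt (form0_1 \<rho> f f) * sqrt (form0_1 \<rho> g g)"
    by (rule pre_form_sector) blast
  interpret represented_form m test_functions "pre_form \<rho> B" L K
  proof
    show "pre_form \<rho> B (\<lambda>x. f x - g x) h = pre_form \<rho> B f h - pre_form \<rho> B g h"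
      if "f \<in> test_functions" "g \<in> test_functions" "h \<in> test_functions" for f g h
    proof -
      have "L (\<lambda>x. f x - g x) = (\<lambda>x. L f x - L g x)"
        by (rule ext) (rule L_diff[OF that(1,2)])
      then show ?thesis
        using that test_functions_Lp[of h 2]
        by (simp add: pre_form_eq test_functions_diff L2_inner_diff L_Lp_2)
    qed
    show "0 \<le> pre_form \<rho> B f f" if "f \<in> test_functions" for f
      by (simp add: pre_form_self form0_self that)
    show "\<bar>pre_form \<rho> B f g\<bar> \<le> K * sqrt (pre_form \<rho> B f f + (Lp_norm 2 m f)\<^sup>2)
        * sqrt (pre_form \<rho> B g g + (Lp_norm 2 m g)\<^sup>2)"
      if "f \<in> test_functions" "g \<in> test_functions" for f g
      using K(2)[OF that] by (simp add: form0_1_eq that)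
  qed (use K test_functions_Lp[where q = 2] in \<open>simp_all add: test_functions_diff L_Lp_2 pre_form_eq\<close>)
  show "f \<in> dirichlet_dom \<rho> B"
    unfolding dirichlet_dom_def by (rule D_subset_closure_dom[OF f])
  show "dirichlet_form \<rho> B f v = - L2_inner m (L f) v" if "v \<in> dirichlet_dom \<rho> B"
    using closure_form_eq[OF f] that by (simp add: dirichlet_dom_def dirichlet_form_def)
qed

end


section \<open>The transition densities at every point\<close>

context weighted_space
begin

abbreviation E where "E \<equiv> E_of \<rho>"
abbreviation N where "N \<equiv> mE_of \<rho>"

lemma open_E: "open E"
  unfolding E_of_def using \<rho>_cont by (intro open_Collect_less) auto

lemma E_sets [measurable]: "E \<in> sets borel"
  using open_E by simp

lemma AE_m_E: "AE x in m. x \<in> E"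
  using AE_m_\<rho>_pos by (simp add: E_of_def)

lemma space_N [simp]: "space N = E"
  by (simp add: mE_of_def space_restrict_space)

lemma E_sets_N [simp]: "E \<in> sets N"
  using sets.top[of N] by simp

lemma AE_N_iff: "(AE x in N. P x) \<longleftrightarrow> (AE x in m. P x)"
proof -
  have "(AE x in N. P x) \<longleftrightarrow> (AE x in m. x \<in> E \<longrightarrow> P x)"
    unfolding mE_of_def by (rule AE_restrict_space_iff) simp
  also have "\<dots> \<longleftrightarrow> (AE x in m. P x)"
    using AE_m_E by (auto elim: eventually_elim2)
  finally show ?thesis .
qed

lemma integral_N: "(\<integral>y. f y \<partial>N) = (\<integral>y. indicator E y * f y \<partial>m)" for f :: "'a \<Rightarrow> real"
  unfolding mE_of_def by (subst integral_restrict_space) auto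

lemma integrable_N_iff: "integrable N f \<longleftrightarrow> integrable m (\<lambda>y. indicator E y * f y)" for f :: "'a \<Rightarrow> real"
  unfolding mE_of_def by (subst integrable_restrict_space) auto

lemma nn_integral_N: "(\<integral>\<^sup>+y. f y \<partial>N) = (\<integral>\<^sup>+y. f y * indicator E y \<partial>m)"
  unfolding mE_of_def by (subst nn_integral_restrict_space) auto

lemma measurable_N_iff:
  "f \<in> borel_measurable N \<longleftrightarrow> (\<lambda>y. indicator E y * f y) \<in> borel_measurable borel" for f :: "'a \<Rightarrow> real"
proof -
  have "f \<in> borel_measurable N \<longleftrightarrow> (\<lambda>y. indicator E y *\<^sub>R f y) \<in> borel_measurable m"
    unfolding mE_of_def by (rule borel_measurable_restrict_space_iff) simp
  then show ?thesis by simp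
qed

text \<open>A nonempty open set is not Lebesgue null, and \<open>m\<close> has the same null sets.
  This is the passage from almost everywhere to every point of \<open>E\<close>; it needs continuity
  of both sides.\<close>

lemma le_on_E_if_AE_le:
  fixes f g :: "'a \<Rightarrow> real"
  assumes "continuous_on E f" "continuous_on E g" "AE x in m. f x \<le> g x" "x \<in> E"
  shows "f x \<le> g x"
proof (rule ccontr)
  assume less: "\<not> f x \<le> g x"
  define U where "U = E \<inter> (\<lambda>x. f x - g x) -` {0<..}"
  have "open U"
    unfolding U_def using assms open_E
    by (intro continuous_open_preimage continuous_intros) auto
  have "AE x in lborel. x \<notin> U"
    using assms(3) unfolding AE_m_iff by eventually_elim (simp add: U_def)
  then have "U \<in> null_sets lborel"
    using \<open>open U\<close> AE_iff_null_sets[of U lborel] by simp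
  then have "negligible U"
    by (simp add: negligible_iff_null_sets null_sets_completionI)
  then have "U = {}"
    using \<open>open U\<close> open_not_negligible by blast
  then show False
    using less \<open>x \<in> E\<close> by (auto simp: U_def)
qed

lemma eq_on_E_if_AE_eq:
  fixes f g :: "'a \<Rightarrow> real"
  assumes "continuous_on E f" "continuous_on E g" "AE x in m. f x = g x" "x \<in> E"
  shows "f x = g x"
proof (rule antisym)
  show "f x \<le> g x"
    by (rule le_on_E_if_AE_le[OF assms(1,2) _ assms(4)]) (use assms(3) in \<open>auto elim: eventually_mono\<close>)
  show "g x \<le> f x"
    by (rule le_on_E_if_AE_le[OF assms(2,1) _ assms(4)]) (use assms(3) in \<open>auto elim: eventually_mono\<close>)
qed

text \<open>Extending a kernel by 0 in its second argument turns integrals over the restricted space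
  \<open>N\<close> into integrals over \<open>m\<close>, on which the other function spaces are
  based.\<close>

definition on_E :: "('a \<Rightarrow> 'a \<Rightarrow> real) \<Rightarrow> 'a \<Rightarrow> 'a \<Rightarrow> real" where
  "on_E k x y = indicator E y * k x y"

lemma kernel_op_eq: "kernel_op N k f x = (\<integral>y. f y * on_E k x y \<partial>m)"
  by (simp add: kernel_op_def integral_N on_E_def mult_ac)

lemma on_E_integrable_iff: "integrable N (\<lambda>y. f y * k x y) \<longleftrightarrow> integrable m (\<lambda>y. f y * on_E k x y)"
  by (simp add: integrable_N_iff on_E_def mult_ac)

lemma kernel_density_on_E:
  assumes "kernel_density N k" "x \<in> E"
  shows "on_E k x \<in> borel_measurable borel" "0 \<le> on_E k x y"
  using assms measurable_N_iff[of "k x"]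
  by (auto simp: kernel_density_def on_E_def[abs_def] indicator_def)

text \<open>A kernel with a density ignores null sets at every single point, so any version of an
  \<open>L\<^sup>q\<close> function may stand inside \<open>P t\<close> or
  \<open>R \<alpha>\<close>.\<close>

lemma kernel_op_cong_AE:
  assumes "kernel_density N k" "x \<in> E" "f \<in> borel_measurable borel" "g \<in> borel_measurable borel"
    and "AE y in m. f y = g y"
  shows "kernel_op N k f x = kernel_op N k g x"
  unfolding kernel_op_eq
  by (rule integral_cong_AE) (use assms kernel_density_on_E in auto)

lemma kernel_op_nonneg:
  assumes "kernel_density N k" "x \<in> E" "AE y in m. 0 \<le> f y"
  shows "0 \<le> kernel_op N k f x"
  unfolding kernel_op_eq
proof (rule integral_nonneg_AE)
  show "AE y in m. 0 \<le> f y * on_E k x y"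
    using assms(3) by eventually_elim (simp add: kernel_density_on_E(2)[OF assms(1,2)])
qed

text \<open>These functions increase to \<open>1\<close> and lie in every \<open>L\<^sup>q\<close>
  with \<open>0 < q\<close>. They stand in for the constant \<open>1\<close>, to which the
  continuity of the kernels does not apply directly.\<close>

definition ball_indicator :: "nat \<Rightarrow> 'a \<Rightarrow> real" where
  "ball_indicator n = indicator (ball 0 (real n))"

lemma ball_indicator_bounds: "0 \<le> ball_indicator n x" "ball_indicator n x \<le> 1" "\<bar>ball_indicator n x\<bar> \<le> 1"
  by (auto simp: ball_indicator_def indicator_def)

lemma ball_indicator_mono: "n \<le> n' \<Longrightarrow> ball_indicator n x \<le> ball_indicator n' x"
  by (auto simp: ball_indicator_def indicator_def)

lemma ball_indicator_measurable [measurable]: "ball_indicator n \<in> borel_measurable borel"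
  unfolding ball_indicator_def by (intro borel_measurable_indicator) simp

lemma ball_indicator_tendsto: "(\<lambda>n. ball_indicator n x) \<longlonglongrightarrow> 1"
proof (rule tendsto_eventually)
  obtain n0 where "norm x < real n0" using reals_Archimedean2 by blast
  then show "\<forall>\<^sub>F n in sequentially. ball_indicator n x = 1"
    by (auto simp: eventually_sequentially ball_indicator_def indicator_def intro!: exI[of _ n0])
qed

lemma ball_indicator_mult_Lp:
  assumes "f \<in> borel_measurable borel" "\<And>x. \<bar>f x\<bar> \<le> C" "0 < q"
  shows "(\<lambda>x. f x * ball_indicator n x) \<in> Lp q m"
proof (rule bounded_support_Lp[where C = C and r = "real n"])
  show "\<bar>f x * ball_indicator n x\<bar> \<le> C" for x
    using mult_mono[OF assms(2)[of x] ball_indicator_bounds(3)[of n x]] assms(2)[of x]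
    by (simp add: abs_mult)
  show "(\<lambda>x. f x * ball_indicator n x) \<in> borel_measurable borel"
    using assms(1) by measurable
qed (use assms in \<open>auto simp: ball_indicator_def\<close>)

lemma ball_indicator_Lp: "0 < q \<Longrightarrow> ball_indicator n \<in> Lp q m"
  using ball_indicator_mult_Lp[of "\<lambda>_. 1" 1 q n] by simp

lemma ball_indicator_integrable: "integrable m (ball_indicator n)"
  by (rule bounded_support_integrable[where C = 1 and r = "real n"])
    (auto simp: ball_indicator_bounds, auto simp: ball_indicator_def)

text \<open>Interpolation by \<open>\<bar>h\<bar> powr q \<le> C powr (q - 2) * h\<^sup>2\<close>:
  for functions with a common bound, convergence to 0 in \<open>L\<^sup>2\<close> implies
  convergence to 0 in \<open>L\<^sup>q\<close>.\<close>

lemma Lp_if_bounded_Lp_2: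
  assumes h: "h \<in> Lp 2 m" and C: "AE x in m. \<bar>h x\<bar> \<le> C" and "2 \<le> q"
  shows "h \<in> Lp q m" "(\<integral>x. \<bar>h x\<bar> powr q \<partial>m) \<le> C powr (q - 2) * (Lp_norm 2 m h)\<^sup>2"
proof -
  have hm: "h \<in> borel_measurable borel" using Lp_2_measurable[OF h] by simp
  have le: "AE x in m. \<bar>h x\<bar> powr q \<le> C powr (q - 2) * (h x)\<^sup>2"
    using C
  proof eventually_elim
    case (elim x)
    show ?case
    proof (cases "h x = 0")
      case False
      have "\<bar>h x\<bar> powr q = \<bar>h x\<bar> powr (q - 2) * \<bar>h x\<bar> powr 2"
        using powr_add[of "\<bar>h x\<bar>" "q - 2" 2] by simp
      also have "\<dots> \<le> C powr (q - 2) * \<bar>h x\<bar> powr 2"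
        using elim \<open>2 \<le> q\<close> by (intro mult_right_mono powr_mono2) auto
      finally show ?thesis using False by simp
    qed simp
  qed
  have i: "integrable m (\<lambda>x. C powr (q - 2) * (h x)\<^sup>2)"
    using h by (simp add: Lp_2_iff)
  have i': "integrable m (\<lambda>x. \<bar>h x\<bar> powr q)"
    by (rule Bochner_Integration.integrable_bound[OF i]) (use hm le in \<open>auto elim: eventually_mono\<close>)
  then show "h \<in> Lp q m" using hm by (simp add: Lp_def)
  have "(\<integral>x. \<bar>h x\<bar> powr q \<partial>m) \<le> (\<integral>x. C powr (q - 2) * (h x)\<^sup>2 \<partial>m)"
    by (rule integral_mono_AE[OF i' i le])
  then show "(\<integral>x. \<bar>h x\<bar> powr q \<partial>m) \<le> C powr (q - 2) * (Lp_norm 2 m h)\<^sup>2"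
    by (simp add: Lp_norm_2_power2)
qed

end

locale conservative_distorted_brownian = distorted_brownian \<rho> w B p
  for \<rho> :: "'a::euclidean_space \<Rightarrow> real" and w B p +
  fixes T G :: "real \<Rightarrow> ('a \<Rightarrow> real) \<Rightarrow> 'a \<Rightarrow> real"
    and p_t r_l :: "real \<Rightarrow> 'a \<Rightarrow> 'a \<Rightarrow> real"
  assumes T_form: "is_semigroup_of_form \<rho> B T"
    and G_form: "is_resolvent_of_form \<rho> B G"
    and p_t: "is_transition_density p \<rho> T p_t"
    and r_l: "is_resolvent_density p \<rho> G r_l"
    and H4: "H4 \<rho> T"
begin

sublocale L2_contraction_semigroup m T
  by unfold_locales (use T_form in \<open>simp add: is_semigroup_of_form_def\<close>)

abbreviation P where "P t \<equiv> kernel_op N (p_t t)"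
abbreviation R where "R \<alpha> \<equiv> kernel_op N (r_l \<alpha>)"

lemma p_kernel: "0 < t \<Longrightarrow> kernel_density N (p_t t)"
  using p_t by (simp add: is_transition_density_def submarkovian_transition_density_def)

lemma r_kernel: "0 < \<alpha> \<Longrightarrow> kernel_density N (r_l \<alpha>)"
  using r_l by (simp add: is_resolvent_density_def)

lemma P_props:
  assumes "f \<in> Lp p m" "0 < t"
  shows "x \<in> E \<Longrightarrow> integrable m (\<lambda>y. f y * on_E (p_t t) x y)"
    and "continuous_on E (P t f)"
    and "AE x in m. P t f x = T t f x"
  using p_t assms unfolding is_transition_density_def AE_N_iff on_E_integrable_iff by blast+

lemma R_props:
  assumes "f \<in> Lp p m" "0 < \<alpha>"
  shows "x \<in> E \<Longrightarrow> integrable m (\<lambda>y. f y * on_E (r_l \<alpha>) x y)"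
    and "continuous_on E (R \<alpha> f)"
    and "AE x in m. R \<alpha> f x = G \<alpha> f x"
  using r_l assms unfolding is_resolvent_density_def AE_N_iff on_E_integrable_iff by blast+

section \<open>Total mass of the transition kernels\<close>

lemma p_t_mass_nn:
  assumes "0 < t" "x \<in> E"
  shows "emeasure (density N (p_t t x)) (space N) = (\<integral>\<^sup>+y. on_E (p_t t) x y \<partial>m)"
proof -
  have meas: "p_t t x \<in> borel_measurable N"
    using p_kernel[OF assms(1)] assms(2) by (simp add: kernel_density_def)
  then have "emeasure (density N (p_t t x)) (space N) = (\<integral>\<^sup>+y. ennreal (p_t t x y) * indicator (space N) y \<partial>N)"
    by (intro emeasure_density) auto
  also have "\<dots> = (\<integral>\<^sup>+y. on_E (p_t t) x y \<partial>m)"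
    unfolding nn_integral_N by (rule nn_integral_cong) (auto simp: on_E_def indicator_def)
  finally show ?thesis .
qed

lemma p_t_integrable:
  assumes "0 < t" "x \<in> E"
  shows "integrable m (on_E (p_t t) x)"
proof (rule integrableI_nonneg)
  have "(\<integral>\<^sup>+y. on_E (p_t t) x y \<partial>m) \<le> 1"
    using p_t assms unfolding p_t_mass_nn[OF assms, symmetric]
    by (auto simp: is_transition_density_def submarkovian_transition_density_def)
  then show "(\<integral>\<^sup>+y. on_E (p_t t) x y \<partial>m) < \<infinity>"
    using order_le_less_trans by fastforce
qed (use kernel_density_on_E[OF p_kernel[OF assms(1)] assms(2)] in auto)

text \<open>For fixed \<open>t\<close> no continuity in \<open>x\<close> is assumed, because
  \<open>1\<close> need not be in any \<open>L\<^sup>r\<close>.\<close>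

definition mass :: "real \<Rightarrow> 'a \<Rightarrow> real" where
  "mass t x = P t (\<lambda>_. 1) x"

lemma mass_eq: "mass t x = (\<integral>y. on_E (p_t t) x y \<partial>m)"
  by (simp add: mass_def kernel_op_eq)

lemma p_t_mass:
  assumes "0 < t" "x \<in> E"
  shows "emeasure (density N (p_t t x)) (space N) = ennreal (mass t x)"
  unfolding p_t_mass_nn[OF assms] mass_eq
  by (rule nn_integral_eq_integral[OF p_t_integrable[OF assms]])
    (simp add: kernel_density_on_E[OF p_kernel[OF assms(1)] assms(2)])

lemma mass_nonneg: "0 < t \<Longrightarrow> x \<in> E \<Longrightarrow> 0 \<le> mass t x"
  unfolding mass_def by (rule kernel_op_nonneg[OF p_kernel]) auto

lemma mass_le_1:
  assumes "0 < t" "x \<in> E"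
  shows "mass t x \<le> 1"
proof -
  have "ennreal (mass t x) \<le> 1"
    using p_t assms unfolding p_t_mass[OF assms, symmetric]
    by (auto simp: is_transition_density_def submarkovian_transition_density_def)
  then show ?thesis by simp
qed

lemma mass_chapman_kolmogorov:
  assumes "0 < s" "0 < t" "x \<in> E"
  shows "ennreal (mass (s + t) x) = (\<integral>\<^sup>+y. ennreal (on_E (p_t s) x y) * ennreal (mass t y) \<partial>m)"
proof -
  have meas: "p_t s x \<in> borel_measurable N"
    using p_kernel[OF assms(1)] assms(3) by (simp add: kernel_density_def)
  have meas': "(\<lambda>y. emeasure (density N (p_t t y)) (space N)) \<in> borel_measurable N"
    using p_kernel[OF assms(2)] unfolding kernel_density_def by blast
  have "ennreal (mass (s + t) x) = emeasure (density N (p_t (s + t) x)) (space N)"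
    using assms by (simp add: p_t_mass[symmetric])
  also have "\<dots> = (\<integral>\<^sup>+y. emeasure (density N (p_t t y)) (space N) \<partial>density N (p_t s x))"
    using p_t assms unfolding is_transition_density_def submarkovian_transition_density_def by simp
  also have "\<dots> = (\<integral>\<^sup>+y. ennreal (p_t s x y) * emeasure (density N (p_t t y)) (space N) \<partial>N)"
    using meas meas' by (intro nn_integral_density) auto
  also have "\<dots> = (\<integral>\<^sup>+y. ennreal (on_E (p_t s) x y) * ennreal (mass t y) \<partial>m)"
    unfolding nn_integral_N
    by (rule nn_integral_cong) (use assms in \<open>auto simp: on_E_def indicator_def p_t_mass[symmetric]\<close>)
  finally show ?thesis .
qed

lemma mass_antimono:
  assumes "0 < s" "0 < t" "x \<in> E"
  shows "mass (s + t) x \<le> mass s x"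
proof -
  have "ennreal (mass (s + t) x) \<le> (\<integral>\<^sup>+y. ennreal (on_E (p_t s) x y) \<partial>m)"
    unfolding mass_chapman_kolmogorov[OF assms]
  proof (rule nn_integral_mono)
    fix y
    show "ennreal (on_E (p_t s) x y) * ennreal (mass t y) \<le> ennreal (on_E (p_t s) x y)"
    proof (cases "y \<in> E")
      case True
      then have "ennreal (mass t y) \<le> 1" using mass_le_1[OF assms(2)] by simp
      then show ?thesis using mult_left_mono[of "ennreal (mass t y)" 1] by simp
    qed (simp add: on_E_def)
  qed
  also have "\<dots> = ennreal (mass s x)"
    using p_t_mass[OF assms(1,3)] p_t_mass_nn[OF assms(1,3)] by simp
  finally show ?thesis using mass_nonneg assms by simp
qed

text \<open>The kernel law gives \<open>P (s + t) 1 = P s (P t 1)\<close> at every point, and the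
  density lets \<open>P s\<close> ignore the null set on which \<open>mass t\<close> differs from
  1.\<close>

lemma mass_add_eq:
  assumes "0 < s" "0 < t" "x \<in> E" "AE y in m. mass t y = 1"
  shows "mass (s + t) x = mass s x"
proof -
  have "ennreal (mass (s + t) x) = (\<integral>\<^sup>+y. ennreal (on_E (p_t s) x y) \<partial>m)"
    unfolding mass_chapman_kolmogorov[OF assms(1-3)]
    by (rule nn_integral_cong_AE) (use assms(4) in \<open>auto elim!: eventually_mono\<close>)
  also have "\<dots> = ennreal (mass s x)"
    using p_t_mass[OF assms(1,3)] p_t_mass_nn[OF assms(1,3)] by simp
  finally show ?thesis using mass_nonneg assms by simp
qed

lemma P_tendsto:
  assumes "0 < t" "x \<in> E" and f: "\<And>n. f n \<in> borel_measurable borel" "F \<in> borel_measurable borel"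
    and "\<And>n. AE y in m. \<bar>f n y\<bar> \<le> C" "AE y in m. (\<lambda>n. f n y) \<longlonglongrightarrow> F y"
  shows "(\<lambda>n. P t (f n) x) \<longlonglongrightarrow> P t F x"
  unfolding kernel_op_eq
proof (rule integral_dominated_convergence[where w = "\<lambda>y. C * on_E (p_t t) x y"])
  note k = kernel_density_on_E[OF p_kernel[OF assms(1)] assms(2)]
  show "AE y in m. (\<lambda>n. f n y * on_E (p_t t) x y) \<longlonglongrightarrow> F y * on_E (p_t t) x y"
    using assms(6) by eventually_elim (intro tendsto_intros)
  show "AE y in m. norm (f n y * on_E (p_t t) x y) \<le> C * on_E (p_t t) x y" for n
    using assms(5)[of n] by eventually_elim (simp add: abs_mult k mult_right_mono)
qed (use f kernel_density_on_E[OF p_kernel[OF assms(1)] assms(2)] p_t_integrable[OF assms(1,2)] in auto)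

lemma P_ball_indicator_tendsto:
  assumes "0 < t" "x \<in> E"
  shows "(\<lambda>n. P t (ball_indicator n) x) \<longlonglongrightarrow> mass t x"
  unfolding mass_def by (rule P_tendsto[where C = 1, OF assms])
    (auto simp: ball_indicator_bounds ball_indicator_tendsto)

lemma p_pos: "0 < p"
  using p_ge_2 by simp

lemma P_ball_indicator_AE: "0 < t \<Longrightarrow> AE x in m. P t (ball_indicator n) x = T t (ball_indicator n) x"
  by (intro P_props ball_indicator_Lp p_pos)

lemma T_ball_indicator_tendsto_mass:
  assumes "0 < t"
  shows "AE x in m. (\<lambda>n. T t (ball_indicator n) x) \<longlonglongrightarrow> mass t x"
proof -
  have "AE x in m. \<forall>n. P t (ball_indicator n) x = T t (ball_indicator n) x"
    unfolding AE_all_countable using P_ball_indicator_AE[OF assms] by blast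
  then show ?thesis
    using AE_m_E
  proof eventually_elim
    case (elim x)
    then show ?case using P_ball_indicator_tendsto[OF assms, of x] by simp
  qed
qed

text \<open>The extension of \<open>T t\<close> to \<open>L\<^sup>\<infinity>\<close> is fixed by
  increasing sequences, and along ball indicators it agrees almost everywhere with the kernel. This
  brings (H4) to the kernels.\<close>

lemma T_1_eq_mass:
  assumes "0 < t"
  shows "AE x in m. T t (\<lambda>_. 1) x = mass t x"
proof -
  have ext: "extended_to_Linfty m (T t)"
    using T_form assms by (simp add: is_semigroup_of_form_def)
  have mono_lim: "AE x in m. (\<lambda>n. T t (g n) x) \<longlonglongrightarrow> T t f x"
    if "f \<in> Linfty m" "\<And>n. g n \<in> Lp 2 m \<inter> Linfty m"
      "AE x in m. (\<forall>n. 0 \<le> g n x \<and> g n x \<le> g (Suc n) x) \<and> (\<lambda>n. g n x) \<longlonglongrightarrow> f x" for f g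
    using ext that unfolding extended_to_Linfty_def by blast
  have "(\<lambda>_. 1) \<in> Linfty m"
    by (auto simp: Linfty_def intro!: exI[of _ 1])
  moreover have "ball_indicator n \<in> Lp 2 m \<inter> Linfty m" for n
    using ball_indicator_Lp[of 2 n] ball_indicator_bounds(3)[of n]
    by (auto simp: Linfty_def intro!: exI[of _ 1] always_eventually)
  moreover have "AE x in m. (\<forall>n. 0 \<le> ball_indicator n x \<and> ball_indicator n x \<le> ball_indicator (Suc n) x)
      \<and> (\<lambda>n. ball_indicator n x) \<longlonglongrightarrow> 1"
    by (auto simp: ball_indicator_bounds ball_indicator_mono ball_indicator_tendsto intro!: always_eventually)
  ultimately have "AE x in m. (\<lambda>n. T t (ball_indicator n) x) \<longlonglongrightarrow> T t (\<lambda>_. 1) x"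
    by (rule mono_lim)
  with T_ball_indicator_tendsto_mass[OF assms] show ?thesis
    by eventually_elim (rule LIMSEQ_unique)
qed

text \<open>(H4) concerns a single time \<open>t0\<close>. The equality passes to the multiples of
  \<open>t0\<close>, and below such a multiple the mass is squeezed between 1 and 1, because it does
  not increase with time.\<close>

lemma mass_AE_1:
  assumes "0 < t"
  shows "AE x in m. mass t x = 1"
proof -
  obtain t0 where "0 < t0" "AE x in m. T t0 (\<lambda>_. 1) x = 1"
    using H4 by (auto simp: H4_def)
  with T_1_eq_mass[of t0] have t0: "AE x in m. mass t0 x = 1"
    by (auto elim: eventually_elim2)
  have mult: "AE x in m. mass (real (Suc n) * t0) x = 1" for n
  proof (induction n)
    case 0
    then show ?case using t0 by simp
  next
    case (Suc n)
    have "AE x in m. mass (t0 + real (Suc n) * t0) x = mass t0 x"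
      using AE_m_E by eventually_elim (rule mass_add_eq[OF \<open>0 < t0\<close> _ _ Suc], use \<open>0 < t0\<close> in auto)
    with t0 have "AE x in m. mass (t0 + real (Suc n) * t0) x = 1" by eventually_elim simp
    then show ?case by (simp add: algebra_simps)
  qed
  obtain n where n: "t / t0 < real n" using reals_Archimedean2 by blast
  define s where "s = real (Suc n) * t0 - t"
  have "t < real n * t0" using n \<open>0 < t0\<close> by (simp add: field_simps)
  then have "0 < s" using \<open>0 < t0\<close> by (simp add: s_def algebra_simps)
  show ?thesis
    using mult[of n] AE_m_E
  proof eventually_elim
    case (elim x)
    then show ?case
      using mass_antimono[OF assms \<open>0 < s\<close>, of x] mass_le_1[OF assms, of x] by (simp add: s_def)
  qed
qed

text \<open>Splitting \<open>s + t\<close> in either order identifies both masses with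
  \<open>mass (s + t) x\<close>. This holds at every point of \<open>E\<close>, also where the
  common value is not yet known to be 1.\<close>

lemma mass_constant:
  assumes "0 < s" "0 < t" "x \<in> E"
  shows "mass s x = mass t x"
  using mass_add_eq[OF assms mass_AE_1[OF assms(2)]]
    mass_add_eq[OF assms(2,1,3) mass_AE_1[OF assms(1)]] by (simp add: add.commute)

section \<open>Semigroup and resolvent identified through the generator\<close>

lemma G_Lp:
  assumes "0 < \<alpha>" "1 \<le> q" "h \<in> Lp q m"
  shows "G \<alpha> h \<in> Lp q m"
  using G_form assms by (auto simp: is_resolvent_of_form_def extended_to_Lp_def)

lemma T_Lp:
  assumes "0 < t" "1 \<le> q" "h \<in> Lp q m"
  shows "T t h \<in> Lp q m"
  using T_form assms by (auto simp: is_semigroup_of_form_def extended_to_Lp_def)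

lemma T_generator_iff:
  assumes "u \<in> Lp 2 m" "w' \<in> Lp 2 m"
  shows "has_generator_value m T u w' \<longleftrightarrow> u \<in> dirichlet_dom \<rho> B \<and>
    (\<forall>v\<in>dirichlet_dom \<rho> B. dirichlet_form \<rho> B u v = - L2_inner m w' v)"
  using T_form assms by (simp add: is_semigroup_of_form_def)

lemma G_generator:
  assumes "0 < \<alpha>" and h: "h \<in> Lp 2 m"
  shows "has_generator_value m T (G \<alpha> h) (\<lambda>x. \<alpha> * G \<alpha> h x - h x)"
proof -
  have G2: "G \<alpha> h \<in> Lp 2 m" using assms by (intro G_Lp) auto
  have "dirichlet_form \<rho> B (G \<alpha> h) v = - L2_inner m (\<lambda>x. \<alpha> * G \<alpha> h x - h x) v"
    if v: "v \<in> dirichlet_dom \<rho> B" for v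
  proof -
    have "v \<in> Lp 2 m" using v by (simp add: dirichlet_dom_def closure_dom_def)
    then have "L2_inner m (\<lambda>x. \<alpha> * G \<alpha> h x - h x) v = \<alpha> * L2_inner m (G \<alpha> h) v - L2_inner m h v"
      using L2_inner_lincomb[OF G2 h, of v \<alpha> "-1"] by simp
    moreover have "dirichlet_form \<rho> B (G \<alpha> h) v + \<alpha> * L2_inner m (G \<alpha> h) v = L2_inner m h v"
      using G_form assms v by (simp add: is_resolvent_of_form_def)
    ultimately show ?thesis by simp
  qed
  moreover have "G \<alpha> h \<in> dirichlet_dom \<rho> B"
    using G_form assms by (simp add: is_resolvent_of_form_def)
  ultimately show ?thesis
    using T_generator_iff[OF G2 Lp_2_diff[OF Lp_2_cmult[OF G2] h]] by blast
qed

text \<open>On test functions the closed form is given by \<open>L\<close>, so \<open>L f\<close> is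
  the generator value of \<open>f\<close>. Then \<open>f\<close> and \<open>G 1 (f - L f)\<close>
  solve the same resolvent equation.\<close>

lemma test_function_eq_G:
  assumes f: "f \<in> test_functions"
  shows "AE x in m. f x = G 1 (\<lambda>x. f x - L f x) x"
proof (rule resolvent_equation_unique)
  have f2: "f \<in> Lp 2 m" using test_functions_Lp[OF f] by simp
  have "has_generator_value m T f (L f)"
    using T_generator_iff[OF f2 L_Lp_2[OF f]] test_function_dirichlet_dom[OF f]
      test_function_dirichlet_form[OF f] by blast
  then show "has_generator_value m T f (\<lambda>x. 1 * f x - (f x - L f x))" by simp
  show "has_generator_value m T (G 1 (\<lambda>x. f x - L f x))
      (\<lambda>x. 1 * G 1 (\<lambda>x. f x - L f x) x - (f x - L f x))"
    by (rule G_generator) (use f2 L_Lp_2[OF f] Lp_2_diff in auto)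
qed simp

text \<open>Positivity of \<open>T t\<close> is read off from the nonnegative kernel, which
  represents it on \<open>L\<^sup>p\<close>; hence the membership required of
  \<open>h\<close>.\<close>

lemma orbit_nonneg:
  assumes h: "h \<in> Lp p m" "AE x in m. 0 \<le> h x" and "0 \<le> t"
  shows "AE x in m. 0 \<le> orbit T t h x"
proof (cases "t = 0")
  case False
  with \<open>0 \<le> t\<close> have t: "0 < t" by simp
  from P_props(3)[OF h(1) t] AE_m_E show ?thesis
  proof eventually_elim
    case (elim x)
    then show ?case using kernel_op_nonneg[OF p_kernel[OF t] elim(2) h(2)] t by simp
  qed
qed (use h in simp)

lemma T_bounded:
  assumes h: "h \<in> Lp p m" "AE x in m. \<bar>h x\<bar> \<le> C" and t: "0 < t"
  shows "AE x in m. \<bar>T t h x\<bar> \<le> C"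
  using P_props(3)[OF h(1) t] AE_m_E
proof eventually_elim
  case (elim x)
  note k = kernel_density_on_E[OF p_kernel[OF t] elim(2)]
  have "\<bar>P t h x\<bar> \<le> (\<integral>y. \<bar>h y * on_E (p_t t) x y\<bar> \<partial>m)"
    unfolding kernel_op_eq by (rule integral_abs_bound)
  also have "\<dots> \<le> (\<integral>y. \<bar>C\<bar> * on_E (p_t t) x y \<partial>m)"
  proof (rule integral_mono_AE)
    show "AE y in m. \<bar>h y * on_E (p_t t) x y\<bar> \<le> \<bar>C\<bar> * on_E (p_t t) x y"
      using h(2) by eventually_elim (auto simp: abs_mult k intro!: mult_right_mono)
  qed (use P_props(1)[OF h(1) t elim(2)] p_t_integrable[OF t elim(2)] in auto)
  also have "\<dots> = \<bar>C\<bar> * mass t x" by (simp add: mass_eq)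
  also have "\<dots> \<le> \<bar>C\<bar>"
    using mass_le_1[OF t elim(2)] by (simp add: mult_left_le)
  finally have "\<bar>T t h x\<bar> \<le> \<bar>C\<bar>" using elim(1) by simp
  \<comment> \<open>A negative \<open>C\<close> would make almost every point contradictory, but
    \<open>E\<close> contains \<open>x\<close> and is thus a nonempty open set.\<close>
  moreover have "0 \<le> C"
  proof (rule ccontr)
    assume "\<not> 0 \<le> C"
    then have "AE y in m. (1::real) \<le> 0" using h(2) by (auto elim!: eventually_mono)
    then show False
      using le_on_E_if_AE_le[of "\<lambda>_. 1" "\<lambda>_. 0" x] elim(2) by simp
  qed
  ultimately show ?case by simp
qed

section \<open>Pointwise limits for small times\<close>

lemma R_excessive:
  assumes h: "h \<in> Lp 2 m" "h \<in> Lp p m" "AE x in m. 0 \<le> h x" and "0 < \<alpha>" "0 < t" "x \<in> E"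
  shows "exp (- \<alpha> * t) * P t (G \<alpha> h) x \<le> R \<alpha> h x"
proof (rule le_on_E_if_AE_le[OF _ _ _ \<open>x \<in> E\<close>])
  have Gp: "G \<alpha> h \<in> Lp p m" using h p_ge_2 \<open>0 < \<alpha>\<close> by (intro G_Lp) auto
  show "continuous_on E (\<lambda>x. exp (- \<alpha> * t) * P t (G \<alpha> h) x)"
    using P_props(2)[OF Gp \<open>0 < t\<close>] by (intro continuous_intros)
  show "continuous_on E (R \<alpha> h)" by (rule R_props(2)[OF h(2) \<open>0 < \<alpha>\<close>])
  have "AE x in m. exp (- \<alpha> * t) * T t (G \<alpha> h) x \<le> G \<alpha> h x"
    using h assms by (intro resolvent_excessive[OF G_generator] orbit_nonneg)
  with P_props(3)[OF Gp \<open>0 < t\<close>] R_props(3)[OF h(2) \<open>0 < \<alpha>\<close>]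
  show "AE x in m. exp (- \<alpha> * t) * P t (G \<alpha> h) x \<le> R \<alpha> h x"
    by eventually_elim simp
qed

text \<open>\<open>T t\<close> commutes with the generator, so
  \<open>G \<alpha> h - e T t (G \<alpha> h)\<close> solves the resolvent equation with right side
  \<open>h - e T t h\<close>, where \<open>e\<close> is the discount factor. Uniqueness gives the
  identity almost everywhere, and continuity on \<open>E\<close> gives it at
  \<open>x\<close>.\<close>

lemma R_minus_P:
  assumes h: "h \<in> Lp 2 m" "h \<in> Lp p m" and "0 < \<alpha>" "0 < t" "x \<in> E"
  shows "R \<alpha> h x - exp (- \<alpha> * t) * P t (G \<alpha> h) x = R \<alpha> (\<lambda>y. h y - exp (- \<alpha> * t) * T t h y) x"
proof (rule eq_on_E_if_AE_eq[OF _ _ _ \<open>x \<in> E\<close>])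
  define e where "e = exp (- \<alpha> * t)"
  define h' where "h' y = h y - e * T t h y" for y
  have h': "h' \<in> Lp 2 m" "h' \<in> Lp p m"
    unfolding h'_def[abs_def] using h assms p_ge_2
    by (auto intro!: Lp_2_diff Lp_2_cmult Lp_diff Lp_cmult T_Lp)
  have G2: "G \<alpha> h \<in> Lp 2 m" and Gp: "G \<alpha> h \<in> Lp p m"
    using h p_ge_2 \<open>0 < \<alpha>\<close> by (auto intro: G_Lp)
  show "continuous_on E (\<lambda>x. R \<alpha> h x - exp (- \<alpha> * t) * P t (G \<alpha> h) x)"
    using P_props(2)[OF Gp \<open>0 < t\<close>] R_props(2)[OF h(2) \<open>0 < \<alpha>\<close>] by (intro continuous_intros)
  show "continuous_on E (R \<alpha> (\<lambda>y. h y - exp (- \<alpha> * t) * T t h y))"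
    using R_props(2)[OF h'(2) \<open>0 < \<alpha>\<close>] by (simp add: h'_def[abs_def] e_def)
  define y where "y x = 1 * G \<alpha> h x + (- e) * T t (G \<alpha> h) x" for x
  note gen = G_generator[OF \<open>0 < \<alpha>\<close> h(1)]
  have y2: "y \<in> Lp 2 m"
    unfolding y_def[abs_def] using G2 \<open>0 < t\<close> by (intro Lp_2_lincomb T_Lp) auto
  have "has_generator_value m T y (\<lambda>x. \<alpha> * y x - h' x)"
  proof (rule generator_value_cong_AE)
    show "has_generator_value m T y (\<lambda>x. 1 * (\<alpha> * G \<alpha> h x - h x) + (- e) * T t (\<lambda>x. \<alpha> * G \<alpha> h x - h x) x)"
      unfolding y_def[abs_def]
      by (intro generator_value_lincomb gen generator_value_orbit \<open>0 < t\<close>)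
    show "(\<lambda>x. \<alpha> * y x - h' x) \<in> Lp 2 m"
      using y2 h' by (intro Lp_2_diff Lp_2_cmult)
    have "AE x in m. T t (\<lambda>x. \<alpha> * G \<alpha> h x - h x) x = \<alpha> * T t (G \<alpha> h) x - T t h x"
      using orbit_lincomb[of t "G \<alpha> h" h \<alpha> "-1"] \<open>0 < t\<close> G2 h by simp
    then show "AE x in m. 1 * (\<alpha> * G \<alpha> h x - h x) + (- e) * T t (\<lambda>x. \<alpha> * G \<alpha> h x - h x) x = \<alpha> * y x - h' x"
    proof eventually_elim
      case (elim x)
      show ?case unfolding elim y_def h'_def by (simp add: algebra_simps)
    qed
  qed
  then have "AE x in m. y x = G \<alpha> h' x"
    using G_generator[OF \<open>0 < \<alpha>\<close> h'(1)] \<open>0 < \<alpha>\<close> by (rule resolvent_equation_unique)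
  with P_props(3)[OF Gp \<open>0 < t\<close>] R_props(3)[OF h(2) \<open>0 < \<alpha>\<close>] R_props(3)[OF h'(2) \<open>0 < \<alpha>\<close>]
  have "AE x in m. R \<alpha> h x - e * P t (G \<alpha> h) x = R \<alpha> h' x"
    by eventually_elim (simp add: y_def)
  then show "AE x in m. R \<alpha> h x - exp (- \<alpha> * t) * P t (G \<alpha> h) x = R \<alpha> (\<lambda>y. h y - exp (- \<alpha> * t) * T t h y) x"
    by (simp add: e_def h'_def[abs_def])
qed

text \<open>By \<open>R_minus_P\<close> the error is \<open>R \<alpha> (\<delta> t) x\<close>, up to
  the discount. The \<open>\<delta> t\<close> are bounded by \<open>2 * C\<close> and tend to 0 in
  \<open>L\<^sup>2\<close>, hence in \<open>L\<^sup>p\<close>, where evaluation of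
  \<open>R \<alpha>\<close> at \<open>x\<close> is a continuous functional.\<close>

lemma P_G_tendsto_bounded:
  assumes h: "h \<in> Lp 2 m" and C: "AE x in m. \<bar>h x\<bar> \<le> C" and "0 < \<alpha>" "x \<in> E"
  shows "((\<lambda>t. P t (G \<alpha> h) x) \<longlongrightarrow> R \<alpha> h x) (at_right 0)"
proof -
  note hp = Lp_if_bounded_Lp_2(1)[OF h C p_ge_2]
  define \<delta> where "\<delta> t y = h y - exp (- \<alpha> * t) * T t h y" for t y
  have \<delta>: "\<delta> t \<in> Lp 2 m" "\<delta> t \<in> Lp p m" if "0 < t" for t
    unfolding \<delta>_def[abs_def] using h hp that p_ge_2
    by (auto intro!: Lp_2_diff Lp_2_cmult Lp_diff Lp_cmult T_Lp)
  have \<delta>_bound: "AE y in m. \<bar>\<delta> t y\<bar> \<le> 2 * C" if "0 < t" for t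
    using C T_bounded[OF hp C that]
  proof eventually_elim
    case (elim y)
    have "exp (- \<alpha> * t) \<le> 1" using \<open>0 < \<alpha>\<close> that by simp
    then have "exp (- \<alpha> * t) * \<bar>T t h y\<bar> \<le> 1 * C"
      using elim by (intro mult_mono) auto
    then have "\<bar>exp (- \<alpha> * t) * T t h y\<bar> \<le> C" by (simp add: abs_mult)
    with elim show ?case unfolding \<delta>_def by linarith
  qed
  have norm0: "((\<lambda>t. Lp_norm 2 m (\<delta> t)) \<longlongrightarrow> 0) (at_right 0)"
  proof (rule Lim_null_comparison)
    have "norm (Lp_norm 2 m (\<delta> t)) \<le> Lp_norm 2 m (\<lambda>x. orbit T t h x - h x) + (1 - exp (- \<alpha> * t)) * Lp_norm 2 m h"
      if "0 < t" for t
    proof -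
      let ?e = "exp (- \<alpha> * t)"
      have Th: "T t h \<in> Lp 2 m" using h that by (intro T_Lp) auto
      have e1: "?e \<le> 1" using \<open>0 < \<alpha>\<close> that by simp
      have "\<delta> t = (\<lambda>x. (-1) * (T t h x - h x) + (1 - ?e) * T t h x)"
        by (simp add: \<delta>_def fun_eq_iff algebra_simps)
      then have "Lp_norm 2 m (\<delta> t) \<le> Lp_norm 2 m (\<lambda>x. (-1) * (T t h x - h x)) + Lp_norm 2 m (\<lambda>x. (1 - ?e) * T t h x)"
        using Lp_norm_2_triangle[of "\<lambda>x. (-1) * (T t h x - h x)" m "\<lambda>x. (1 - ?e) * T t h x"] h Th
        by (simp add: Lp_2_cmult Lp_2_diff del: mult_minus1)
      also have "\<dots> = Lp_norm 2 m (\<lambda>x. T t h x - h x) + (1 - ?e) * Lp_norm 2 m (T t h)"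
        unfolding Lp_norm_2_cmult using e1 by simp
      also have "\<dots> \<le> Lp_norm 2 m (\<lambda>x. T t h x - h x) + (1 - ?e) * Lp_norm 2 m h"
        using orbit_norm_le[of t h] that h e1 by (intro add_left_mono mult_left_mono) auto
      finally show ?thesis using that by (simp add: Lp_norm_2_nonneg)
    qed
    then show "\<forall>\<^sub>F t in at_right 0. norm (Lp_norm 2 m (\<delta> t))
        \<le> Lp_norm 2 m (\<lambda>x. orbit T t h x - h x) + (1 - exp (- \<alpha> * t)) * Lp_norm 2 m h"
      by (auto simp: eventually_at_filter)
    have "((\<lambda>t. Lp_norm 2 m (\<lambda>x. orbit T t h x - h x) + (1 - exp (- \<alpha> * t)) * Lp_norm 2 m h)
        \<longlongrightarrow> 0 + (1 - 1) * Lp_norm 2 m h) (at_right 0)"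
      by (intro tendsto_intros orbit_strongly_continuous h exp_at_right_0)
    then show "((\<lambda>t. Lp_norm 2 m (\<lambda>x. orbit T t h x - h x) + (1 - exp (- \<alpha> * t)) * Lp_norm 2 m h)
        \<longlongrightarrow> 0) (at_right 0)" by simp
  qed
  have "((\<lambda>t. R \<alpha> (\<delta> t) x) \<longlongrightarrow> 0) (at_right 0)"
  proof (rule tendstoI)
    fix e :: real assume "0 < e"
    obtain \<eta> where "0 < \<eta>" and \<eta>: "\<And>g. g \<in> Lp p m \<Longrightarrow> (\<integral>y. \<bar>g y\<bar> powr p \<partial>m) < \<eta> \<Longrightarrow>
        \<bar>\<integral>y. g y * on_E (r_l \<alpha>) x y \<partial>m\<bar> < e"
      using positive_functional_continuous_Lp[of p "on_E (r_l \<alpha>) x" m e] p_pos \<open>0 < e\<close>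
        kernel_density_on_E[OF r_kernel[OF \<open>0 < \<alpha>\<close>] \<open>x \<in> E\<close>] R_props(1)[OF _ \<open>0 < \<alpha>\<close> \<open>x \<in> E\<close>]
      by auto
    have "((\<lambda>t. (2 * C) powr (p - 2) * (Lp_norm 2 m (\<delta> t))\<^sup>2) \<longlongrightarrow> (2 * C) powr (p - 2) * 0\<^sup>2) (at_right 0)"
      by (intro tendsto_intros norm0)
    then have "\<forall>\<^sub>F t in at_right 0. (2 * C) powr (p - 2) * (Lp_norm 2 m (\<delta> t))\<^sup>2 < \<eta>"
      using \<open>0 < \<eta>\<close> by (intro order_tendstoD) auto
    moreover have "\<forall>\<^sub>F t::real in at_right 0. 0 < t"
      by (auto simp: eventually_at_filter)
    ultimately show "\<forall>\<^sub>F t in at_right 0. dist (R \<alpha> (\<delta> t) x) 0 < e"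
    proof eventually_elim
      case (elim t)
      have "\<bar>\<integral>y. \<delta> t y * on_E (r_l \<alpha>) x y \<partial>m\<bar> < e"
        using Lp_if_bounded_Lp_2(2)[OF \<delta>(1) \<delta>_bound p_ge_2] elim
        by (intro \<eta> \<delta>) (auto intro: le_less_trans)
      then show ?case by (simp add: kernel_op_eq)
    qed
  qed
  \<comment> \<open>This is \<open>R_minus_P\<close> solved for \<open>P t (G \<alpha> h) x\<close>;
    the factor removes the discount and tends to 1.\<close>
  then have "((\<lambda>t. exp (\<alpha> * t) * (R \<alpha> h x - R \<alpha> (\<delta> t) x)) \<longlongrightarrow> 1 * (R \<alpha> h x - 0)) (at_right 0)"
    by (intro tendsto_intros exp_at_right_0)
  then have lim: "((\<lambda>t. exp (\<alpha> * t) * (R \<alpha> h x - R \<alpha> (\<delta> t) x)) \<longlongrightarrow> R \<alpha> h x) (at_right 0)"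
    by simp
  show ?thesis
  proof (rule Lim_transform_eventually[OF lim])
    have "exp (\<alpha> * t) * (R \<alpha> h x - R \<alpha> (\<delta> t) x) = P t (G \<alpha> h) x" if "0 < t" for t
      using R_minus_P[OF h hp \<open>0 < \<alpha>\<close> that \<open>x \<in> E\<close>] by (simp add: \<delta>_def[abs_def] exp_minus field_simps)
    then show "\<forall>\<^sub>F t in at_right 0. exp (\<alpha> * t) * (R \<alpha> h x - R \<alpha> (\<delta> t) x) = P t (G \<alpha> h) x"
      by (auto simp: eventually_at_filter)
  qed
qed

lemma P_diff_le:
  assumes "f \<in> Lp p m" "g \<in> Lp p m" "d \<in> Lp p m" "AE y in m. \<bar>f y - g y\<bar> \<le> d y" "0 < t" "x \<in> E"
  shows "\<bar>P t f x - P t g x\<bar> \<le> P t d x"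
proof -
  note k = kernel_density_on_E[OF p_kernel[OF \<open>0 < t\<close>] \<open>x \<in> E\<close>]
  note i = P_props(1)[OF _ \<open>0 < t\<close> \<open>x \<in> E\<close>]
  have "P t f x - P t g x = (\<integral>y. (f y - g y) * on_E (p_t t) x y \<partial>m)"
    using i[OF assms(1)] i[OF assms(2)] by (simp add: kernel_op_eq left_diff_distrib)
  also have "\<bar>\<dots>\<bar> \<le> (\<integral>y. \<bar>(f y - g y) * on_E (p_t t) x y\<bar> \<partial>m)"
    by (rule integral_abs_bound)
  also have "\<dots> \<le> P t d x"
    unfolding kernel_op_eq
  proof (rule integral_mono_AE)
    show "AE y in m. \<bar>(f y - g y) * on_E (p_t t) x y\<bar> \<le> d y * on_E (p_t t) x y"
      using assms(4) by eventually_elim (simp add: abs_mult k mult_right_mono)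
  qed (use i[OF assms(1)] i[OF assms(2)] i[OF assms(3)] in \<open>auto simp: left_diff_distrib\<close>)
  finally show ?thesis .
qed

lemma R_diff_le:
  assumes "f \<in> Lp p m" "g \<in> Lp p m" "0 < \<alpha>" "x \<in> E"
  shows "\<bar>R \<alpha> f x - R \<alpha> g x\<bar> \<le> R \<alpha> (\<lambda>y. \<bar>f y - g y\<bar>) x"
proof -
  note k = kernel_density_on_E[OF r_kernel[OF \<open>0 < \<alpha>\<close>] \<open>x \<in> E\<close>]
  note i = R_props(1)[OF _ \<open>0 < \<alpha>\<close> \<open>x \<in> E\<close>]
  have "R \<alpha> f x - R \<alpha> g x = (\<integral>y. (f y - g y) * on_E (r_l \<alpha>) x y \<partial>m)"
    using i[OF assms(1)] i[OF assms(2)] by (simp add: kernel_op_eq left_diff_distrib)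
  also have "\<bar>\<dots>\<bar> \<le> (\<integral>y. \<bar>(f y - g y) * on_E (r_l \<alpha>) x y\<bar> \<partial>m)"
    by (rule integral_abs_bound)
  also have "\<dots> = R \<alpha> (\<lambda>y. \<bar>f y - g y\<bar>) x"
    by (simp add: kernel_op_eq abs_mult k)
  finally show ?thesis .
qed

text \<open>Cutting \<open>h\<close> at height \<open>n\<close> leaves \<open>d n\<close>, dominated
  by the absolute value of \<open>h\<close>, so \<open>R \<alpha> (d n) x\<close> tends to 0.
  Excessiveness bounds \<open>P t (G \<alpha> (d n)) x\<close> by \<open>exp (\<alpha> * t)\<close>
  times that quantity, which makes the cut harmless uniformly in small \<open>t\<close>.\<close>

lemma P_G_tendsto:
  assumes h: "h \<in> Lp 2 m" "h \<in> Lp p m" and "0 < \<alpha>" "x \<in> E"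
  shows "((\<lambda>t. P t (G \<alpha> h) x) \<longlongrightarrow> R \<alpha> h x) (at_right 0)"
proof -
  have hm: "h \<in> borel_measurable borel" using Lp_measurable[OF h(1)] by simp
  define c where "c n y = (if \<bar>h y\<bar> \<le> real n then h y else 0)" for n y
  define d where "d n y = \<bar>h y - c n y\<bar>" for n y
  have cm: "c n \<in> borel_measurable borel" "d n \<in> borel_measurable borel" for n
    unfolding d_def[abs_def] c_def[abs_def] using hm by measurable
  have cL: "c n \<in> Lp 2 m" "c n \<in> Lp p m" for n
    using Lp_2_bound[OF h(1), of "c n"] Lp_bound[OF h(2), of "c n"] cm p_pos by (auto simp: c_def)
  have dL: "d n \<in> Lp 2 m" "d n \<in> Lp p m" for n
    using Lp_2_bound[OF h(1), of "d n"] Lp_bound[OF h(2), of "d n"] cm p_pos by (auto simp: d_def c_def)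
  note k = kernel_density_on_E[OF r_kernel[OF \<open>0 < \<alpha>\<close>] \<open>x \<in> E\<close>]
  have "(\<lambda>n. R \<alpha> (d n) x) \<longlonglongrightarrow> R \<alpha> (\<lambda>_. 0) x"
    unfolding kernel_op_eq
  proof (rule integral_dominated_convergence[where w = "\<lambda>y. \<bar>h y\<bar> * on_E (r_l \<alpha>) x y"])
    show "integrable m (\<lambda>y. \<bar>h y\<bar> * on_E (r_l \<alpha>) x y)"
      using R_props(1)[OF Lp_abs[OF h(2)] \<open>0 < \<alpha>\<close> \<open>x \<in> E\<close>] .
    have "(\<lambda>n. d n y) \<longlonglongrightarrow> 0" for y
    proof (rule tendsto_eventually)
      obtain n0 where "\<bar>h y\<bar> < real n0" using reals_Archimedean2 by blast
      then show "\<forall>\<^sub>F n in sequentially. d n y = 0"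
        by (auto simp: eventually_sequentially d_def c_def intro!: exI[of _ n0])
    qed
    then show "AE y in m. (\<lambda>n. d n y * on_E (r_l \<alpha>) x y) \<longlonglongrightarrow> 0 * on_E (r_l \<alpha>) x y"
      by (intro always_eventually allI tendsto_intros)
    show "AE y in m. norm (d n y * on_E (r_l \<alpha>) x y) \<le> \<bar>h y\<bar> * on_E (r_l \<alpha>) x y" for n
      by (intro always_eventually allI) (auto simp: abs_mult k d_def c_def intro!: mult_right_mono)
  qed (use cm k in auto)
  then have Rd: "(\<lambda>n. R \<alpha> (d n) x) \<longlonglongrightarrow> 0" by (simp add: kernel_op_eq)
  show ?thesis
  proof (rule tendstoI)
    fix e :: real assume "0 < e"
    \<comment> \<open>The factor \<open>exp (\<alpha> * t) < 2\<close> doubles this error on the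
      side of \<open>P t\<close>; \<open>e / 2 + e / 4 + e / 4\<close> is the whole budget.\<close>
    then have "\<forall>\<^sub>F n in sequentially. R \<alpha> (d n) x < e / 4"
      using Rd by (intro order_tendstoD) auto
    then obtain n where n: "R \<alpha> (d n) x < e / 4"
      by (auto simp: eventually_sequentially)
    have "((\<lambda>t. P t (G \<alpha> (c n)) x) \<longlongrightarrow> R \<alpha> (c n) x) (at_right 0)"
      by (rule P_G_tendsto_bounded[where C = "real n"]) (use cL assms in \<open>auto simp: c_def\<close>)
    then have "\<forall>\<^sub>F t in at_right 0. dist (P t (G \<alpha> (c n)) x) (R \<alpha> (c n) x) < e / 4"
      using \<open>0 < e\<close> by (intro tendstoD) auto
    moreover have "\<forall>\<^sub>F t in at_right 0. exp (\<alpha> * t) < 2"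
      using exp_at_right_0[of \<alpha>] by (intro order_tendstoD) auto
    moreover have "\<forall>\<^sub>F t::real in at_right 0. 0 < t"
      by (auto simp: eventually_at_filter)
    ultimately show "\<forall>\<^sub>F t in at_right 0. dist (P t (G \<alpha> h) x) (R \<alpha> h x) < e"
    proof eventually_elim
      case (elim t)
      have G: "G \<alpha> f \<in> Lp p m" if "f \<in> Lp p m" for f
        using that p_ge_2 \<open>0 < \<alpha>\<close> by (intro G_Lp) auto
      have "AE y in m. \<bar>G \<alpha> h y - G \<alpha> (c n) y\<bar> \<le> G \<alpha> (d n) y"
        using R_props(3)[OF h(2) \<open>0 < \<alpha>\<close>] R_props(3)[OF cL(2) \<open>0 < \<alpha>\<close>, of n]
          R_props(3)[OF dL(2) \<open>0 < \<alpha>\<close>, of n] AE_m_E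
      proof eventually_elim
        case (elim y)
        then show ?case using R_diff_le[OF h(2) cL(2) \<open>0 < \<alpha>\<close> elim(4), of n] by (simp add: d_def[abs_def])
      qed
      then have "\<bar>P t (G \<alpha> h) x - P t (G \<alpha> (c n)) x\<bar> \<le> P t (G \<alpha> (d n)) x"
        using G h cL dL elim \<open>x \<in> E\<close> by (intro P_diff_le) auto
      also have "\<dots> \<le> exp (\<alpha> * t) * R \<alpha> (d n) x"
        using R_excessive[OF dL _ \<open>0 < \<alpha>\<close> elim(3) \<open>x \<in> E\<close>, of n]
        by (simp add: d_def exp_minus field_simps)
      also have "\<dots> \<le> 2 * R \<alpha> (d n) x"
        using elim kernel_op_nonneg[OF r_kernel[OF \<open>0 < \<alpha>\<close>] \<open>x \<in> E\<close>, of "d n"]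
        by (intro mult_right_mono) (auto simp: d_def)
      finally have "\<bar>P t (G \<alpha> h) x - P t (G \<alpha> (c n)) x\<bar> < e / 2" using n by linarith
      moreover have "\<bar>R \<alpha> h x - R \<alpha> (c n) x\<bar> < e / 4"
        using R_diff_le[OF h(2) cL(2) \<open>0 < \<alpha>\<close> \<open>x \<in> E\<close>, of n] n by (simp add: d_def[abs_def])
      ultimately show ?case using elim unfolding dist_real_def by linarith
    qed
  qed
qed

lemma P_test_function_tendsto:
  assumes f: "f \<in> test_functions" and "x \<in> E"
  shows "((\<lambda>t. P t f x) \<longlongrightarrow> f x) (at_right 0)"
proof -
  define h where "h y = f y - L f y" for y
  have fm: "f \<in> borel_measurable borel" by (rule test_functions_measurable[OF f])
  have h: "h \<in> Lp 2 m" "h \<in> Lp p m"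
    unfolding h_def[abs_def] using test_functions_Lp[OF f] L_Lp[OF f] L_Lp_2[OF f] p_pos
    by (auto intro!: Lp_diff)
  have fG: "AE y in m. f y = G 1 h y"
    using test_function_eq_G[OF f] by (simp add: h_def[abs_def])
  have "f x = R 1 h x"
  proof (rule eq_on_E_if_AE_eq[OF _ _ _ \<open>x \<in> E\<close>])
    show "continuous_on E f" using test_functions_continuous[OF f] continuous_on_subset by blast
    show "continuous_on E (R 1 h)" by (rule R_props(2)[OF h(2)]) simp
    show "AE y in m. f y = R 1 h y"
      using fG R_props(3)[OF h(2), of 1] by (auto elim: eventually_elim2)
  qed
  moreover have "((\<lambda>t. P t (G 1 h) x) \<longlongrightarrow> R 1 h x) (at_right 0)"
    by (rule P_G_tendsto[OF h]) (use \<open>x \<in> E\<close> in auto)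
  \<comment> \<open>Outside the kernel continuity has replaced \<open>G 1 h\<close> by
    \<open>R 1 h\<close>; inside it, equality almost everywhere is enough.\<close>
  moreover have "P t (G 1 h) x = P t f x" if "0 < t" for t
  proof (rule kernel_op_cong_AE[OF p_kernel[OF that] \<open>x \<in> E\<close>])
    show "G 1 h \<in> borel_measurable borel"
      using Lp_measurable[OF G_Lp[OF _ _ h(1), of 1]] by simp
    show "AE y in m. G 1 h y = f y" using fG by eventually_elim simp
  qed (rule fm)
  then have "\<forall>\<^sub>F t in at_right 0. P t (G 1 h) x = P t f x"
    by (auto simp: eventually_at_filter)
  ultimately have "((\<lambda>t. P t (G 1 h) x) \<longlongrightarrow> f x) (at_right 0)"
      "\<forall>\<^sub>F t in at_right 0. P t (G 1 h) x = P t f x"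
    by simp_all
  then show ?thesis by (rule Lim_transform_eventually)
qed

text \<open>Otherwise the domain of the generator would be trivial, but it contains \<open>G 1 h\<close> for all \<open>h\<close>
  and determines \<open>h\<close>.\<close>
lemma nonzero_test_function:
  obtains f and x :: 'a where "f \<in> test_functions" "f x \<noteq> 0"
proof (rule ccontr)
  assume "\<not> thesis"
  then have zero: "f x = 0" if "f \<in> test_functions" for f and x :: 'a
    using that \<open>\<And>x f. f \<in> test_functions \<Longrightarrow> f x \<noteq> 0 \<Longrightarrow> thesis\<close> by blast
  define h where "h = ball_indicator 1"
  have h: "h \<in> Lp 2 m" by (simp add: h_def ball_indicator_Lp)
  define u where "u = G 1 h"
  have u2: "u \<in> Lp 2 m" unfolding u_def using h by (intro G_Lp) auto
  have "u \<in> dirichlet_dom \<rho> B"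
    using G_form h by (simp add: u_def is_resolvent_of_form_def)
  then obtain f where f: "\<And>n. f n \<in> test_functions" "(\<lambda>n. Lp_norm 2 m (\<lambda>x. f n x - u x)) \<longlonglongrightarrow> 0"
    by (auto simp: dirichlet_dom_def closure_dom_def form_approx_def)
  then have "Lp_norm 2 m (\<lambda>x. - u x) = 0"
    by (simp add: zero LIMSEQ_const_iff)
  then have u0: "AE x in m. u x = 0"
    using Lp_norm_2_eq_0_iff[OF u2] by (simp add: Lp_norm_2_eq)
  have gen: "has_generator_value m T u (\<lambda>x. 1 * u x - h x)"
    unfolding u_def by (rule G_generator) (use h in auto)
  \<comment> \<open>As \<open>u\<close> and \<open>T t u\<close> vanish almost everywhere, only
    \<open>h\<close> is left in the error of the difference quotient. That error must tend to 0,
    which would make the unit ball null.\<close>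
  have "Lp_norm 2 m (\<lambda>x. (T t u x - u x) / t - (1 * u x - h x)) = Lp_norm 2 m h" if "0 < t" for t
  proof (rule Lp_norm_2_cong_AE)
    have Tu: "T t u \<in> Lp 2 m" using orbit_Lp[of t u] that u2 by simp
    have "Lp_norm 2 m (T t u) = 0"
      using orbit_norm_le[of t u] that u2 u0 Lp_norm_2_eq_0_iff[OF u2] Lp_norm_2_nonneg[of m "T t u"] by simp
    then have "AE x in m. T t u x = 0" using Lp_norm_2_eq_0_iff[OF Tu] by simp
    with u0 show "AE x in m. (T t u x - u x) / t - (1 * u x - h x) = h x"
      by eventually_elim simp
    show "(\<lambda>x. (T t u x - u x) / t - (1 * u x - h x)) \<in> borel_measurable m"
      using Tu u2 h by (intro Lp_2_measurable[OF Lp_2_diff] Lp_2_divide Lp_2_diff Lp_2_cmult)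
  qed (use h Lp_2_measurable in blast)
  then have "\<forall>\<^sub>F t in at_right 0.
      Lp_norm 2 m (\<lambda>x. (T t u x - u x) / t - (1 * u x - h x)) = Lp_norm 2 m h"
    by (auto simp: eventually_at_filter)
  moreover have "((\<lambda>t. Lp_norm 2 m (\<lambda>x. (T t u x - u x) / t - (1 * u x - h x))) \<longlongrightarrow> 0) (at_right 0)"
    using gen unfolding has_generator_value_def by blast
  ultimately have "((\<lambda>t::real. Lp_norm 2 m h) \<longlongrightarrow> 0) (at_right 0)"
    by (rule Lim_transform_eventually[rotated])
  then have "Lp_norm 2 m h = 0"
    by (simp add: tendsto_const_iff)
  then have "AE x in m. h x = 0"
    using Lp_norm_2_eq_0_iff[OF h] by simp
  then have "AE x in lborel. x \<notin> ball (0::'a) 1"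
    unfolding AE_m_iff by eventually_elim (auto simp: h_def ball_indicator_def)
  then have "ball (0::'a) 1 \<in> null_sets lborel"
    using AE_iff_null_sets[of "ball (0::'a) 1" lborel] by simp
  then have "negligible (ball (0::'a) 1)"
    by (simp add: negligible_iff_null_sets null_sets_completionI)
  then show False
    using open_not_negligible[of "ball (0::'a) 1"] by simp
qed

theorem mass_eq_1:
  assumes "0 < t" "x \<in> E"
  shows "mass t x = 1"
proof (rule antisym[OF mass_le_1[OF assms]])
  obtain g :: "'a \<Rightarrow> real" and z where g: "g \<in> test_functions" "g z \<noteq> 0"
    by (rule nonzero_test_function)
  \<comment> \<open>The translation moves the point where \<open>g\<close> is nonzero to
    \<open>x\<close>, so \<open>f x = g z\<close>.\<close>
  define f where "f y = g (y + (z - x))" for y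
  have f: "f \<in> test_functions" "f x \<noteq> 0"
    using g test_functions_shift[OF g(1)] by (auto simp: f_def[abs_def])
  note ff = test_functions_mult[OF f(1) f(1)]
  define a where "a = f x"
  have "0 \<le> P s (\<lambda>y. f y * f y) x - 2 * a * P s f x + a\<^sup>2 * mass t x" if s: "0 < s" for s
  proof -
    let ?k = "on_E (p_t s) x"
    have i: "integrable m (\<lambda>y. (f y * f y) * ?k y)" "integrable m (\<lambda>y. f y * ?k y)" "integrable m ?k"
      using P_props(1)[OF test_functions_Lp[OF ff p_pos] s assms(2)]
        P_props(1)[OF test_functions_Lp[OF f(1) p_pos] s assms(2)] p_t_integrable[OF s assms(2)] by auto
    have "0 \<le> P s (\<lambda>y. (f y - a)\<^sup>2) x"
      by (rule kernel_op_nonneg[OF p_kernel[OF s] assms(2)]) simp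
    also have "\<dots> = (\<integral>y. (f y * f y) * ?k y - 2 * a * (f y * ?k y) + a\<^sup>2 * ?k y \<partial>m)"
      unfolding kernel_op_eq by (simp add: power2_eq_square algebra_simps)
    also have "\<dots> = P s (\<lambda>y. f y * f y) x - 2 * a * P s f x + a\<^sup>2 * mass s x"
      using i by (simp add: kernel_op_eq mass_eq)
    \<comment> \<open>The mass at time \<open>s\<close> is exchanged for the one at the fixed time
      \<open>t\<close>, so the last term stays put as \<open>s\<close> tends to 0.\<close>
    finally show ?thesis using mass_constant[OF s assms] by simp
  qed
  then have "\<forall>\<^sub>F s in at_right 0. 0 \<le> P s (\<lambda>y. f y * f y) x - 2 * a * P s f x + a\<^sup>2 * mass t x"
    by (auto simp: eventually_at_filter)
  moreover have "((\<lambda>s. P s (\<lambda>y. f y * f y) x - 2 * a * P s f x + a\<^sup>2 * mass t x)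
      \<longlongrightarrow> f x * f x - 2 * a * f x + a\<^sup>2 * mass t x) (at_right 0)"
    by (intro tendsto_intros P_test_function_tendsto f ff assms(2))
  ultimately have "0 \<le> f x * f x - 2 * a * f x + a\<^sup>2 * mass t x"
    by (intro tendsto_lowerbound[of _ "f x * f x - 2 * a * f x + a\<^sup>2 * mass t x" "at_right 0"]) auto
  then have "0 \<le> a\<^sup>2 * (mass t x - 1)"
    by (simp add: a_def power2_eq_square algebra_simps)
  then show "1 \<le> mass t x"
    using f(2) by (simp add: a_def zero_le_mult_iff)
qed

end


section \<open>Strong Feller property and the resolvent of the constant function\<close>

context conservative_distorted_brownian
begin

section \<open>Bounded functions and the strong Feller property\<close>

lemma P_bounded_integrable:
  assumes "f \<in> borel_measurable borel" "\<And>y. \<bar>f y\<bar> \<le> C" "0 < t" "x \<in> E"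
  shows "integrable m (\<lambda>y. f y * on_E (p_t t) x y)"
proof (rule Bochner_Integration.integrable_bound)
  note k = kernel_density_on_E[OF p_kernel[OF \<open>0 < t\<close>] \<open>x \<in> E\<close>]
  show "integrable m (\<lambda>y. C * on_E (p_t t) x y)"
    using p_t_integrable[OF assms(3,4)] by simp
  show "(\<lambda>y. f y * on_E (p_t t) x y) \<in> borel_measurable m"
    using assms(1) k(1) by simp
  have "\<bar>f y * on_E (p_t t) x y\<bar> \<le> \<bar>C * on_E (p_t t) x y\<bar>" for y
    using assms(2)[of y] k(2)[of y] by (simp add: abs_mult mult_right_mono)
  then show "AE y in m. norm (f y * on_E (p_t t) x y) \<le> norm (C * on_E (p_t t) x y)" by simp
qed

lemma P_bounded:
  assumes f: "f \<in> borel_measurable borel" "\<And>y. \<bar>f y\<bar> \<le> C" and t: "0 < t" and x: "x \<in> E"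
  shows "\<bar>P t f x\<bar> \<le> C"
proof -
  note k = kernel_density_on_E[OF p_kernel[OF t] x]
  have "\<bar>P t f x\<bar> \<le> (\<integral>y. \<bar>f y * on_E (p_t t) x y\<bar> \<partial>m)"
    unfolding kernel_op_eq by (rule integral_abs_bound)
  also have "\<dots> \<le> (\<integral>y. C * on_E (p_t t) x y \<partial>m)"
  proof (rule integral_mono)
    show "\<bar>f y * on_E (p_t t) x y\<bar> \<le> C * on_E (p_t t) x y" for y
      using f(2)[of y] k(2)[of y] by (simp add: abs_mult mult_right_mono)
  qed (use P_bounded_integrable[OF f t x] p_t_integrable[OF t x] in \<open>auto intro!: integrable_abs\<close>)
  also have "\<dots> = C"
    using mass_eq_1[OF t x] by (simp add: mass_eq)
  finally show ?thesis .
qed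

text \<open>The error is at most \<open>C\<close> times the mass outside the ball. By
  conservativeness at \<open>x\<close> that mass is \<open>1 - P t (ball_indicator n) x\<close>, a
  continuous function of \<open>x\<close>.\<close>

lemma P_truncation_error:
  assumes f: "f \<in> borel_measurable borel" "\<And>y. \<bar>f y\<bar> \<le> C" and t: "0 < t" and x: "x \<in> E"
  shows "\<bar>P t f x - P t (\<lambda>y. f y * ball_indicator n y) x\<bar> \<le> C * (1 - P t (ball_indicator n) x)"
proof -
  note k = kernel_density_on_E[OF p_kernel[OF t] x]
  let ?k = "on_E (p_t t) x" and ?g = "ball_indicator n :: 'a \<Rightarrow> real"
  have i: "integrable m (\<lambda>y. f y * ?k y)" "integrable m (\<lambda>y. f y * ?g y * ?k y)"
      "integrable m (\<lambda>y. ?g y * ?k y)" "integrable m ?k"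
    using P_bounded_integrable[OF f t x] p_t_integrable[OF t x]
      P_props(1)[OF ball_indicator_mult_Lp[OF f p_pos] t x]
      P_props(1)[OF ball_indicator_Lp[OF p_pos] t x] by auto
  have "P t f x - P t (\<lambda>y. f y * ?g y) x = (\<integral>y. f y * ?k y - f y * ?g y * ?k y \<partial>m)"
    using i by (simp add: kernel_op_eq)
  then have "\<bar>P t f x - P t (\<lambda>y. f y * ?g y) x\<bar> \<le> (\<integral>y. \<bar>f y * ?k y - f y * ?g y * ?k y\<bar> \<partial>m)"
    by (simp only: integral_abs_bound)
  also have "\<dots> \<le> (\<integral>y. C * (?k y - ?g y * ?k y) \<partial>m)"
  proof (rule integral_mono)
    have le: "\<bar>a * b - a * c * b\<bar> \<le> C * (b - c * b)" if "\<bar>a\<bar> \<le> C" "0 \<le> b" "c \<le> 1" for a b c :: real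
    proof -
      have nonneg: "0 \<le> (1 - c) * b" using that by simp
      have eq: "a * b - a * c * b = a * ((1 - c) * b)" "C * (b - c * b) = C * ((1 - c) * b)"
        by (simp_all add: algebra_simps)
      show ?thesis
        unfolding eq abs_mult[of a] abs_of_nonneg[OF nonneg]
        by (rule mult_right_mono[OF that(1) nonneg])
    qed
    show "\<bar>f y * ?k y - f y * ?g y * ?k y\<bar> \<le> C * (?k y - ?g y * ?k y)" for y
      by (rule le[OF f(2) k(2) ball_indicator_bounds(2)])
  qed (use i in auto)
  also have "\<dots> = C * (1 - P t ?g x)"
    using i mass_eq_1[OF t x] by (simp add: kernel_op_eq mass_eq)
  finally show ?thesis .
qed

theorem strong_Feller:
  assumes f: "f \<in> borel_measurable borel" "\<And>y. \<bar>f y\<bar> \<le> C" and t: "0 < t"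
  shows "continuous_on E (P t f)"
  unfolding continuous_on_def
proof (intro ballI tendstoI)
  fix x and e :: real assume x: "x \<in> E" and "0 < e"
  have "0 \<le> C" using f(2)[of x] by linarith
  \<comment> \<open>Escaping mass below \<open>d\<close> costs at most
    \<open>C * d \<le> e / 4\<close> at each of the two points, and the continuity of the truncated
    function costs less than another \<open>e / 4\<close>. The radius \<open>n\<close> is fixed at
    \<open>x\<close> and serves all nearby \<open>y\<close>.\<close>
  define d where "d = e / (4 * (C + 1))"
  have "0 < d" using \<open>0 < e\<close> \<open>0 \<le> C\<close> by (simp add: d_def)
  have Cd: "C * d \<le> e / 4"
  proof -
    have "C * d \<le> (C + 1) * d" using \<open>0 < d\<close> by (intro mult_right_mono) auto
    also have "(C + 1) * d = e / 4" using \<open>0 \<le> C\<close> by (simp add: d_def field_simps)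
    finally show ?thesis .
  qed
  have "(\<lambda>n. P t (ball_indicator n) x) \<longlonglongrightarrow> 1"
    using P_ball_indicator_tendsto[OF t x] mass_eq_1[OF t x] by simp
  then have "\<forall>\<^sub>F n in sequentially. 1 - d < P t (ball_indicator n) x"
    using \<open>0 < d\<close> by (intro order_tendstoD) auto
  then obtain n where n: "1 - d < P t (ball_indicator n) x"
    by (auto simp: eventually_sequentially)
  let ?g = "ball_indicator n :: 'a \<Rightarrow> real" and ?f = "\<lambda>y. f y * ball_indicator n y"
  have "((\<lambda>y. P t ?g y) \<longlongrightarrow> P t ?g x) (at x within E)" "((\<lambda>y. P t ?f y) \<longlongrightarrow> P t ?f x) (at x within E)"
    using P_props(2)[OF ball_indicator_Lp[OF p_pos] t] P_props(2)[OF ball_indicator_mult_Lp[OF f p_pos] t] x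
    unfolding continuous_on_def by blast+
  then have "\<forall>\<^sub>F y in at x within E. 1 - d < P t ?g y" "\<forall>\<^sub>F y in at x within E. dist (P t ?f y) (P t ?f x) < e / 4"
    using n \<open>0 < e\<close> by (blast intro: order_tendstoD, intro tendstoD) simp_all
  moreover have "\<forall>\<^sub>F y in at x within E. y \<in> E"
    by (simp add: eventually_at_filter)
  ultimately show "\<forall>\<^sub>F y in at x within E. dist (P t f y) (P t f x) < e"
  proof eventually_elim
    case (elim y)
    have err: "\<bar>P t f z - P t ?f z\<bar> \<le> e / 4" if "1 - d < P t ?g z" "z \<in> E" for z
    proof -
      have "C * (1 - P t ?g z) \<le> C * d" using that \<open>0 \<le> C\<close> by (intro mult_left_mono) auto
      with P_truncation_error[OF f t that(2), of n] Cd show ?thesis by linarith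
    qed
    show ?case
      using err[OF n x] err[OF elim(1,3)] elim(2) \<open>0 < e\<close> unfolding dist_real_def by linarith
  qed
qed

section \<open>The resolvent of the constant function\<close>

lemma R_ball_indicator_le:
  assumes "0 < \<alpha>" "x \<in> E"
  shows "\<alpha> * R \<alpha> (ball_indicator n) x \<le> 1"
proof (rule le_on_E_if_AE_le[OF _ _ _ \<open>x \<in> E\<close>])
  let ?g = "ball_indicator n :: 'a \<Rightarrow> real"
  have g: "?g \<in> Lp 2 m" "?g \<in> Lp p m" by (simp_all add: ball_indicator_Lp p_pos)
  show "continuous_on E (\<lambda>x. \<alpha> * R \<alpha> ?g x)"
    by (intro continuous_intros R_props(2) g \<open>0 < \<alpha>\<close>)
  define u where "u = G \<alpha> ?g"
  have u: "u \<in> Lp 2 m" unfolding u_def using g \<open>0 < \<alpha>\<close> by (intro G_Lp) auto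
  have um: "u \<in> borel_measurable borel" using Lp_2_measurable[OF u] by simp
  \<comment> \<open>The excess of \<open>\<alpha> u\<close> over 1 is the test function:
    \<open>\<alpha> u - 1\<close> tested against it gives its squared norm, which
    \<open>resolvent_le\<close> makes nonpositive.\<close>
  define v where "v y = max 0 (\<alpha> * u y - 1)" for y
  have vm: "v \<in> borel_measurable borel" unfolding v_def[abs_def] using um by measurable
  have v2: "v \<in> Lp 2 m"
    by (rule Lp_2_bound[OF Lp_2_cmult[OF u, of \<alpha>]]) (use vm in \<open>auto simp: v_def\<close>)
  have vi: "integrable m v"
  proof (rule Bochner_Integration.integrable_bound)
    show "integrable m (\<lambda>y. (\<alpha> * u y)\<^sup>2)" using Lp_2_cmult[OF u, of \<alpha>] by (simp add: Lp_2_iff)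
    \<comment> \<open>Where \<open>v\<close> is nonzero, \<open>\<alpha> * u y\<close> exceeds 1 and
      lies below its own square; this makes \<open>v\<close> integrable although \<open>u\<close> is
      only known to be in \<open>L\<^sup>2\<close>.\<close>
    have "\<bar>v y\<bar> \<le> (\<alpha> * u y)\<^sup>2" for y
    proof (cases "\<alpha> * u y \<le> 1")
      case False
      then have "\<alpha> * u y * 1 \<le> \<alpha> * u y * (\<alpha> * u y)" by (intro mult_left_mono) auto
      then show ?thesis using False by (simp add: v_def power2_eq_square)
    qed (simp add: v_def)
    then show "AE y in m. norm (v y) \<le> norm ((\<alpha> * u y)\<^sup>2)" by simp
  qed (use vm in simp)
  have "\<alpha> * L2_inner m u v \<le> integral\<^sup>L m v"
  proof (rule resolvent_le)
    show "has_generator_value m T u (\<lambda>y. \<alpha> * u y - ?g y)"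
      unfolding u_def by (rule G_generator[OF \<open>0 < \<alpha>\<close> g(1)])
    show "AE y in m. orbit T s ?g y \<le> 1" if "0 \<le> s" for s
    proof (cases "s = 0")
      case False
      with that have "0 < s" by simp
      then have "AE y in m. \<bar>T s ?g y\<bar> \<le> 1"
        using g by (intro T_bounded) (auto simp: ball_indicator_bounds)
      then show ?thesis using \<open>0 < s\<close> by (auto elim: eventually_mono)
    qed (simp add: ball_indicator_bounds)
  qed (use g v2 vi \<open>0 < \<alpha>\<close> in \<open>auto simp: v_def\<close>)
  moreover have "\<alpha> * L2_inner m u v - integral\<^sup>L m v = (\<integral>y. (v y)\<^sup>2 \<partial>m)"
  proof -
    have "\<alpha> * L2_inner m u v - integral\<^sup>L m v = (\<integral>y. \<alpha> * (u y * v y) - v y \<partial>m)"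
      using Lp_2_integrable_mult[OF u v2] vi by (simp add: L2_inner_def)
    also have "\<dots> = (\<integral>y. (v y)\<^sup>2 \<partial>m)"
      by (rule Bochner_Integration.integral_cong) (auto simp: v_def max_def power2_eq_square algebra_simps)
    finally show ?thesis .
  qed
  ultimately have "(Lp_norm 2 m v)\<^sup>2 \<le> 0" by (simp add: Lp_norm_2_power2)
  then have "AE y in m. v y = 0" using Lp_norm_2_eq_0_iff[OF v2] by simp
  with R_props(3)[OF g(2) \<open>0 < \<alpha>\<close>] show "AE y in m. \<alpha> * R \<alpha> ?g y \<le> 1"
    by eventually_elim (simp add: u_def v_def max_def split: if_splits)
qed simp

text \<open>The resolvent densities come without a bound on their total mass. Monotone convergence
  along the balls, with the uniform bound \<open>1 / \<alpha>\<close>, supplies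
  integrability.\<close>

lemma R_1:
  assumes "0 < \<alpha>" "x \<in> E"
  shows "integrable m (on_E (r_l \<alpha>) x)"
    and "(\<lambda>n. R \<alpha> (ball_indicator n) x) \<longlonglongrightarrow> R \<alpha> (\<lambda>_. 1) x"
    and "R \<alpha> (ball_indicator n) x \<le> R \<alpha> (\<lambda>_. 1) x"
proof -
  note k = kernel_density_on_E[OF r_kernel[OF \<open>0 < \<alpha>\<close>] \<open>x \<in> E\<close>]
  let ?k = "on_E (r_l \<alpha>) x"
  have i: "integrable m (\<lambda>y. ball_indicator n y * ?k y)" for n
    by (rule R_props(1)[OF ball_indicator_Lp[OF p_pos] assms])
  have mono: "ball_indicator n y * ?k y \<le> ball_indicator n' y * ?k y" if "n \<le> n'" for n n' y
    by (intro mult_right_mono ball_indicator_mono that k(2))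
  have inc: "incseq (\<lambda>n. R \<alpha> (ball_indicator n) x)"
    unfolding kernel_op_eq by (intro incseq_SucI integral_mono i mono) simp
  have bd: "R \<alpha> (ball_indicator n) x \<le> 1 / \<alpha>" for n
    using R_ball_indicator_le[OF assms, of n] \<open>0 < \<alpha>\<close> by (simp add: field_simps)
  obtain l where l: "(\<lambda>n. R \<alpha> (ball_indicator n) x) \<longlonglongrightarrow> l"
    by (rule incseq_convergent[OF inc, of "1 / \<alpha>"]) (use bd in auto)
  have conv: "(\<lambda>n. ball_indicator n y * ?k y) \<longlonglongrightarrow> ?k y" for y
    using tendsto_mult_right[OF ball_indicator_tendsto[of y], of "?k y"] by simp
  have *: "has_bochner_integral m ?k l"
    by (rule has_bochner_integral_monotone_convergence[OF i])
      (use mono conv l k in \<open>auto simp: kernel_op_eq mono_def\<close>)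
  then show "integrable m ?k" by (rule integrable.intros)
  have "R \<alpha> (\<lambda>_. 1) x = l"
    using has_bochner_integral_integral_eq[OF *] by (simp add: kernel_op_eq)
  with l show lim: "(\<lambda>n. R \<alpha> (ball_indicator n) x) \<longlonglongrightarrow> R \<alpha> (\<lambda>_. 1) x" by simp
  show "R \<alpha> (ball_indicator n) x \<le> R \<alpha> (\<lambda>_. 1) x"
    by (rule incseq_le[OF inc lim])
qed

lemma R_1_le: "0 < \<alpha> \<Longrightarrow> x \<in> E \<Longrightarrow> \<alpha> * R \<alpha> (\<lambda>_. 1) x \<le> 1"
proof -
  assume a: "0 < \<alpha>" "x \<in> E"
  have "(\<lambda>n. \<alpha> * R \<alpha> (ball_indicator n) x) \<longlonglongrightarrow> \<alpha> * R \<alpha> (\<lambda>_. 1) x"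
    by (intro tendsto_intros R_1 a)
  then show ?thesis
    by (rule tendsto_upperbound) (use R_ball_indicator_le[OF a] in auto)
qed

lemma G_ball_indicator:
  assumes "0 < \<alpha>"
  shows "AE x in m. \<forall>n. G \<alpha> (ball_indicator n) x = R \<alpha> (ball_indicator n) x"
  unfolding AE_all_countable
proof
  fix n
  show "AE x in m. G \<alpha> (ball_indicator n) x = R \<alpha> (ball_indicator n) x"
    using R_props(3)[OF ball_indicator_Lp[OF p_pos] assms, of n] by eventually_elim simp
qed

text \<open>With \<open>U = R \<alpha> 1\<close>, the function \<open>1 - \<alpha> U\<close> is
  nonnegative, while \<open>resolvent_ge_limit\<close> makes its integral over each ball
  nonpositive. So it vanishes almost everywhere.\<close>

lemma G_ball_indicator_tendsto:
  assumes "0 < \<alpha>"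
  shows "AE x in m. (\<lambda>n. G \<alpha> (ball_indicator n) x) \<longlonglongrightarrow> 1 / \<alpha>"
proof -
  let ?g = "ball_indicator :: nat \<Rightarrow> 'a \<Rightarrow> real"
  \<comment> \<open>Nothing is known about the kernel at points outside \<open>E\<close>; the value
    0 there keeps \<open>U\<close> measurable and within its bounds everywhere.\<close>
  define U where "U x = (if x \<in> E then R \<alpha> (\<lambda>_. 1) x else 0)" for x
  have g: "?g n \<in> Lp 2 m" "?g n \<in> Lp p m" for n by (simp_all add: ball_indicator_Lp p_pos)
  have G: "G \<alpha> (?g n) \<in> Lp 2 m" "G \<alpha> (?g n) \<in> Lp p m" for n
    using g p_ge_2 assms by (auto intro: G_Lp)
  have G_le: "AE x in m. G \<alpha> (?g n) x \<le> U x" for n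
    using G_ball_indicator[OF assms] AE_m_E
    by eventually_elim (simp add: U_def R_1(3)[OF assms])
  have G_pos: "AE x in m. 0 \<le> G \<alpha> (?g n) x" for n
    using G_ball_indicator[OF assms] AE_m_E
    by eventually_elim (simp add: kernel_op_nonneg[OF r_kernel[OF assms]] ball_indicator_bounds)
  have U_bounds: "0 \<le> U x" "\<alpha> * U x \<le> 1" for x
    using R_1_le[OF assms, of x] kernel_op_nonneg[OF r_kernel[OF assms], of x "\<lambda>_. 1"]
    by (auto simp: U_def)
  have Um: "U \<in> borel_measurable borel"
  proof (rule borel_measurable_LIMSEQ_real)
    show "(\<lambda>n. if x \<in> E then R \<alpha> (?g n) x else 0) \<longlonglongrightarrow> U x" for x
      using R_1(2)[OF assms, of x] by (simp add: U_def)
    have "(\<lambda>x. if x \<in> E then R \<alpha> (?g n) x else 0) \<in> borel_measurable borel" for n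
      by (rule borel_measurable_continuous_on_if)
        (use R_props(2)[OF g(2) assms] in \<open>auto intro: continuous_intros\<close>)
    then show "(\<lambda>x. if x \<in> E then R \<alpha> (?g n) x else 0) \<in> borel_measurable borel" for n .
  qed
  have "AE x in m. ?g k x * (1 - \<alpha> * U x) = 0" for k
  proof -
    have iU: "integrable m (\<lambda>x. U x * ?g k x)"
    proof (rule Bochner_Integration.integrable_bound)
      show "integrable m (\<lambda>x. (1 / \<alpha>) * ?g k x)"
        by (intro integrable_mult_right ball_indicator_integrable)
      have "\<bar>U x\<bar> \<le> 1 / \<alpha>" for x
        using U_bounds[of x] assms by (simp add: field_simps)
      then have "\<bar>U x * ?g k x\<bar> \<le> \<bar>(1 / \<alpha>) * ?g k x\<bar>" for x
        using assms by (simp only: abs_mult) (intro mult_right_mono, auto)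
      then show "AE x in m. norm (U x * ?g k x) \<le> norm ((1 / \<alpha>) * ?g k x)" by simp
    qed (use Um in simp)
    have "integral\<^sup>L m (?g k) \<le> \<alpha> * (\<integral>x. U x * ?g k x \<partial>m)"
    proof (rule resolvent_ge_limit)
      show "has_generator_value m T (G \<alpha> (?g n)) (\<lambda>x. \<alpha> * G \<alpha> (?g n) x - ?g n x)" for n
        by (rule G_generator[OF assms g(1)])
      show "AE x in m. \<bar>orbit T s (?g n) x\<bar> \<le> 1" if "0 \<le> s" for n s
      proof (cases "s = 0")
        case False
        then show ?thesis
          using that g T_bounded[of "?g n" 1 s] by (simp add: ball_indicator_bounds)
      qed (simp add: ball_indicator_bounds)
      show "AE x in m. (\<lambda>n. orbit T s (?g n) x) \<longlonglongrightarrow> 1" if "0 \<le> s" for s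
      proof (cases "s = 0")
        case False
        with that have "0 < s" by simp
        from T_ball_indicator_tendsto_mass[OF this] mass_AE_1[OF this] show ?thesis
          by eventually_elim (use \<open>0 < s\<close> in simp)
      qed (simp add: ball_indicator_tendsto)
      show "AE x in m. 0 \<le> orbit T s (G \<alpha> (?g n)) x" if "0 \<le> s" for n s
        by (rule orbit_nonneg[OF G(2) G_pos that])
      show "L2_inner m (G \<alpha> (?g n)) (?g k) \<le> (\<integral>x. U x * ?g k x \<partial>m)" for n
        unfolding L2_inner_def
      proof (rule integral_mono_AE[OF Lp_2_integrable_mult[OF G(1) g(1)] iU])
        show "AE x in m. G \<alpha> (?g n) x * ?g k x \<le> U x * ?g k x"
          using G_le[of n] by eventually_elim (intro mult_right_mono ball_indicator_bounds)
      qed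
    qed (use g assms ball_indicator_integrable in \<open>auto simp: ball_indicator_bounds\<close>)
    moreover have "(\<integral>x. ?g k x * (1 - \<alpha> * U x) \<partial>m) = integral\<^sup>L m (?g k) - \<alpha> * (\<integral>x. U x * ?g k x \<partial>m)"
    proof -
      have "(\<integral>x. ?g k x * (1 - \<alpha> * U x) \<partial>m) = (\<integral>x. ?g k x - \<alpha> * (U x * ?g k x) \<partial>m)"
        by (simp add: algebra_simps)
      then show ?thesis using iU ball_indicator_integrable[of k] by simp
    qed
    moreover have nonneg: "0 \<le> ?g k x * (1 - \<alpha> * U x)" for x
      using U_bounds[of x] by (simp add: ball_indicator_bounds)
    then have "0 \<le> (\<integral>x. ?g k x * (1 - \<alpha> * U x) \<partial>m)" by simp
    ultimately have "(\<integral>x. ?g k x * (1 - \<alpha> * U x) \<partial>m) = 0" by linarith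
    moreover have "integrable m (\<lambda>x. ?g k x * (1 - \<alpha> * U x))"
    proof -
      have "integrable m (\<lambda>x. ?g k x - \<alpha> * (U x * ?g k x))"
        using iU ball_indicator_integrable[of k] by simp
      then show ?thesis by (simp add: algebra_simps)
    qed
    ultimately show ?thesis
      using nonneg by (subst (asm) integral_nonneg_eq_0_iff_AE) auto
  qed
  then have "AE x in m. \<forall>k. ?g k x * (1 - \<alpha> * U x) = 0"
    unfolding AE_all_countable by blast
  then show ?thesis
    using G_ball_indicator[OF assms] AE_m_E
  proof eventually_elim
    case (elim x)
    have "(\<lambda>k. ?g k x * (1 - \<alpha> * U x)) \<longlonglongrightarrow> 1 * (1 - \<alpha> * U x)"
      by (intro tendsto_intros ball_indicator_tendsto)
    then have "1 - \<alpha> * U x = 0"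
      using elim(1) by (simp add: LIMSEQ_const_iff)
    then have "R \<alpha> (\<lambda>_. 1) x = 1 / \<alpha>"
      using assms elim(3) by (simp add: U_def field_simps)
    then show ?case using R_1(2)[OF assms elim(3)] elim(2) by simp
  qed
qed

theorem R_1_eq:
  assumes "0 < \<alpha>" "x \<in> E"
  shows "\<alpha> * R \<alpha> (\<lambda>_. 1) x = 1"
proof (rule antisym[OF R_1_le[OF assms]])
  let ?g = "ball_indicator :: nat \<Rightarrow> 'a \<Rightarrow> real"
  have g: "?g n \<in> Lp 2 m" "?g n \<in> Lp p m" for n by (simp_all add: ball_indicator_Lp p_pos)
  have "exp (- \<alpha> * t) * (1 / \<alpha>) \<le> R \<alpha> (\<lambda>_. 1) x" if t: "0 < t" for t
  proof -
    \<comment> \<open>Excessiveness is available for the truncations only, so \<open>P t\<close> is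
      applied to their resolvents, which are bounded by \<open>1 / \<alpha>\<close> and converge
      almost everywhere; this suffices at every \<open>x\<close>, as \<open>P t\<close> has a
      density.\<close>
    have "(\<lambda>n. P t (G \<alpha> (?g n)) x) \<longlonglongrightarrow> P t (\<lambda>_. 1 / \<alpha>) x"
    proof (rule P_tendsto[where C = "1 / \<alpha>", OF t \<open>x \<in> E\<close>])
      show "G \<alpha> (?g n) \<in> borel_measurable borel" for n
        using Lp_measurable[OF G_Lp[OF \<open>0 < \<alpha>\<close> _ g(1), of n]] by simp
      show "AE y in m. \<bar>G \<alpha> (?g n) y\<bar> \<le> 1 / \<alpha>" for n
        using G_ball_indicator[OF \<open>0 < \<alpha>\<close>] AE_m_E
      proof eventually_elim
        case (elim y)
        have "0 \<le> R \<alpha> (?g n) y"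
          by (rule kernel_op_nonneg[OF r_kernel[OF \<open>0 < \<alpha>\<close>] elim(2)]) (simp add: ball_indicator_bounds)
        then show ?case
          using R_ball_indicator_le[OF \<open>0 < \<alpha>\<close> elim(2), of n] elim(1) \<open>0 < \<alpha>\<close> by (simp add: field_simps)
      qed
    qed (use G_ball_indicator_tendsto[OF \<open>0 < \<alpha>\<close>] in auto)
    then have "(\<lambda>n. exp (- \<alpha> * t) * P t (G \<alpha> (?g n)) x) \<longlonglongrightarrow> exp (- \<alpha> * t) * P t (\<lambda>_. 1 / \<alpha>) x"
      by (intro tendsto_intros)
    moreover have "P t (\<lambda>_. 1 / \<alpha>) x = 1 / \<alpha>"
      using mass_eq_1[OF t \<open>x \<in> E\<close>] by (simp add: kernel_op_eq mass_eq)
    moreover have "exp (- \<alpha> * t) * P t (G \<alpha> (?g n)) x \<le> R \<alpha> (\<lambda>_. 1) x" for n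
    proof -
      have "exp (- \<alpha> * t) * P t (G \<alpha> (?g n)) x \<le> R \<alpha> (?g n) x"
        by (rule R_excessive) (use g t assms in \<open>auto simp: ball_indicator_bounds\<close>)
      also have "\<dots> \<le> R \<alpha> (\<lambda>_. 1) x" by (rule R_1(3)[OF assms])
      finally show ?thesis .
    qed
    ultimately show ?thesis
      by (intro tendsto_upperbound[of _ "exp (- \<alpha> * t) * (1 / \<alpha>)" sequentially]) auto
  qed
  then have "\<forall>\<^sub>F t in at_right 0. exp (- \<alpha> * t) * (1 / \<alpha>) \<le> R \<alpha> (\<lambda>_. 1) x"
    by (auto simp: eventually_at_filter)
  moreover have "((\<lambda>t. exp (- \<alpha> * t) * (1 / \<alpha>)) \<longlongrightarrow> 1 * (1 / \<alpha>)) (at_right 0)"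
    by (intro tendsto_intros exp_at_right_0)
  ultimately have "1 * (1 / \<alpha>) \<le> R \<alpha> (\<lambda>_. 1) x"
    by (intro tendsto_upperbound[of _ "1 * (1 / \<alpha>)" "at_right (0::real)"]) auto
  then show "1 \<le> \<alpha> * R \<alpha> (\<lambda>_. 1) x"
    using \<open>0 < \<alpha>\<close> by (simp add: field_simps)
qed

end

theorem proposition2p9:
  fixes \<rho> :: "'a::euclidean_space \<Rightarrow> real"
    and B :: "'a \<Rightarrow> 'a"
    and \<epsilon> p :: real
    and T G :: "real \<Rightarrow> ('a \<Rightarrow> real) \<Rightarrow> 'a \<Rightarrow> real"
    and p_t r_l :: "real \<Rightarrow> 'a \<Rightarrow> 'a \<Rightarrow> real"
  assumes "\<epsilon> > 0"
    and "p = max (real DIM('a) + \<epsilon>) 2"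
    and "continuous_on UNIV \<rho>"
    and "H1 p \<rho>"
    and "H2 p \<rho> B"
    and "H3 \<rho> B"
    and "is_semigroup_of_form \<rho> B T"
    and "is_resolvent_of_form \<rho> B G"
    and "is_transition_density p \<rho> T p_t"
    and "is_resolvent_density p \<rho> G r_l"
    and "H4 \<rho> T"
  shows "(\<forall>\<alpha>>0. \<forall>x\<in>E_of \<rho>. \<alpha> * kernel_op (mE_of \<rho>) (r_l \<alpha>) (\<lambda>_. 1) x = 1) \<and>
         (\<forall>t>0. \<forall>f\<in>borel_measurable borel. bounded (range f) \<longrightarrow>
            continuous_on (E_of \<rho>) (kernel_op (mE_of \<rho>) (p_t t) f) \<and>
            bounded (kernel_op (mE_of \<rho>) (p_t t) f ` E_of \<rho>)) \<and>
         (\<forall>t>0. \<forall>x\<in>E_of \<rho>. kernel_op (mE_of \<rho>) (p_t t) (\<lambda>_. 1) x = 1)"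
proof -
  obtain w where w: "has_weak_gradient \<rho> w" "(\<lambda>x. norm (w x) / \<rho> x) \<in> Lp_loc p (m_of \<rho>)"
    using \<open>H1 p \<rho>\<close> by (auto simp: H1_def)
  interpret conservative_distorted_brownian \<rho> w B p T G p_t r_l
    by unfold_locales (use assms w in \<open>auto simp: H1_def\<close>)
  have "continuous_on E (P t f)" "bounded (P t f ` E)"
    if t: "0 < t" and f: "f \<in> borel_measurable borel" "bounded (range f)" for t f
  proof -
    obtain C where C: "\<And>y. \<bar>f y\<bar> \<le> C"
      using f(2) by (auto simp: bounded_iff)
    show "continuous_on E (P t f)" by (rule strong_Feller[OF f(1) C t])
    show "bounded (P t f ` E)"
      using P_bounded[OF f(1) C t] by (auto simp: bounded_iff)
  qed
  then show ?thesis
    using R_1_eq mass_eq_1 unfolding mass_def by blast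
qed

end
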